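(* Let $m\ge2$ and let $0=k_0<k_1<\cdots<k_m=n$ be integers. For each $j\in\{1,2,\ldots,m\}$, let $f_j\in\mathbb{C}[z_{k_{j-1}+1},z_{k_{j-1}+2},\ldots,z_{k_j}]$ be a polynomial with $f_j(0)=0$. Regard $f_1,\ldots,f_m$ as polynomials in $\mathbb{C}[z_1,\ldots,z_n]$. Then, for $\varepsilon>0$ sufficiently small, the Milnor fibration product map $\Phi:S_\varepsilon\setminus K_{f_1f_2\cdots f_m}\to T^m$ associated with $f_1,f_2,\ldots,f_m$ has no singular point.
   Context: $S_\varepsilon=\{z\in\mathbb{C}^n\mid \|z\|=\varepsilon\}$ and $K_{f_1\cdots f_m}=\{z\in S_\varepsilon\mid f_1(z)\cdots f_m(z)=0\}$. The Milnor fibration product map associated with $f_1,\ldots,f_m$ is the $C^\infty$ map $\Phi:S_\varepsilon\setminus K_{f_1\cdots f_m}\to (S^1)^m=T^m$, $\Phi(z)=\left(\frac{f_1(z)}{|f_1(z)|},\ldots,\frac{f_m(z)}{|f_m(z)|}\right)$. A point $p$ is a singular point of $\Phi$ if $\mathrm{rank}\,d\Phi_p<m$. "For $\varepsilon>0$ sufficiently small" means: there is $\varepsilon_0>0$ (depending on the $f_j$) such that the assertion holds for all $0<\varepsilon\le\varepsilon_0$. *)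

theory Defs
  imports "HOL-Analysis.Analysis" "HOL-Library.Poly_Mapping"
begin

(* Polynomials in the countably many variables z_1, z_2, ...: finitely supported
   families of coefficients indexed by finitely supported exponent vectors. *)
type_synonym cpoly = "(nat \<Rightarrow>\<^sub>0 nat) \<Rightarrow>\<^sub>0 complex"

definition poly_vars :: "cpoly \<Rightarrow> nat set" where
  "poly_vars P = (\<Union>a\<in>Poly_Mapping.keys P. Poly_Mapping.keys a)"

(* ix enumerates the coordinates of C^n: the variable z_i takes the value z $ ix i. *)
definition poly_eval :: "(nat \<Rightarrow> 'n) \<Rightarrow> cpoly \<Rightarrow> complex ^ 'n \<Rightarrow> complex" where
  "poly_eval ix P z = (\<Sum>a\<in>Poly_Mapping.keys P. Poly_Mapping.lookup P a * (\<Prod>i\<in>Poly_Mapping.keys a. (z $ ix i) ^ Poly_Mapping.lookup a i))"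

definition milnor_link ::
    "(nat \<Rightarrow> 'n::finite) \<Rightarrow> nat \<Rightarrow> (nat \<Rightarrow> cpoly) \<Rightarrow> real \<Rightarrow> (complex ^ 'n) set" where
  "milnor_link ix m f \<epsilon> = {z \<in> sphere 0 \<epsilon>. (\<Prod>j=1..m. poly_eval ix (f j) z) = 0}"

(* jx numbers the factors of the torus, which is regarded as a subset of C^m. The same
   formula defines the map on the open set of C^n where no f_j vanishes. *)
definition milnor_product_map ::
    "(nat \<Rightarrow> 'n::finite) \<Rightarrow> ('m::finite \<Rightarrow> nat) \<Rightarrow> (nat \<Rightarrow> cpoly) \<Rightarrow> complex ^ 'n \<Rightarrow> complex ^ 'm" where
  "milnor_product_map ix jx f z =
     (\<chi> a. poly_eval ix (f (jx a)) z / complex_of_real (cmod (poly_eval ix (f (jx a)) z)))"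

(* Velocities at p of curves in M; for an embedded submanifold M this is T_p M,
   see tangent_space_sphere for the case needed here. *)
definition tangent_space :: "'a::euclidean_space set \<Rightarrow> 'a \<Rightarrow> 'a set" where
  "tangent_space M p =
     {v. \<exists>\<gamma>. \<gamma> 0 = p \<and> (\<forall>\<^sub>F t in at (0::real). \<gamma> t \<in> M) \<and> (\<gamma> has_vector_derivative v) (at 0)}"

(* Rank over the reals of the differential at p of the restriction of F to M, for F
   differentiable on a neighbourhood of p in the ambient space: that differential is the
   restriction to T_p M of the ambient derivative. *)
definition differential_rank ::
    "('a::euclidean_space \<Rightarrow> 'b::euclidean_space) \<Rightarrow> 'a set \<Rightarrow> 'a \<Rightarrow> nat" where
  "differential_rank F M p = dim (frechet_derivative F (at p) ` tangent_space M p)"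

definition milnor_singular_point ::
    "(nat \<Rightarrow> 'n::finite) \<Rightarrow> ('m::finite \<Rightarrow> nat) \<Rightarrow> nat \<Rightarrow> (nat \<Rightarrow> cpoly) \<Rightarrow> real \<Rightarrow> complex ^ 'n \<Rightarrow> bool" where
  "milnor_singular_point ix jx m f \<epsilon> p \<longleftrightarrow>
     p \<in> sphere 0 \<epsilon> - milnor_link ix m f \<epsilon> \<and>
     differential_rank (milnor_product_map ix jx f) (sphere 0 \<epsilon> - milnor_link ix m f \<epsilon>) p < m"

lemma tangent_space_sphere:
  fixes p :: "'a::euclidean_space"
  assumes "open U" "p \<in> U" "norm p = \<epsilon>" "\<epsilon> > 0"
  shows "tangent_space (sphere 0 \<epsilon> \<inter> U) p = {v. v \<bullet> p = 0}"
proof (intro equalityI subsetI)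
  fix v assume "v \<in> tangent_space (sphere 0 \<epsilon> \<inter> U) p"
  then obtain \<gamma> where g: "\<gamma> 0 = p" "\<forall>\<^sub>F t in at (0::real). \<gamma> t \<in> sphere 0 \<epsilon> \<inter> U"
      "(\<gamma> has_vector_derivative v) (at 0)"
    unfolding tangent_space_def by blast
  have "((\<lambda>t. \<gamma> t \<bullet> \<gamma> t) has_derivative (\<lambda>t. \<gamma> 0 \<bullet> (t *\<^sub>R v) + (t *\<^sub>R v) \<bullet> \<gamma> 0)) (at 0)"
    using g(3) unfolding has_vector_derivative_def by (intro has_derivative_inner)
  moreover have "((\<lambda>t. \<gamma> t \<bullet> \<gamma> t) has_derivative (\<lambda>t. 0)) (at 0)"
  proof (rule has_derivative_transform_eventually[OF has_derivative_const])
    show "\<forall>\<^sub>F t in at 0. \<epsilon>\<^sup>2 = \<gamma> t \<bullet> \<gamma> t"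
      using g(2) by eventually_elim (simp add: dot_square_norm)
    show "\<epsilon>\<^sup>2 = \<gamma> 0 \<bullet> \<gamma> 0" using g(1) assms(3) by (simp add: dot_square_norm)
  qed simp
  ultimately have "(\<lambda>t. \<gamma> 0 \<bullet> (t *\<^sub>R v) + (t *\<^sub>R v) \<bullet> \<gamma> 0) = (\<lambda>t::real. 0)"
    by (rule has_derivative_unique)
  from fun_cong[OF this, of 1] show "v \<in> {v. v \<bullet> p = 0}"
    using g(1) by (simp add: inner_commute)
next
  fix v assume "v \<in> {v. v \<bullet> p = 0}"
  then have v: "v \<bullet> p = 0" by simp
  define r where "r = norm v / \<epsilon>"
  define u where "u = v /\<^sub>R r"
  define \<gamma> where "\<gamma> = (\<lambda>t. cos (r * t) *\<^sub>R p + sin (r * t) *\<^sub>R u)"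
  have ru: "r *\<^sub>R u = v" using assms(4) by (auto simp: u_def r_def)
  have d: "(\<gamma> has_vector_derivative v) (at 0)"
    unfolding \<gamma>_def by (auto intro!: derivative_eq_intros simp: ru)
  have c: "isCont \<gamma> 0"
    unfolding \<gamma>_def by (intro continuous_intros)
  have "norm (\<gamma> t) = \<epsilon>" for t
  proof -
    have up: "u \<bullet> p = 0" "p \<bullet> u = 0" using v by (simp_all add: u_def inner_commute)
    have "\<gamma> t \<bullet> \<gamma> t = (cos (r * t))\<^sup>2 * (p \<bullet> p) + (sin (r * t))\<^sup>2 * (u \<bullet> u)"
      by (simp add: \<gamma>_def inner_add_left inner_add_right up power2_eq_square)
    moreover have "(sin (r * t))\<^sup>2 * (u \<bullet> u) = (sin (r * t))\<^sup>2 * \<epsilon>\<^sup>2"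
    proof (cases "v = 0")
      case False
      then have "norm u = \<epsilon>" using assms(4) by (simp add: u_def r_def)
      then show ?thesis by (simp add: dot_square_norm)
    qed (simp add: r_def)
    moreover have "p \<bullet> p = \<epsilon>\<^sup>2" using assms(3) by (simp add: dot_square_norm)
    ultimately have "\<gamma> t \<bullet> \<gamma> t = ((cos (r * t))\<^sup>2 + (sin (r * t))\<^sup>2) * \<epsilon>\<^sup>2"
      by (simp only: distrib_right)
    then have "\<gamma> t \<bullet> \<gamma> t = \<epsilon>\<^sup>2" by simp
    then show ?thesis using assms(4) by (simp add: norm_eq_sqrt_inner)
  qed
  moreover have "\<forall>\<^sub>F t in at 0. \<gamma> t \<in> U"
    using c assms(1,2) by (intro topological_tendstoD[of \<gamma> "\<gamma> 0"]) (auto simp: isCont_def \<gamma>_def)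
  ultimately have "\<forall>\<^sub>F t in at 0. \<gamma> t \<in> sphere 0 \<epsilon> \<inter> U" by (auto elim: eventually_mono)
  then show "v \<in> tangent_space (sphere 0 \<epsilon> \<inter> U) p"
    unfolding tangent_space_def using d by (auto intro!: exI[of _ \<gamma>] simp: \<gamma>_def)
qed

lemma differentiable_poly_eval:
  fixes p :: "complex ^ 'n"
  shows "poly_eval ix P differentiable at p"
proof -
  have c: "(\<lambda>z :: complex ^ 'n. z $ i) differentiable at p" for i
    by (intro bounded_linear_imp_differentiable bounded_linear_vec_nth)
  have pr: "finite I \<Longrightarrow> (\<lambda>z :: complex ^ 'n. \<Prod>i\<in>I. z $ ix i ^ e i) differentiable at p" for I e
    by (induction I rule: finite_induct) (auto intro!: differentiable_mult differentiable_power c)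
  show ?thesis
    unfolding poly_eval_def[abs_def]
    by (intro differentiable_sum differentiable_mult differentiable_const pr ballI) simp_all
qed

lemma differentiable_milnor_product_map:
  fixes p :: "complex ^ 'n" and jx :: "'m::finite \<Rightarrow> nat"
  assumes "\<And>a. poly_eval ix (f (jx a)) p \<noteq> 0"
  shows "(milnor_product_map ix jx f :: complex ^ 'n \<Rightarrow> complex ^ 'm) differentiable at p"
proof -
  have "(\<lambda>z. poly_eval ix (f (jx a)) z / complex_of_real (cmod (poly_eval ix (f (jx a)) z)))
      differentiable at p" for a
  proof -
    let ?g = "poly_eval ix (f (jx a))"
    have g: "?g differentiable at p" by (rule differentiable_poly_eval)
    have "(\<lambda>z. cmod (?g z)) differentiable at p"
      using differentiable_compose[OF differentiable_norm_at g] assms[of a] by blast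
    then have "(\<lambda>z. complex_of_real (cmod (?g z))) differentiable at p"
      by (rule differentiable_compose[OF bounded_linear_imp_differentiable[OF bounded_linear_of_real]])
    with g show ?thesis
      using assms[of a] by (intro differentiable_divide) auto
  qed
  then show ?thesis
    unfolding milnor_product_map_def[abs_def]
    by (subst differentiable_componentwise_within)
      (auto simp: Basis_vec_def inner_axis intro!: differentiable_inner)
qed

lemma sphere_minus_milnor_link:
  "\<exists>U. open U \<and> sphere 0 \<epsilon> - milnor_link ix m f \<epsilon> = sphere 0 \<epsilon> \<inter> U"
proof -
  have "continuous_on UNIV (\<lambda>z. \<Prod>j=1..m. poly_eval ix (f j) z)"
    unfolding poly_eval_def by (intro continuous_intros)
  then have "open {z. (\<Prod>j=1..m. poly_eval ix (f j) z) \<noteq> 0}"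
    by (intro open_Collect_neq continuous_on_const)
  then show ?thesis
    by (intro exI[of _ "{z. (\<Prod>j=1..m. poly_eval ix (f j) z) \<noteq> 0}"]) (auto simp: milnor_link_def)
qed

end

theory Submission
  imports Defs "HOL-Computational_Algebra.Polynomial"
begin

text \<open>
  Write \<open>w\<^sub>j\<close> for the coordinates of \<open>p\<close> in the \<open>j\<close>-th block. At a singular point a nontrivial real
  combination of the gradients of the \<open>arg f\<^sub>j\<close> is a real multiple of \<open>p\<close>; since the blocks are
  disjoint, the gradient of some \<open>arg f\<^sub>j\<close> at \<open>w\<^sub>j\<close> is a real multiple of \<open>w\<^sub>j\<close>. By Milnor's lemma
  this is impossible close to the origin when \<open>f\<^sub>j(w\<^sub>j) \<noteq> 0\<close>.

  For Milnor's lemma, suppose that such points accumulate at the origin. They satisfy an open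
  polynomial condition \<open>g > 0\<close>. Maximizing \<open>g\<close> on the cube of radius \<open>\<epsilon>\<close> yields points that are
  algebraic over \<open>\<real>(\<epsilon>)\<close>: the maximizers of \<open>g - \<eta> \<Sum> x\<^sub>i^(2D)\<close> solve a system with leading terms
  \<open>x\<^sub>i^(2D+1)\<close>, and one lets \<open>\<eta>\<close> tend to zero. Following branches of roots gives a curve along which
  rational functions form a Hardy field. Along it the bounded functions (the direction of \<open>z\<close>, the
  argument of \<open>f\<close>) vary slowly compared with \<open>ln |z|\<close>, whereas \<open>ln |f|\<close> grows at least at a fixed rate;
  this contradicts \<open>g > 0\<close>.
\<close>

section \<open>Algebraicity over finite modules\<close>

text \<open>Points where the gradient of arg f is exactly radial form a real algebraic set, possibly
  of positive dimension and without interior, in which no curve is easily singled out. Relaxing the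
  equations to inequalities with tolerance 1/16 gives the single condition g > 0, and a maximizer of
  g on a cube that meets the set g > 0 satisfies it automatically. Maximizers need not be isolated.
  The even powers of high degree make the critical equations monic up to the factor \<eta>, so that
  each coordinate satisfies one algebraic equation valid for all radii. The maximizers are chosen
  without any continuity; but only finitely many combinations of root branches occur, and one of
  them recurs at arbitrarily small radii. Constant signs of germs turn this into a statement about
  all small radii. No exponents of power series are available, so growth is compared through
  logarithmic derivatives. The value 1/16 is not sharp: it only has to keep the ratio of the growth
  rates of ln |f| and ln |z| below 1/2, while f(0) = 0 forces this ratio above 1/2.\<close>

lemma fraction_free_dependence:
  fixes c :: "'i \<Rightarrow> 'b \<Rightarrow> 'r::idom"
  assumes "finite B" "finite I" "card B < card I"
  shows "\<exists>p. (\<exists>i\<in>I. p i \<noteq> 0) \<and> (\<forall>b\<in>B. (\<Sum>i\<in>I. p i * c i b) = 0)"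
  using assms
proof (induction B arbitrary: I c rule: finite_induct)
  case empty
  then obtain i where "i \<in> I" by fastforce
  then show ?case by (intro exI[of _ "\<lambda>_. 1"]) auto
next
  case (insert b B)
  show ?case
  proof (cases "\<forall>i\<in>I. c i b = 0")
    case True
    have "card B < card I" using insert.prems insert.hyps by simp
    from insert.IH[OF insert.prems(1) this, of c] True show ?thesis by auto
  next
    case False
    then obtain i0 where i0: "i0 \<in> I" "c i0 b \<noteq> 0" by blast
    let ?J = "I - {i0}"
    \<comment> \<open>Cross-multiplication with the pivot row \<open>i0\<close> clears column
      \<open>b\<close> without any division.\<close>
    define c' where "c' i \<beta> = c i0 b * c i \<beta> - c i b * c i0 \<beta>" for i \<beta>
    have "card B < card ?J" using insert.prems insert.hyps i0 by simp
    from insert.IH[OF _ this, of c'] insert.prems obtain p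
      where p: "\<exists>i\<in>?J. p i \<noteq> 0" "\<forall>\<beta>\<in>B. (\<Sum>i\<in>?J. p i * c' i \<beta>) = 0" by auto
    \<comment> \<open>The weight of the pivot row is forced by column \<open>b\<close>. The other
      weights are scaled by the nonzero pivot entry, so a nonzero \<open>p i\<close> stays nonzero
      in a domain.\<close>
    define q where "q i = (if i = i0 then - (\<Sum>i\<in>?J. p i * c i b) else c i0 b * p i)" for i
    have split: "(\<Sum>i\<in>I. q i * c i \<beta>) = (\<Sum>i\<in>?J. p i * c' i \<beta>)" for \<beta>
    proof -
      have "(\<Sum>i\<in>I. q i * c i \<beta>) = q i0 * c i0 \<beta> + (\<Sum>i\<in>?J. q i * c i \<beta>)"
        using insert.prems(1) i0(1) by (rule sum.remove)
      also have "(\<Sum>i\<in>?J. q i * c i \<beta>) = (\<Sum>i\<in>?J. c i0 b * p i * c i \<beta>)"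
        by (intro sum.cong) (auto simp: q_def)
      also have "q i0 * c i0 \<beta> = (\<Sum>i\<in>?J. - (p i * c i b * c i0 \<beta>))"
        by (simp add: q_def sum_distrib_right sum_negf)
      finally show ?thesis
        by (simp add: c'_def right_diff_distrib sum_subtractf sum_negf mult_ac)
    qed
    have "(\<Sum>i\<in>I. q i * c i b) = 0"
      unfolding split by (simp add: c'_def mult.commute)
    moreover have "\<exists>i\<in>I. q i \<noteq> 0" using p(1) i0 by (auto simp: q_def)
    ultimately show ?thesis using p(2) split by (intro exI[of _ q]) auto
  qed
qed

text \<open>The elements \<open>s\<close> index solutions of a polynomial system whose coefficients depend on parameters:
  \<open>ev s\<close> evaluates coefficients at the parameters of \<open>s\<close>, and \<open>x s\<close> are its coordinates.\<close>
locale coefficient_evaluation =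
  fixes ev :: "'s \<Rightarrow> 'r::idom \<Rightarrow> real" and x :: "'s \<Rightarrow> 'b \<Rightarrow> real" and I :: "'b set"
  assumes finite_I: "finite I"
    and ev_add: "ev s (c + c') = ev s c + ev s c'"
    and ev_mult: "ev s (c * c') = ev s c * ev s c'"
    and ev_1: "ev s 1 = 1"
begin

definition mon :: "('b \<Rightarrow> nat) \<Rightarrow> 's \<Rightarrow> real" where
  "mon \<alpha> s = (\<Prod>b\<in>I. x s b ^ \<alpha> b)"

definition deg :: "('b \<Rightarrow> nat) \<Rightarrow> nat" where
  "deg \<alpha> = (\<Sum>b\<in>I. \<alpha> b)"

text \<open>Polynomials in the coordinates of total degree below \<open>k\<close> are represented by
  the functions of \<open>s\<close> that they induce, with coefficients chosen in the ring
  independently of \<open>s\<close>. The bound is strict, so \<open>pspan 0\<close> contains only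
  zero.\<close>

inductive_set pspan :: "nat \<Rightarrow> ('s \<Rightarrow> real) set" for k where
  pspan_0: "(\<lambda>s. 0) \<in> pspan k"
| pspan_step: "h \<in> pspan k \<Longrightarrow> deg \<alpha> < k \<Longrightarrow> (\<lambda>s. ev s c * mon \<alpha> s + h s) \<in> pspan k"

lemma ev_0: "ev s 0 = 0"
  using ev_add[of s 0 0] by simp

lemma ev_power: "ev s (c ^ i) = ev s c ^ i"
  by (induction i) (simp_all add: ev_1 ev_mult)

lemma ev_sum: "ev s (sum c A) = (\<Sum>i\<in>A. ev s (c i))"
  by (induction A rule: infinite_finite_induct) (simp_all add: ev_0 ev_add)

lemma mon_add: "mon (\<lambda>b. \<alpha> b + \<beta> b) s = mon \<alpha> s * mon \<beta> s"
  by (simp add: mon_def power_add prod.distrib)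

lemma deg_add: "deg (\<lambda>b. \<alpha> b + \<beta> b) = deg \<alpha> + deg \<beta>"
  by (simp add: deg_def sum.distrib)

lemma mon_single: "b \<in> I \<Longrightarrow> mon (\<lambda>b'. if b' = b then k else 0) s = x s b ^ k"
  using finite_I by (simp add: mon_def if_distrib cong: if_cong)

lemma deg_single: "b \<in> I \<Longrightarrow> deg (\<lambda>b'. if b' = b then k else 0) = k"
  using finite_I by (simp add: deg_def)

lemma mon_zero: "mon (\<lambda>_. 0) s = 1"
  by (simp add: mon_def)

lemma deg_zero: "deg (\<lambda>_. 0) = 0"
  by (simp add: deg_def)

lemma pspan_mon: "deg \<alpha> < k \<Longrightarrow> (\<lambda>s. ev s c * mon \<alpha> s) \<in> pspan k"
  using pspan_step[OF pspan_0, of \<alpha> k c] by simp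

lemma pspan_const: "0 < k \<Longrightarrow> (\<lambda>s. ev s c) \<in> pspan k"
  using pspan_mon[of "\<lambda>_. 0" k c] by (simp add: mon_zero deg_zero)

lemma pspan_var_power: "b \<in> I \<Longrightarrow> i < k \<Longrightarrow> (\<lambda>s. x s b ^ i) \<in> pspan k"
  using pspan_mon[of "\<lambda>b'. if b' = b then i else 0" k 1] by (simp add: mon_single deg_single ev_1)

lemma pspan_add:
  assumes "h \<in> pspan k" "h' \<in> pspan k"
  shows "(\<lambda>s. h s + h' s) \<in> pspan k"
  using assms(1)
proof induction
  case (pspan_step h \<alpha> c)
  then show ?case using pspan.pspan_step[of "\<lambda>s. h s + h' s" k \<alpha> c] by (simp add: add.assoc)
qed (use assms in simp)

lemma pspan_sum:
  "(\<And>i. i \<in> A \<Longrightarrow> h i \<in> pspan k) \<Longrightarrow> (\<lambda>s. \<Sum>i\<in>A. h i s) \<in> pspan k"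
  by (induction A rule: infinite_finite_induct) (auto intro: pspan_0 pspan_add)

lemma pspan_mono: "h \<in> pspan k \<Longrightarrow> k \<le> l \<Longrightarrow> h \<in> pspan l"
  by (induction rule: pspan.induct) (auto intro: pspan.intros)

lemma pspan_mon_mult:
  assumes "h \<in> pspan k"
  shows "(\<lambda>s. ev s c * mon \<alpha> s * h s) \<in> pspan (k + deg \<alpha>)"
  using assms
proof induction
  case pspan_0
  then show ?case by (simp add: pspan.pspan_0)
next
  case (pspan_step h \<beta> c')
  have "(\<lambda>s. ev s (c * c') * mon (\<lambda>b. \<alpha> b + \<beta> b) s) \<in> pspan (k + deg \<alpha>)"
    using pspan_step by (intro pspan_mon) (simp add: deg_add)
  from pspan_add[OF this pspan_step.IH] show ?case
    by (simp add: ev_mult mon_add algebra_simps)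
qed

lemma pspan_mult:
  assumes "h \<in> pspan k" "h' \<in> pspan l"
  shows "(\<lambda>s. h s * h' s) \<in> pspan (k + l)"
  using assms(1)
proof induction
  case pspan_0
  then show ?case by (simp add: pspan.pspan_0)
next
  case (pspan_step h \<beta> c)
  have "(\<lambda>s. ev s c * mon \<beta> s * h' s) \<in> pspan (k + l)"
    using pspan_mono[OF pspan_mon_mult[OF assms(2)]] pspan_step.hyps by simp
  from pspan_add[OF this pspan_step.IH] show ?case by (simp add: algebra_simps)
qed

text \<open>Only the existence of some bound matters: the degree of the perturbation is chosen after
  it. Hypothesis \<open>const\<close> says that the ring of coefficients represents every real
  constant.\<close>

lemma pspan_polynomial:
  fixes X :: "'s \<Rightarrow> 'c::real_normed_vector"
  assumes "real_polynomial_function h"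
    and lin: "\<And>f. bounded_linear f \<Longrightarrow> \<exists>k. (\<lambda>s. f (X s)) \<in> pspan k"
    and const: "\<And>r. \<exists>c. \<forall>s. ev s c = r"
  shows "\<exists>k. (\<lambda>s. h (X s)) \<in> pspan k"
  using assms(1)
proof induction
  case (linear f)
  then show ?case by (rule lin)
next
  case (const r)
  then obtain c where "\<forall>s. ev s c = r" using assms(3) by blast
  then show ?case using pspan_const[of 1 c] by auto
next
  case (add f g)
  then obtain k l where "(\<lambda>s. f (X s)) \<in> pspan k" "(\<lambda>s. g (X s)) \<in> pspan l" by blast
  then show ?case
    by (intro exI[of _ "max k l"] pspan_add) (auto elim: pspan_mono)
next
  case (mult f g)
  then obtain k l where "(\<lambda>s. f (X s)) \<in> pspan k" "(\<lambda>s. g (X s)) \<in> pspan l" by blast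
  then show ?case by (intro exI) (rule pspan_mult)
qed

end

text \<open>The remainder may mix all coordinates, but its total degree is below \<open>d\<close>;
  this is what lets the rewriting of \<open>x s b ^ d\<close> terminate. The leading coefficient
  \<open>a\<close> need not be invertible and may evaluate to 0 at some \<open>s\<close>, so
  denominators are kept as powers of \<open>a\<close> on the other side of an equation.\<close>

locale monic_system = coefficient_evaluation ev x I
  for ev :: "'s \<Rightarrow> 'r::idom \<Rightarrow> real" and x :: "'s \<Rightarrow> 'b \<Rightarrow> real" and I :: "'b set" +
  fixes S :: "'s set" and a :: 'r and d :: nat
  assumes a_nonzero: "a \<noteq> 0"
    and relation: "b \<in> I \<Longrightarrow> \<exists>R\<in>pspan d. \<forall>s\<in>S. ev s a * x s b ^ d = R s"
begin

section \<open>Reduction modulo the monic relations\<close>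

definition reduced :: "('b \<Rightarrow> nat) set" where
  "reduced = (\<Pi>\<^sub>E b\<in>I. {..<d})"

text \<open>This is membership in the module spanned, after localization at \<open>a\<close>, by the
  finitely many monomials with all exponents below \<open>d\<close>; the denominator is multiplied
  out.\<close>

definition reducible :: "('s \<Rightarrow> real) \<Rightarrow> bool" where
  "reducible h \<longleftrightarrow> (\<exists>k c. \<forall>s\<in>S. ev s a ^ k * h s = (\<Sum>\<beta>\<in>reduced. ev s (c \<beta>) * mon \<beta> s))"

lemma finite_reduced: "finite reduced"
  unfolding reduced_def using finite_I by (intro finite_PiE) auto

lemma reducibleI:
  "(\<And>s. s \<in> S \<Longrightarrow> ev s a ^ k * h s = (\<Sum>\<beta>\<in>reduced. ev s (c \<beta>) * mon \<beta> s)) \<Longrightarrow> reducible h"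
  unfolding reducible_def by blast

lemma reducible_cong: "reducible h \<Longrightarrow> (\<And>s. s \<in> S \<Longrightarrow> h s = h' s) \<Longrightarrow> reducible h'"
  unfolding reducible_def by simp

lemma reducible_add:
  assumes "reducible h" "reducible h'"
  shows "reducible (\<lambda>s. h s + h' s)"
proof -
  obtain k c k' c' where
    c: "\<And>s. s \<in> S \<Longrightarrow> ev s a ^ k * h s = (\<Sum>\<beta>\<in>reduced. ev s (c \<beta>) * mon \<beta> s)"
    "\<And>s. s \<in> S \<Longrightarrow> ev s a ^ k' * h' s = (\<Sum>\<beta>\<in>reduced. ev s (c' \<beta>) * mon \<beta> s)"
    using assms unfolding reducible_def by blast
  show ?thesis
  proof (rule reducibleI[of "k + k'" _ "\<lambda>\<beta>. a ^ k' * c \<beta> + a ^ k * c' \<beta>"])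
    fix s assume s: "s \<in> S"
    have "ev s a ^ (k + k') * (h s + h' s) =
        ev s a ^ k' * (ev s a ^ k * h s) + ev s a ^ k * (ev s a ^ k' * h' s)"
      by (simp add: power_add algebra_simps)
    then show "ev s a ^ (k + k') * (h s + h' s) =
        (\<Sum>\<beta>\<in>reduced. ev s (a ^ k' * c \<beta> + a ^ k * c' \<beta>) * mon \<beta> s)"
      unfolding c(1)[OF s] c(2)[OF s]
      by (simp add: ev_add ev_mult ev_power sum_distrib_left algebra_simps sum.distrib)
  qed
qed

lemma reducible_0: "reducible (\<lambda>s. 0)"
  by (rule reducibleI[of 0 _ "\<lambda>_. 0"]) (simp add: ev_0)

lemma reducible_sum:
  "(\<And>i. i \<in> A \<Longrightarrow> reducible (h i)) \<Longrightarrow> reducible (\<lambda>s. \<Sum>i\<in>A. h i s)"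
  by (induction A rule: infinite_finite_induct) (auto intro: reducible_0 reducible_add)

lemma reducible_scale:
  assumes "reducible h"
  shows "reducible (\<lambda>s. ev s e * h s)"
proof -
  obtain k c where
    c: "\<And>s. s \<in> S \<Longrightarrow> ev s a ^ k * h s = (\<Sum>\<beta>\<in>reduced. ev s (c \<beta>) * mon \<beta> s)"
    using assms unfolding reducible_def by blast
  show ?thesis
  proof (rule reducibleI[of k _ "\<lambda>\<beta>. e * c \<beta>"])
    fix s assume s: "s \<in> S"
    have "ev s a ^ k * (ev s e * h s) = ev s e * (ev s a ^ k * h s)" by simp
    then show "ev s a ^ k * (ev s e * h s) = (\<Sum>\<beta>\<in>reduced. ev s (e * c \<beta>) * mon \<beta> s)"
      unfolding c[OF s] by (simp add: ev_mult sum_distrib_left algebra_simps)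
  qed
qed

lemma reducible_cancel:
  assumes "reducible (\<lambda>s. ev s a ^ l * h s)"
  shows "reducible h"
proof -
  obtain k c where
    c: "\<And>s. s \<in> S \<Longrightarrow> ev s a ^ k * (ev s a ^ l * h s) = (\<Sum>\<beta>\<in>reduced. ev s (c \<beta>) * mon \<beta> s)"
    using assms unfolding reducible_def by blast
  show ?thesis
    by (rule reducibleI[of "k + l" _ c]) (simp add: c[symmetric] power_add)
qed

text \<open>Induction on the total degree: once an exponent reaches \<open>d\<close>, the factor
  \<open>x s b ^ d\<close> is traded for the remainder at the price of one power of
  \<open>a\<close>. All monomials of the resulting product have smaller total degree, so the
  induction hypothesis applies to them one by one.\<close>

lemma reducible_mon: "reducible (mon \<alpha>)"
proof (induction "deg \<alpha>" arbitrary: \<alpha> rule: less_induct)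
  case less
  show ?case
  proof (cases "\<forall>b\<in>I. \<alpha> b < d")
    case True
    then have r: "restrict \<alpha> I \<in> reduced" by (auto simp: reduced_def)
    have m: "mon (restrict \<alpha> I) s = mon \<alpha> s" for s by (simp add: mon_def)
    show ?thesis
      by (rule reducibleI[of 0 _ "\<lambda>\<beta>. if \<beta> = restrict \<alpha> I then 1 else 0"])
        (use finite_reduced r in \<open>simp add: ev_0 ev_1 if_distrib if_distribR m cong: if_cong\<close>)
  next
    case False
    then obtain b where b: "b \<in> I" "d \<le> \<alpha> b" by force
    define \<gamma> where "\<gamma> b' = (if b' = b then \<alpha> b - d else \<alpha> b')" for b'
    have \<alpha>: "\<alpha> = (\<lambda>b'. (if b' = b then d else 0) + \<gamma> b')"
      using b by (auto simp: \<gamma>_def)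
    have d\<alpha>: "deg \<alpha> = d + deg \<gamma>"
      by (subst \<alpha>, subst deg_add) (simp add: deg_single b)
    obtain R where R: "R \<in> pspan d" "\<And>s. s \<in> S \<Longrightarrow> ev s a * x s b ^ d = R s"
      using relation[OF b(1)] by blast
    have "(\<lambda>s. ev s 1 * mon \<gamma> s * R s) \<in> pspan (deg \<alpha>)"
      unfolding d\<alpha> by (rule pspan_mon_mult[OF R(1)])
    moreover have "h \<in> pspan (deg \<alpha>) \<Longrightarrow> reducible h" for h
    proof (induction rule: pspan.induct)
      case pspan_0
      show ?case by (rule reducible_0)
    next
      case (pspan_step h \<beta> c)
      then show ?case by (intro reducible_add reducible_scale less) auto
    qed
    ultimately have "reducible (\<lambda>s. ev s 1 * mon \<gamma> s * R s)" by blast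
    then have "reducible (\<lambda>s. ev s a ^ 1 * mon \<alpha> s)"
    proof (rule reducible_cong)
      fix s assume "s \<in> S"
      then show "ev s 1 * mon \<gamma> s * R s = ev s a ^ 1 * mon \<alpha> s"
        by (subst \<alpha>, subst mon_add) (simp add: R(2)[symmetric] mon_single b ev_1)
    qed
    then show ?thesis by (rule reducible_cancel)
  qed
qed

lemma reducible_mult:
  assumes "reducible h" "reducible h'"
  shows "reducible (\<lambda>s. h s * h' s)"
proof -
  obtain k c k' c' where
    c: "\<And>s. s \<in> S \<Longrightarrow> ev s a ^ k * h s = (\<Sum>\<beta>\<in>reduced. ev s (c \<beta>) * mon \<beta> s)"
    "\<And>s. s \<in> S \<Longrightarrow> ev s a ^ k' * h' s = (\<Sum>\<beta>\<in>reduced. ev s (c' \<beta>) * mon \<beta> s)"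
    using assms unfolding reducible_def by blast
  have "reducible (\<lambda>s. \<Sum>\<beta>\<in>reduced. \<Sum>\<gamma>\<in>reduced. ev s (c \<beta> * c' \<gamma>) * mon (\<lambda>b. \<beta> b + \<gamma> b) s)"
    by (intro reducible_sum reducible_scale reducible_mon)
  then have "reducible (\<lambda>s. ev s a ^ (k + k') * (h s * h' s))"
  proof (rule reducible_cong)
    fix s assume s: "s \<in> S"
    have "ev s a ^ (k + k') * (h s * h' s) = (ev s a ^ k * h s) * (ev s a ^ k' * h' s)"
      by (simp add: power_add)
    also have "\<dots> = (\<Sum>\<beta>\<in>reduced. \<Sum>\<gamma>\<in>reduced. ev s (c \<beta> * c' \<gamma>) * mon (\<lambda>b. \<beta> b + \<gamma> b) s)"
      unfolding c(1)[OF s] c(2)[OF s] sum_product by (simp add: ev_mult mon_add algebra_simps)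
    finally show "(\<Sum>\<beta>\<in>reduced. \<Sum>\<gamma>\<in>reduced. ev s (c \<beta> * c' \<gamma>) * mon (\<lambda>b. \<beta> b + \<gamma> b) s) =
        ev s a ^ (k + k') * (h s * h' s)" by simp
  qed
  then show ?thesis by (rule reducible_cancel)
qed

lemma reducible_const: "reducible (\<lambda>s. ev s c)"
  using reducible_scale[OF reducible_mon[of "\<lambda>_. 0"], of c] by (simp add: mon_zero)

lemma reducible_var: "b \<in> I \<Longrightarrow> reducible (\<lambda>s. x s b)"
  by (rule reducible_cong[OF reducible_mon[of "\<lambda>b'. if b' = b then 1 else 0"]]) (simp add: mon_single)

lemma reducible_power: "reducible h \<Longrightarrow> reducible (\<lambda>s. h s ^ i)"
  by (induction i) (use reducible_const[of 1] in \<open>auto simp: ev_1 intro: reducible_mult\<close>)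

text \<open>The powers of \<open>h\<close> with exponents from 0 to \<open>card reduced\<close> are
  one more than the generators of the module, so fraction-free elimination yields a relation among
  them whose coefficients do not depend on \<open>s\<close>.\<close>

lemma reducible_algebraic:
  assumes "reducible h"
  obtains r p where "\<exists>i\<le>r. p i \<noteq> 0"
    and "\<And>s. s \<in> S \<Longrightarrow> (\<Sum>i\<le>r. ev s (p i) * h s ^ i) = 0"
proof -
  have "\<exists>k c. \<forall>s\<in>S. ev s a ^ k * h s ^ i = (\<Sum>\<beta>\<in>reduced. ev s (c \<beta>) * mon \<beta> s)" for i
    using reducible_power[OF assms, of i] unfolding reducible_def .
  then obtain k c where c: "\<And>i s. s \<in> S \<Longrightarrow>
      ev s a ^ k i * h s ^ i = (\<Sum>\<beta>\<in>reduced. ev s (c i \<beta>) * mon \<beta> s)"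
    by metis
  define r where "r = card reduced"
  obtain p where p: "\<exists>i\<in>{..r}. p i \<noteq> 0" "\<And>\<beta>. \<beta> \<in> reduced \<Longrightarrow> (\<Sum>i\<in>{..r}. p i * c i \<beta>) = 0"
    using fraction_free_dependence[of reduced "{..r}" c] finite_reduced unfolding r_def by auto
  show ?thesis
  proof (rule that[of r "\<lambda>i. p i * a ^ k i"])
    \<comment> \<open>The factor \<open>a ^ k i\<close> absorbs the denominator of the
      \<open>i\<close>-th power, which varies with \<open>i\<close>; it is nonzero because the ring
      is a domain.\<close>
    show "\<exists>i\<le>r. p i * a ^ k i \<noteq> 0" using p(1) a_nonzero by auto
    fix s assume s: "s \<in> S"
    have "(\<Sum>i\<le>r. ev s (p i * a ^ k i) * h s ^ i) =
        (\<Sum>i\<le>r. ev s (p i) * (ev s a ^ k i * h s ^ i))"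
      by (simp add: ev_mult ev_power algebra_simps)
    also have "\<dots> = (\<Sum>i\<le>r. \<Sum>\<beta>\<in>reduced. ev s (p i * c i \<beta>) * mon \<beta> s)"
      unfolding c[OF s] by (simp add: sum_distrib_left ev_mult algebra_simps)
    also have "\<dots> = (\<Sum>\<beta>\<in>reduced. \<Sum>i\<le>r. ev s (p i * c i \<beta>) * mon \<beta> s)"
      by (rule sum.swap)
    also have "\<dots> = (\<Sum>\<beta>\<in>reduced. ev s (\<Sum>i\<le>r. p i * c i \<beta>) * mon \<beta> s)"
      by (simp add: ev_sum sum_distrib_right)
    also have "\<dots> = 0" by (simp add: p(2) ev_0)
    finally show "(\<Sum>i\<le>r. ev s (p i * a ^ k i) * h s ^ i) = 0" .
  qed
qed

end

section \<open>Maximizers on small cubes\<close>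

text \<open>A \<open>real poly poly\<close> is read as a polynomial in \<open>y\<close> whose
  coefficients are polynomials in a parameter \<open>t\<close>; \<open>poly (poly P [:y:]) t\<close>
  is its value at \<open>(t, y)\<close>. The limit is joint in both arguments.\<close>

lemma tendsto_bivariate_poly [tendsto_intros]:
  fixes P :: "real poly poly"
  assumes "(f \<longlongrightarrow> t) F" "(g \<longlongrightarrow> y) F"
  shows "((\<lambda>n. poly (poly P [:g n:]) (f n)) \<longlongrightarrow> poly (poly P [:y:]) t) F"
proof (induction P)
  case (pCons a P)
  have "((\<lambda>n. poly a (f n)) \<longlongrightarrow> poly a t) F"
    using assms(1) by (rule tendsto_poly)
  then show ?case using pCons assms by (auto intro!: tendsto_intros)
qed simp

lemma real_polynomial_function_directional_derivative:
  assumes "real_polynomial_function p"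
  shows "\<exists>p'. real_polynomial_function p' \<and>
    (\<forall>x. ((\<lambda>t. p (x + t *\<^sub>R v)) has_real_derivative p' x) (at 0))"
  using assms
proof induction
  case (linear f)
  interpret bounded_linear f by fact
  show ?case
    by (intro exI[of _ "\<lambda>_. f v"]) (auto simp: add scaleR intro!: derivative_eq_intros)
next
  case (const c)
  show ?case by (intro exI[of _ "\<lambda>_. 0"]) auto
next
  case (add f g)
  then obtain f' g' where "real_polynomial_function f'" "real_polynomial_function g'"
    "\<forall>x. ((\<lambda>t. f (x + t *\<^sub>R v)) has_real_derivative f' x) (at 0)"
    "\<forall>x. ((\<lambda>t. g (x + t *\<^sub>R v)) has_real_derivative g' x) (at 0)" by blast
  then show ?case
    by (intro exI[of _ "\<lambda>x. f' x + g' x"]) (auto intro!: derivative_eq_intros)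
next
  case (mult f g)
  then obtain f' g' where f': "real_polynomial_function f'" "real_polynomial_function g'"
    "\<And>x. ((\<lambda>t. f (x + t *\<^sub>R v)) has_real_derivative f' x) (at 0)"
    "\<And>x. ((\<lambda>t. g (x + t *\<^sub>R v)) has_real_derivative g' x) (at 0)" by blast
  show ?case
  proof (intro exI[of _ "\<lambda>x. f' x * g x + f x * g' x"] conjI allI)
    show "real_polynomial_function (\<lambda>x. f' x * g x + f x * g' x)"
      by (intro real_polynomial_function.intros f'(1,2) mult.hyps)
    show "((\<lambda>t. f (x + t *\<^sub>R v) * g (x + t *\<^sub>R v)) has_real_derivative f' x * g x + f x * g' x) (at 0)" for x
      using f'(3,4)[of x] by (auto intro!: derivative_eq_intros)
  qed
qed

text \<open>Removing the largest common power of the variable keeps the family from vanishing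
  altogether when the variable is set to 0. Without this the limit \<eta> = 0 of an algebraic
  relation could be the trivial one.\<close>

lemma poly_coefficients_primitive_at_0:
  fixes p :: "nat \<Rightarrow> 'r::idom poly"
  assumes "\<exists>i\<in>A. p i \<noteq> 0"
  shows "\<exists>m p'. (\<forall>i\<in>A. p i = [:0, 1:] ^ m * p' i) \<and> (\<exists>i\<in>A. poly (p' i) 0 \<noteq> 0)"
proof -
  from assms obtain i0 where "i0 \<in> A" "p i0 \<noteq> 0" by blast
  then show ?thesis
  proof (induction "degree (p i0)" arbitrary: p rule: less_induct)
    case less
    show ?case
    proof (cases "\<exists>i\<in>A. poly (p i) 0 \<noteq> 0")
      case True
      then show ?thesis by (intro exI[of _ 0] exI[of _ p]) auto
    next
      case False
      then have "\<forall>i\<in>A. \<exists>q. p i = [:0, 1:] * q"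
        by (metis dvdE poly_eq_0_iff_dvd minus_zero)
      then obtain q where q: "\<And>i. i \<in> A \<Longrightarrow> p i = [:0, 1:] * q i" by metis
      with less.prems have "q i0 \<noteq> 0" by auto
      moreover from this have "degree (q i0) < degree (p i0)"
        using q[OF less.prems(1)] by (simp add: degree_mult_eq)
      ultimately obtain m p' where
        "\<forall>i\<in>A. q i = [:0, 1:] ^ m * p' i" "\<exists>i\<in>A. poly (p' i) 0 \<noteq> 0"
        using less.hyps[of q] less.prems(1) by blast
      with q show ?thesis
        by (intro exI[of _ "Suc m"] exI[of _ p']) (auto simp: mult.assoc)
    qed
  qed
qed

section \<open>Critical points of perturbed functions on cubes\<close>

lemma has_real_derivative_sum_power_coordinates:
  fixes x b :: "'a::euclidean_space"
  assumes "b \<in> Basis"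
  shows "((\<lambda>t. \<Sum>b'\<in>Basis. ((x + t *\<^sub>R b) \<bullet> b') ^ k) has_real_derivative
    real k * (x \<bullet> b) ^ (k - 1)) (at 0)"
proof -
  have "((\<lambda>t. \<Sum>b'\<in>Basis. (x \<bullet> b' + t * (b \<bullet> b')) ^ k) has_real_derivative
      (\<Sum>b'\<in>Basis. real k * (x \<bullet> b') ^ (k - 1) * (b \<bullet> b'))) (at 0)"
    by (auto intro!: derivative_eq_intros sum.cong)
  also have "(\<Sum>b'\<in>Basis. real k * (x \<bullet> b') ^ (k - 1) * (b \<bullet> b')) =
      (\<Sum>b'\<in>Basis. if b' = b then real k * (x \<bullet> b) ^ (k - 1) else 0)"
    using assms by (intro sum.cong) (auto simp: inner_Basis)
  also have "\<dots> = real k * (x \<bullet> b) ^ (k - 1)" using assms by simp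
  finally show ?thesis by (simp add: inner_add_left)
qed

lemma mem_cube:
  "(x :: 'a::euclidean_space) \<in> cbox (- (e *\<^sub>R One)) (e *\<^sub>R One) \<longleftrightarrow> (\<forall>b\<in>Basis. \<bar>x \<bullet> b\<bar> \<le> e)"
  by (simp add: mem_box abs_le_iff minus_le_iff[of e] conj_commute)

text \<open>Where the coordinate reaches a face the first factor vanishes; elsewhere the maximum is
  critical in direction \<open>b\<close>. One polynomial equation thus covers interior and boundary.
  This is the advantage of a cube: its constraints separate by coordinates.\<close>

lemma polynomial_maximum_on_cube_critical:
  fixes x :: "'a::euclidean_space"
  assumes b: "b \<in> Basis" and x: "x \<in> cbox (- (e *\<^sub>R One)) (e *\<^sub>R One)"
    and max: "\<And>y. y \<in> cbox (- (e *\<^sub>R One)) (e *\<^sub>R One) \<Longrightarrow> G y \<le> G x"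
    and deriv: "((\<lambda>t. G (x + t *\<^sub>R b)) has_real_derivative D) (at 0)"
  shows "(e\<^sup>2 - (x \<bullet> b)\<^sup>2) * D = 0"
proof (cases "\<bar>x \<bullet> b\<bar> < e")
  case True
  have xb: "\<bar>x \<bullet> b'\<bar> \<le> e" if "b' \<in> Basis" for b'
    using x that by (simp add: mem_cube)
  have "D = 0"
  proof (rule DERIV_local_max[OF deriv, of "e - \<bar>x \<bullet> b\<bar>"])
    show "\<forall>t. \<bar>0 - t\<bar> < e - \<bar>x \<bullet> b\<bar> \<longrightarrow> G (x + t *\<^sub>R b) \<le> G (x + 0 *\<^sub>R b)"
    proof (intro allI impI)
      fix t assume t: "\<bar>0 - t\<bar> < e - \<bar>x \<bullet> b\<bar>"
      have "\<bar>(x + t *\<^sub>R b) \<bullet> b'\<bar> \<le> e" if "b' \<in> Basis" for b'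
        using xb[OF that] t b that by (cases "b' = b") (auto simp: inner_add_left inner_Basis)
      then have "x + t *\<^sub>R b \<in> cbox (- (e *\<^sub>R One)) (e *\<^sub>R One)"
        by (simp add: mem_cube)
      from max[OF this] show "G (x + t *\<^sub>R b) \<le> G (x + 0 *\<^sub>R b)" by simp
    qed
  qed (use True in auto)
  then show ?thesis by simp
next
  case False
  moreover have "\<bar>x \<bullet> b\<bar> \<le> e" using x b by (simp add: mem_cube)
  ultimately have "\<bar>x \<bullet> b\<bar> = \<bar>e\<bar>" by auto
  then have "(x \<bullet> b)\<^sup>2 = e\<^sup>2" by (metis power2_abs)
  then show ?thesis by simp
qed


text \<open>The critical equations of \<open>g\<close> alone may have infinitely many solutions.
  Subtracting \<eta> times the sum of the powers \<open>(x \<bullet> b) ^ (2 * D)\<close> gives the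
  equation for \<open>b\<close> the top term \<open>\<eta> * (x \<bullet> b) ^ (2 * D + 1)\<close>
  up to a constant, so the system is monic over the polynomials in \<open>e\<close> and \<eta> with
  leading coefficient \<eta>. The resulting \<open>P b\<close> serve all radii \<open>e\<close> at
  once.\<close>

lemma polynomial_maximizer_algebraic:
  fixes g :: "'a::euclidean_space \<Rightarrow> real"
  assumes g: "real_polynomial_function g"
  obtains P :: "'a \<Rightarrow> real poly poly" where "\<And>b. b \<in> Basis \<Longrightarrow> P b \<noteq> 0"
    and "\<And>e. e > 0 \<Longrightarrow> \<exists>x \<in> cbox (- (e *\<^sub>R One)) (e *\<^sub>R One).
      (\<forall>y \<in> cbox (- (e *\<^sub>R One)) (e *\<^sub>R One). g y \<le> g x) \<and>
      (\<forall>b\<in>Basis. poly (poly (P b) [:x \<bullet> b:]) e = 0)"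
proof -
  have "\<exists>g'. real_polynomial_function g' \<and>
      (\<forall>x. ((\<lambda>t. g (x + t *\<^sub>R b)) has_real_derivative g' x) (at 0))" for b
    using g by (rule real_polynomial_function_directional_derivative)
  then obtain g' where g': "\<And>b. real_polynomial_function (g' b)"
    "\<And>b x. ((\<lambda>t. g (x + t *\<^sub>R b)) has_real_derivative g' b x) (at 0)"
    by metis
  \<comment> \<open>The components of \<open>s\<close> are \<open>e\<close>, \<eta> and the point.
    The outer variable of the ring is \<eta> and the inner one is \<open>e\<close>, so that \<eta>
    can be set to 0 by evaluating at 0.\<close>
  define ev where "ev s c = poly (poly c [:fst (snd s):]) (fst s)"
    for s :: "real \<times> real \<times> 'a" and c :: "real poly poly"
  define X where "X s = snd (snd s)" for s :: "real \<times> real \<times> 'a"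
  interpret coefficient_evaluation ev "\<lambda>s b. X s \<bullet> b" Basis
    by standard (auto simp: ev_def)
  have ev_const: "ev s [:[:r:]:] = r" for s r by (simp add: ev_def)
  have lin: "\<exists>k. (\<lambda>s. f (X s)) \<in> pspan k" if "bounded_linear f" for f :: "'a \<Rightarrow> real"
  proof -
    interpret bounded_linear f by fact
    have "(\<Sum>b\<in>Basis. (x \<bullet> b) * f b) = f x" for x
      by (subst (2) euclidean_representation[symmetric, of x]) (simp add: sum scaleR)
    then have "(\<lambda>s. \<Sum>b\<in>Basis. (X s \<bullet> b) * f b) = (\<lambda>s. f (X s))" by (intro ext)
    moreover have "(\<lambda>s. \<Sum>b\<in>Basis. (X s \<bullet> b) * f b) \<in> pspan (2 + 1)"
    proof (intro pspan_sum pspan_mult)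
      fix b :: 'a assume "b \<in> Basis"
      then show "(\<lambda>s. X s \<bullet> b) \<in> pspan 2" using pspan_var_power[of b 1 2] by simp
      show "(\<lambda>s. f b) \<in> pspan 1" using pspan_const[of 1 "[:[:f b:]:]"] by (simp add: ev_const)
    qed
    ultimately have "(\<lambda>s. f (X s)) \<in> pspan (2 + 1)"
      by (rule subst[of _ _ "\<lambda>h. h \<in> pspan (2 + 1)"])
    then show ?thesis ..
  qed
  have ev_surj: "\<exists>c. \<forall>s. ev s c = r" for r
    by (intro exI allI) (rule ev_const)
  have "\<forall>b. \<exists>k. (\<lambda>s. g' b (X s)) \<in> pspan k"
  proof
    show "\<exists>k. (\<lambda>s. g' b (X s)) \<in> pspan k" for b
      using pspan_polynomial[where h = "g' b" and X = X, OF g'(1)] lin ev_surj by blast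
  qed
  then obtain k where k: "\<And>b. (\<lambda>s. g' b (X s)) \<in> pspan (k b)"
    using choice[of "\<lambda>b k. (\<lambda>s. g' b (X s)) \<in> pspan k"] by blast
  \<comment> \<open>The part of the equation containing \<open>g' b\<close> lies in
    \<open>pspan (k b + 5)\<close>: 4 for the factor
    \<open>e\<^sup>2 - (x \<bullet> b)\<^sup>2\<close>, \<open>k b\<close> for the derivative and 1
    for a constant. It has to fit into \<open>pspan (2 * D + 1)\<close>.\<close>
  define D where "D = Max (insert 0 (k ` Basis)) + 4"
  have D: "k b + 4 \<le> 2 * D" if "b \<in> Basis" for b
  proof -
    have "k b \<le> Max (insert 0 (k ` Basis))" using that by (intro Max_ge) auto
    then show ?thesis by (simp add: D_def)
  qed
  have "D > 0" by (simp add: D_def)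
  define S where "S = {s :: real \<times> real \<times> 'a. \<forall>b\<in>Basis. ((fst s)\<^sup>2 - (X s \<bullet> b)\<^sup>2) *
    (g' b (X s) - fst (snd s) * (2 * real D * (X s \<bullet> b) ^ (2 * D - 1))) = 0}"
  interpret monic_system ev "\<lambda>s b. X s \<bullet> b" Basis S "[:0, 1:]" "2 * D + 1"
  proof
    fix b :: 'a assume b: "b \<in> Basis"
    \<comment> \<open>This is the critical equation solved for its top term, with the factor
      \<open>2 * D\<close> from differentiating the power divided out.\<close>
    define R where "R s = ev s [:0, [:0, 0, 1:]:] * (X s \<bullet> b) ^ (2 * D - 1) +
      (ev s [:[:0, 0, 1:]:] + ev s (- 1) * (X s \<bullet> b) ^ 2) * g' b (X s) * ev s [:[:- 1 / (2 * real D):]:]" for s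
    have "(\<lambda>s. ev s [:0, [:0, 0, 1:]:] * (X s \<bullet> b) ^ (2 * D - 1)) \<in> pspan (1 + 2 * D)"
      using b \<open>D > 0\<close> by (intro pspan_mult pspan_const pspan_var_power) auto
    moreover have "(\<lambda>s. (ev s [:[:0, 0, 1:]:] + ev s (- 1) * (X s \<bullet> b) ^ 2) * g' b (X s) *
        ev s [:[:- 1 / (2 * real D):]:]) \<in> pspan ((1 + 3) + k b + 1)"
      using b by (intro pspan_mult pspan_add pspan_mono[OF pspan_const[of 1]] k pspan_const pspan_var_power) auto
    ultimately have "R \<in> pspan (2 * D + 1)"
      unfolding R_def by (intro pspan_add) (use D[OF b] in \<open>auto elim: pspan_mono\<close>)
    moreover have "ev s [:0, 1:] * (X s \<bullet> b) ^ (2 * D + 1) = R s" if "s \<in> S" for s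
    proof -
      let ?x = "X s \<bullet> b"
      have eq: "((fst s)\<^sup>2 - ?x\<^sup>2) * (g' b (X s) - fst (snd s) * (2 * real D * ?x ^ (2 * D - 1))) = 0"
        using that b by (simp add: S_def)
      have pw: "?x ^ (2 * D + 1) = ?x\<^sup>2 * ?x ^ (2 * D - 1)"
        using \<open>D > 0\<close> by (simp flip: power_add)
      have "R s = (fst s)\<^sup>2 * fst (snd s) * ?x ^ (2 * D - 1) -
          ((fst s)\<^sup>2 - ?x\<^sup>2) * g' b (X s) / (2 * real D)"
        using \<open>D > 0\<close> by (simp add: R_def ev_def power2_eq_square field_simps)
      also have "((fst s)\<^sup>2 - ?x\<^sup>2) * g' b (X s) =
          ((fst s)\<^sup>2 - ?x\<^sup>2) * (fst (snd s) * (2 * real D * ?x ^ (2 * D - 1)))"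
        using eq by (simp add: right_diff_distrib)
      finally show ?thesis
        unfolding pw using \<open>D > 0\<close> by (simp add: ev_def field_simps)
    qed
    ultimately show "\<exists>R\<in>pspan (2 * D + 1). \<forall>s\<in>S. ev s [:0, 1:] * (X s \<bullet> b) ^ (2 * D + 1) = R s"
      by blast
  qed simp
  \<comment> \<open>Cancelling the common power of \<eta> restricts the relation to nonzero \<eta>;
    the value 0 is recovered in the limit. The pair \<open>z\<close> holds the degree bound and the
    coefficients.\<close>
  have "\<exists>z. (\<exists>i\<le>fst z. poly (snd z i) 0 \<noteq> 0) \<and>
      (\<forall>s\<in>S. fst (snd s) \<noteq> 0 \<longrightarrow> (\<Sum>i\<le>fst z. ev s (snd z i) * (X s \<bullet> b) ^ i) = 0)"
    if b: "b \<in> Basis" for b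
  proof -
    obtain r p where p: "\<exists>i\<le>r. p i \<noteq> 0"
      "\<And>s. s \<in> S \<Longrightarrow> (\<Sum>i\<le>r. ev s (p i) * (X s \<bullet> b) ^ i) = 0"
      using reducible_algebraic[OF reducible_var[OF b]] by blast
    obtain m p' where p': "\<forall>i\<in>{..r}. p i = [:0, 1:] ^ m * p' i" "\<exists>i\<in>{..r}. poly (p' i) 0 \<noteq> 0"
      using poly_coefficients_primitive_at_0[of "{..r}" p] p(1) by auto
    have "(\<Sum>i\<le>r. ev s (p' i) * (X s \<bullet> b) ^ i) = 0" if s: "s \<in> S" "fst (snd s) \<noteq> 0" for s
    proof -
      have "0 = (\<Sum>i\<le>r. ev s (p i) * (X s \<bullet> b) ^ i)" using p(2)[OF s(1)] by simp
      also have "\<dots> = (\<Sum>i\<le>r. fst (snd s) ^ m * (ev s (p' i) * (X s \<bullet> b) ^ i))"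
      proof (intro sum.cong refl)
        fix i assume "i \<in> {..r}"
        with p'(1) have "p i = [:0, 1:] ^ m * p' i" by blast
        moreover have "ev s [:0, 1:] = fst (snd s)" by (simp add: ev_def)
        ultimately show "ev s (p i) * (X s \<bullet> b) ^ i = fst (snd s) ^ m * (ev s (p' i) * (X s \<bullet> b) ^ i)"
          by (simp only: ev_mult ev_power mult.assoc)
      qed
      finally show ?thesis using s(2) by (simp add: sum_distrib_left[symmetric])
    qed
    with p'(2) show ?thesis by (intro exI[of _ "(r, p')"]) auto
  qed
  then obtain z where z: "\<And>b. b \<in> Basis \<Longrightarrow> \<exists>i\<le>fst (z b). poly (snd (z b) i) 0 \<noteq> 0"
    "\<And>b s. b \<in> Basis \<Longrightarrow> s \<in> S \<Longrightarrow> fst (snd s) \<noteq> 0 \<Longrightarrow>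
      (\<Sum>i\<le>fst (z b). ev s (snd (z b) i) * (X s \<bullet> b) ^ i) = 0"
    using bchoice[of Basis "\<lambda>b z. (\<exists>i\<le>fst z. poly (snd z i) 0 \<noteq> 0) \<and>
      (\<forall>s\<in>S. fst (snd s) \<noteq> 0 \<longrightarrow> (\<Sum>i\<le>fst z. ev s (snd z i) * (X s \<bullet> b) ^ i) = 0)"] by blast
  define r where "r b = fst (z b)" for b
  define p' where "p' b = snd (z b)" for b
  \<comment> \<open>At \<eta> = 0 the coefficients become polynomials in \<open>e\<close>, and the
    outer variable now stands for the coordinate \<open>x \<bullet> b\<close>.\<close>
  define P where "P b = (\<Sum>i\<le>r b. monom (poly (p' b i) 0) i)" for b
  show ?thesis
  proof (rule that[of P])
    fix b :: 'a assume "b \<in> Basis"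
    then obtain i where i: "i \<le> r b" "poly (p' b i) 0 \<noteq> 0" using z(1) unfolding r_def p'_def by blast
    then have "coeff (P b) i \<noteq> 0" by (simp add: P_def coeff_sum)
    then show "P b \<noteq> 0" by auto
  next
    fix e :: real assume e: "e > 0"
    let ?C = "cbox (- (e *\<^sub>R One)) (e *\<^sub>R One) :: 'a set"
    define \<eta> where "\<eta> n = inverse (real (Suc n))" for n
    define G where "G n x = g x - \<eta> n * (\<Sum>b\<in>Basis. (x \<bullet> b) ^ (2 * D))" for n x
    have contg: "continuous_on A g" for A
      using g by (simp add: continuous_on_polymonial_function real_polynomial_function_eq)
    have "0 \<in> ?C" using e by (simp add: mem_cube)
    have "\<exists>x\<in>?C. \<forall>y\<in>?C. G n y \<le> G n x" for n
      unfolding G_def using \<open>0 \<in> ?C\<close>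
      by (intro continuous_attains_sup compact_cbox continuous_intros contg) blast
    then obtain x where x: "\<And>n. x n \<in> ?C" "\<And>n y. y \<in> ?C \<Longrightarrow> G n y \<le> G n (x n)" by metis
    have "(e, \<eta> n, x n) \<in> S" for n
      unfolding S_def X_def mem_Collect_eq fst_conv snd_conv
    proof
      fix b :: 'a assume b: "b \<in> Basis"
      have "((\<lambda>t. G n (x n + t *\<^sub>R b)) has_real_derivative
          g' b (x n) - \<eta> n * (real (2 * D) * (x n \<bullet> b) ^ (2 * D - 1))) (at 0)"
        unfolding G_def
        by (intro DERIV_diff g'(2) DERIV_cmult has_real_derivative_sum_power_coordinates b)
      from polynomial_maximum_on_cube_critical[OF b x(1) x(2) this]
      show "(e\<^sup>2 - (x n \<bullet> b)\<^sup>2) * (g' b (x n) - \<eta> n * (2 * real D * (x n \<bullet> b) ^ (2 * D - 1))) = 0"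
        by (simp only: of_nat_mult of_nat_numeral)
    qed
    then have root: "(\<Sum>i\<le>r b. ev (e, \<eta> n, x n) (p' b i) * (x n \<bullet> b) ^ i) = 0" if "b \<in> Basis" for b n
      using z(2)[OF that \<open>(e, \<eta> n, x n) \<in> S\<close>]
      by (simp add: X_def r_def p'_def \<eta>_def del: of_nat_Suc)
    \<comment> \<open>A limit of maximizers of \<open>G n\<close> maximizes \<open>g\<close>, and it
      inherits the relations as a limit of their solutions.\<close>
    obtain l \<rho> where l: "l \<in> ?C" "strict_mono \<rho>" "(x \<circ> \<rho>) \<longlonglongrightarrow> l"
      using x(1) compact_cbox unfolding compact_eq_seq_compact_metric seq_compact_def by metis
    have "\<eta> \<longlonglongrightarrow> 0" unfolding \<eta>_def by (rule LIMSEQ_inverse_real_of_nat)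
    then have \<eta>: "(\<lambda>n. \<eta> (\<rho> n)) \<longlonglongrightarrow> 0"
      using LIMSEQ_subseq_LIMSEQ[OF _ l(2)] by (auto simp: o_def)
    have xl: "(\<lambda>n. x (\<rho> n)) \<longlonglongrightarrow> l" using l(3) by (simp add: o_def)
    have gl: "(\<lambda>n. g (x (\<rho> n))) \<longlonglongrightarrow> g l"
      by (rule continuous_on_tendsto_compose[OF contg[of UNIV] xl]) auto
    have "g y \<le> g l" if "y \<in> ?C" for y
    proof (rule LIMSEQ_le)
      show "(\<lambda>n. G (\<rho> n) y) \<longlonglongrightarrow> g y"
        unfolding G_def by (auto intro!: tendsto_eq_intros \<eta>)
      show "(\<lambda>n. G (\<rho> n) (x (\<rho> n))) \<longlonglongrightarrow> g l"
        unfolding G_def by (auto intro!: tendsto_eq_intros \<eta> gl xl)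
    qed (use x(2)[OF that] in auto)
    moreover have "poly (poly (P b) [:l \<bullet> b:]) e = 0" if b: "b \<in> Basis" for b
    proof -
      have "(\<lambda>n. \<Sum>i\<le>r b. ev (e, \<eta> (\<rho> n), x (\<rho> n)) (p' b i) * (x (\<rho> n) \<bullet> b) ^ i) \<longlonglongrightarrow>
          (\<Sum>i\<le>r b. poly (poly (p' b i) [:0:]) e * (l \<bullet> b) ^ i)"
        unfolding ev_def fst_conv snd_conv by (intro tendsto_intros \<eta> xl)
      then have "(\<Sum>i\<le>r b. poly (poly (p' b i) 0) e * (l \<bullet> b) ^ i) = 0"
        unfolding root[OF b] by (simp add: LIMSEQ_const_iff)
      then show ?thesis by (simp add: P_def poly_sum poly_monom)
    qed
    ultimately show "\<exists>x\<in>?C. (\<forall>y\<in>?C. g y \<le> g x) \<and> (\<forall>b\<in>Basis. poly (poly (P b) [:x \<bullet> b:]) e = 0)"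
      using l(1) by blast
  qed
qed

section \<open>Branches of real roots\<close>

definition specialize :: "real poly poly \<Rightarrow> real \<Rightarrow> real poly" where
  "specialize P t = map_poly (\<lambda>c. poly c t) P"

lemma coeff_specialize: "coeff (specialize P t) i = poly (coeff P i) t"
  by (simp add: specialize_def coeff_map_poly)

lemma poly_specialize: "poly (specialize P t) y = poly (poly P [:y:]) t"
  unfolding specialize_def by (induction P) (simp_all add: map_poly_pCons)

lemma specialize_add: "specialize (P + Q) t = specialize P t + specialize Q t"
  by (rule poly_eqI) (simp add: coeff_specialize)

lemma specialize_mult: "specialize (P * Q) t = specialize P t * specialize Q t"
  by (rule poly_eqI) (simp add: coeff_specialize coeff_mult poly_sum)

lemma specialize_smult: "specialize (smult a P) t = smult (poly a t) (specialize P t)"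
  by (rule poly_eqI) (simp add: coeff_specialize)

lemma specialize_pderiv: "specialize (pderiv P) t = pderiv (specialize P t)"
  by (rule poly_eqI) (simp add: coeff_specialize coeff_pderiv poly_of_nat)

lemma eventually_poly_nonzero:
  fixes c :: "real poly"
  assumes "c \<noteq> 0"
  shows "\<forall>\<^sub>F t in at_right a. poly c t \<noteq> 0"
proof -
  have "open (- ({t. poly c t = 0} - {a}))"
    using poly_roots_finite[OF assms] by (intro open_Compl finite_imp_closed) auto
  then have "\<forall>\<^sub>F t in nhds a. t \<in> - ({t. poly c t = 0} - {a})"
    by (rule eventually_nhds_in_open) simp
  then show ?thesis
    by (auto simp: eventually_at_filter elim: eventually_mono)
qed

lemma eventually_specialize_nonzero:
  assumes "P \<noteq> 0"
  shows "\<forall>\<^sub>F t in at_right a. specialize P t \<noteq> 0"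
proof -
  have "lead_coeff P \<noteq> 0" using assms by simp
  from eventually_poly_nonzero[OF this, of a] show ?thesis
    by eventually_elim (metis coeff_0 coeff_specialize)
qed

text \<open>A nonzero \<open>Q\<close> of least degree that vanishes at the roots of
  \<open>P\<close> is squarefree. Let \<open>h\<close> have least degree among the nonzero elements
  of the ideal generated by \<open>Q\<close> and \<open>pderiv Q\<close>; up to factors depending on
  \<open>t\<close> it divides both. The cofactor \<open>q\<close> of \<open>h\<close> in
  \<open>Q\<close> still has all the roots, so minimality makes \<open>h\<close> constant in
  \<open>y\<close>, and the identity \<open>h = A * Q + B * pderiv Q\<close> excludes multiple roots
  for small \<open>t > 0\<close>.\<close>

lemma simple_roots_polynomial:
  fixes P :: "real poly poly"
  assumes "P \<noteq> 0"
  obtains Q where "Q \<noteq> 0"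
    and "\<forall>\<^sub>F t in at_right 0. \<forall>y. poly (specialize P t) y = 0 \<longrightarrow> poly (specialize Q t) y = 0"
    and "\<forall>\<^sub>F t in at_right 0. \<forall>y. poly (specialize Q t) y = 0 \<longrightarrow> poly (pderiv (specialize Q t)) y \<noteq> 0"
proof -
  define good where "good Q \<longleftrightarrow> Q \<noteq> 0 \<and>
    (\<forall>\<^sub>F t in at_right 0. \<forall>y. poly (specialize P t) y = 0 \<longrightarrow> poly (specialize Q t) y = 0)" for Q
  have "good P" using assms by (simp add: good_def)
  then obtain Q where Q: "good Q" "\<And>Q'. good Q' \<Longrightarrow> degree Q \<le> degree Q'"
    using ex_has_least_nat[of good P degree] by blast
  have Q0: "Q \<noteq> 0" using Q(1) by (simp add: good_def)
  define J where "J = {h. \<exists>A B. h = A * Q + B * pderiv Q}"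
  have "Q \<in> J" unfolding J_def by (rule CollectI, rule exI[of _ 1], rule exI[of _ 0]) simp
  have "pderiv Q \<in> J" unfolding J_def by (rule CollectI, rule exI[of _ 0], rule exI[of _ 1]) simp
  obtain h where h: "h \<noteq> 0" "h \<in> J" "\<And>g. g \<noteq> 0 \<Longrightarrow> g \<in> J \<Longrightarrow> degree h \<le> degree g"
    using ex_has_least_nat[of "\<lambda>g. g \<noteq> 0 \<and> g \<in> J" Q degree] \<open>Q \<in> J\<close> Q0 by blast
  have pseudo_dvd: "\<exists>a q. a \<noteq> 0 \<and> smult a g = h * q" if gJ: "g \<in> J" for g
  proof -
    obtain a q where a: "a \<noteq> 0" "smult a g = h * q + pseudo_mod g h"
      using pseudo_mod(1)[OF h(1), of g] by blast
    obtain A B where g: "g = A * Q + B * pderiv Q" using gJ unfolding J_def by blast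
    obtain A' B' where h': "h = A' * Q + B' * pderiv Q" using h(2) unfolding J_def by blast
    have "pseudo_mod g h = smult a g - h * q" using a(2) by simp
    also have "\<dots> = (smult a A - q * A') * Q + (smult a B - q * B') * pderiv Q"
      unfolding g by (subst h') (simp add: algebra_simps smult_add_right)
    finally have "pseudo_mod g h \<in> J" unfolding J_def by blast
    \<comment> \<open>The pseudo-remainder belongs to \<open>J\<close>; a nonzero one would have
      smaller degree than \<open>h\<close>.\<close>
    then have "pseudo_mod g h = 0"
      using pseudo_mod(2)[OF h(1), of g] h(3)[of "pseudo_mod g h"] by (meson leD)
    with a show ?thesis by auto
  qed
  obtain a q where a: "a \<noteq> 0" "smult a Q = h * q" using pseudo_dvd[OF \<open>Q \<in> J\<close>] by blast
  obtain a' q' where a': "a' \<noteq> 0" "smult a' (pderiv Q) = h * q'"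
    using pseudo_dvd[OF \<open>pderiv Q \<in> J\<close>] by blast
  have "q \<noteq> 0" using a Q0 by auto
  have ev: "\<forall>\<^sub>F t in at_right 0. poly a t \<noteq> 0 \<and> poly a' t \<noteq> 0 \<and> specialize Q t \<noteq> 0"
    using eventually_poly_nonzero[OF a(1)] eventually_poly_nonzero[OF a'(1)]
      eventually_specialize_nonzero[OF Q0] by eventually_elim auto
  have "good q"
    unfolding good_def
  proof (intro conjI \<open>q \<noteq> 0\<close>)
    have "\<forall>\<^sub>F t in at_right 0. \<forall>y. poly (specialize P t) y = 0 \<longrightarrow> poly (specialize Q t) y = 0"
      using Q(1) by (simp add: good_def)
    with ev show "\<forall>\<^sub>F t in at_right 0. \<forall>y. poly (specialize P t) y = 0 \<longrightarrow> poly (specialize q t) y = 0"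
    proof (eventually_elim, intro allI impI)
      fix t y
      assume t: "poly a t \<noteq> 0 \<and> poly a' t \<noteq> 0 \<and> specialize Q t \<noteq> 0"
        and "\<forall>y. poly (specialize P t) y = 0 \<longrightarrow> poly (specialize Q t) y = 0"
        and "poly (specialize P t) y = 0"
      then have y: "poly (specialize Q t) y = 0" by blast
      let ?Q = "specialize Q t" and ?h = "specialize h t" and ?q = "specialize q t"
      have e1: "smult (poly a t) ?Q = ?h * ?q"
        using arg_cong[OF a(2), of "\<lambda>P. specialize P t"] by (simp add: specialize_smult specialize_mult)
      have e2: "smult (poly a' t) (pderiv ?Q) = ?h * specialize q' t"
        using arg_cong[OF a'(2), of "\<lambda>P. specialize P t"]
        by (simp add: specialize_smult specialize_mult specialize_pderiv)
      have hq: "?h * ?q \<noteq> 0" using t by (simp flip: e1)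
      have "pderiv ?Q \<noteq> 0"
      proof
        assume "pderiv ?Q = 0"
        then obtain c where "?Q = [:c:]" using pderiv_iszero by blast
        with y t show False by simp
      qed
      then have hq': "?h * specialize q' t \<noteq> 0" using t by (simp flip: e2)
      \<comment> \<open>The order of \<open>h\<close> at \<open>y\<close> is at most that of the
        derivative, which is one less than that of \<open>Q\<close>; hence \<open>q\<close> keeps
        the root \<open>y\<close>.\<close>
      have "order y ?Q = order y ?h + order y ?q"
        using order_mult[OF hq, of y] t by (simp flip: e1 add: order_smult)
      moreover have "order y ?h \<le> order y (pderiv ?Q)"
        using order_mult[OF hq', of y] t by (simp flip: e2 add: order_smult)
      moreover have "order y ?Q = Suc (order y (pderiv ?Q))"
        using t y by (intro order_pderiv) auto
      ultimately have "order y ?q \<noteq> 0" by linarith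
      then show "poly ?q y = 0" by (metis order_root)
    qed
  qed
  then have "degree Q \<le> degree q" by (rule Q(2))
  moreover have "degree Q = degree h + degree q"
    using arg_cong[OF a(2), of degree] a(1) h(1) \<open>q \<noteq> 0\<close> by (simp add: degree_mult_eq)
  ultimately have "degree h = 0" by simp
  then obtain c where c: "h = [:c:]" using degree_eq_zeroE by blast
  with h(1) have "c \<noteq> 0" by simp
  obtain A B where AB: "h = A * Q + B * pderiv Q" using h(2) unfolding J_def by blast
  show ?thesis
  proof (rule that[of Q])
    show "\<forall>\<^sub>F t in at_right 0. \<forall>y. poly (specialize Q t) y = 0 \<longrightarrow> poly (pderiv (specialize Q t)) y \<noteq> 0"
      using eventually_poly_nonzero[OF \<open>c \<noteq> 0\<close>]
    proof (eventually_elim, intro allI impI notI)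
      fix t y
      assume "poly c t \<noteq> 0" "poly (specialize Q t) y = 0" "poly (pderiv (specialize Q t)) y = 0"
      moreover have "poly (specialize h t) y = poly c t" by (simp add: c poly_specialize)
      ultimately show False
        by (simp add: AB specialize_add specialize_mult specialize_pderiv)
    qed
  qed (use Q(1) in \<open>simp_all add: good_def\<close>)
qed

text \<open>Convention for the two partial derivatives: \<open>map_poly pderiv P\<close>
  differentiates in the parameter \<open>t\<close>, whereas \<open>pderiv P\<close> differentiates
  in \<open>y\<close>.\<close>

lemma pderiv_poly_const: "pderiv (poly P [:y:]) = poly (map_poly pderiv P) [:y:]"
  for P :: "real poly poly"
  by (induction P) (simp_all add: map_poly_pCons pderiv_add pderiv_smult)

text \<open>Division with remainder gives P(t, z) = (z - y(t0)) A(t, z) + P(t, y(t0)), where A at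
  the base point equals the partial derivative in y. Along the curve the left side vanishes, so the
  difference quotient of y is that of P(t, y(t0)) divided by -A, and continuity of y suffices for
  its limit.\<close>

lemma has_real_derivative_implicit:
  fixes P :: "real poly poly"
  assumes cont: "isCont y t0" and root: "\<forall>\<^sub>F t in nhds t0. poly (poly P [:y t:]) t = 0"
    and simple: "poly (poly (pderiv P) [:y t0:]) t0 \<noteq> 0"
  shows "(y has_real_derivative
    - poly (poly (map_poly pderiv P) [:y t0:]) t0 / poly (poly (pderiv P) [:y t0:]) t0) (at t0)"
proof -
  define A where "A = synthetic_div P [:y t0:]"
  have P: "P = [:- [:y t0:], 1:] * A + [:poly P [:y t0:]:]"
    unfolding A_def by (rule synthetic_div_correct'[symmetric])
  have split: "poly (poly P [:z:]) t = (z - y t0) * poly (poly A [:z:]) t + poly (poly P [:y t0:]) t" for z t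
    by (subst P) (simp add: left_diff_distrib)
  have "pderiv P = A + [:- [:y t0:], 1:] * pderiv A"
    by (subst P) (simp add: pderiv_mult pderiv_add pderiv_pCons pderiv_smult)
  then have A0: "poly (poly A [:y t0:]) t0 = poly (poly (pderiv P) [:y t0:]) t0"
    by simp
  have "((\<lambda>t. poly (poly P [:y t0:]) t) has_real_derivative poly (pderiv (poly P [:y t0:])) t0) (at t0)"
    by (rule poly_DERIV)
  then have L: "((\<lambda>t. (poly (poly P [:y t0:]) t - poly (poly P [:y t0:]) t0) / (t - t0))
      \<longlongrightarrow> poly (poly (map_poly pderiv P) [:y t0:]) t0) (at t0)"
    by (simp add: has_field_derivative_iff pderiv_poly_const)
  have yt: "(y \<longlongrightarrow> y t0) (at t0)" using cont by (simp add: isCont_def)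
  have At: "((\<lambda>t. poly (poly A [:y t:]) t) \<longlongrightarrow> poly (poly A [:y t0:]) t0) (at t0)"
    by (intro tendsto_bivariate_poly tendsto_ident_at yt)
  have quot: "((\<lambda>t. - ((poly (poly P [:y t0:]) t - poly (poly P [:y t0:]) t0) / (t - t0)) / poly (poly A [:y t:]) t)
      \<longlongrightarrow> - poly (poly (map_poly pderiv P) [:y t0:]) t0 / poly (poly A [:y t0:]) t0) (at t0)"
    using simple A0 by (intro tendsto_divide tendsto_minus L At) simp
  have "\<forall>\<^sub>F t in at t0. - ((poly (poly P [:y t0:]) t - poly (poly P [:y t0:]) t0) / (t - t0)) / poly (poly A [:y t:]) t
      = (y t - y t0) / (t - t0)"
  proof -
    have r0: "poly (poly P [:y t0:]) t0 = 0" using root by (rule eventually_nhds_x_imp_x)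
    have "\<forall>\<^sub>F t in at t0. poly (poly A [:y t:]) t \<noteq> 0"
      using At by (rule tendsto_imp_eventually_ne) (use simple A0 in simp)
    moreover have "\<forall>\<^sub>F t in at t0. poly (poly P [:y t:]) t = 0"
      using root by (simp add: eventually_nhds_conv_at)
    moreover have "\<forall>\<^sub>F t in at t0. t \<noteq> t0" by (simp add: eventually_at_filter)
    ultimately show ?thesis
    proof eventually_elim
      case (elim t)
      from split[of "y t" t] elim(2)
      have "poly (poly P [:y t0:]) t = - (y t - y t0) * poly (poly A [:y t:]) t" by (simp add: algebra_simps)
      then have "- ((poly (poly P [:y t0:]) t - poly (poly P [:y t0:]) t0) / (t - t0)) / poly (poly A [:y t:]) t =
          - ((- (y t - y t0)) / (t - t0))"
        using elim r0 by simp
      then show ?case by (simp only: minus_divide_left minus_minus)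
    qed
  qed
  from tendsto_cong[OF this] quot A0 show ?thesis
    by (simp add: has_field_derivative_iff)
qed

section \<open>Continuous dependence of real roots on the parameter\<close>

abbreviation real_roots :: "real poly poly \<Rightarrow> real \<Rightarrow> real set" where
  "real_roots Q t \<equiv> {y. poly (poly Q [:y:]) t = 0}"

lemma real_roots_specialize: "real_roots Q t = {y. poly (specialize Q t) y = 0}"
  by (simp add: poly_specialize)

lemma poly_root_bound:
  fixes p :: "real poly"
  assumes "poly p y = 0" "degree p \<le> d" "coeff p d \<noteq> 0"
  shows "\<bar>y\<bar> \<le> 1 + (\<Sum>i<d. \<bar>coeff p i\<bar>) / \<bar>coeff p d\<bar>"
proof (cases "\<bar>y\<bar> \<le> 1")
  case True
  moreover have "0 \<le> (\<Sum>i<d. \<bar>coeff p i\<bar>) / \<bar>coeff p d\<bar>" by (simp add: sum_nonneg)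
  ultimately show ?thesis by linarith
next
  case False
  have d: "degree p = d" using assms(2,3) by (simp add: le_antisym le_degree)
  have sum0: "coeff p d * y ^ d + (\<Sum>i<d. coeff p i * y ^ i) = 0"
    using assms(1) by (simp add: poly_altdef d lessThan_Suc_atMost[symmetric])
  have "d \<noteq> 0"
  proof
    assume "d = 0"
    with sum0 assms(3) show False by simp
  qed
  have "\<bar>coeff p d\<bar> * \<bar>y\<bar> ^ d = \<bar>\<Sum>i<d. coeff p i * y ^ i\<bar>"
    using sum0 by (simp flip: abs_mult power_abs add: add_eq_0_iff)
  also have "\<dots> \<le> (\<Sum>i<d. \<bar>coeff p i\<bar> * \<bar>y\<bar> ^ (d - 1))"
  proof (rule order.trans[OF sum_abs sum_mono])
    fix i assume "i \<in> {..<d}"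
    then have "\<bar>y\<bar> ^ i \<le> \<bar>y\<bar> ^ (d - 1)" using False by (intro power_increasing) auto
    then show "\<bar>coeff p i * y ^ i\<bar> \<le> \<bar>coeff p i\<bar> * \<bar>y\<bar> ^ (d - 1)"
      by (simp add: abs_mult power_abs mult_left_mono)
  qed
  also have "\<dots> = (\<Sum>i<d. \<bar>coeff p i\<bar>) * \<bar>y\<bar> ^ (d - 1)" by (simp add: sum_distrib_right)
  also have "\<bar>coeff p d\<bar> * \<bar>y\<bar> ^ d = (\<bar>coeff p d\<bar> * \<bar>y\<bar>) * \<bar>y\<bar> ^ (d - 1)"
    using \<open>d \<noteq> 0\<close> by (cases d) auto
  finally have "\<bar>coeff p d\<bar> * \<bar>y\<bar> \<le> (\<Sum>i<d. \<bar>coeff p i\<bar>)"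
    by (rule mult_right_le_imp_le) (use False in auto)
  then have "\<bar>y\<bar> \<le> (\<Sum>i<d. \<bar>coeff p i\<bar>) / \<bar>coeff p d\<bar>"
    using assms(3) by (simp add: pos_le_divide_eq mult.commute)
  then show ?thesis by simp
qed

text \<open>The nonzero leading coefficient bounds all roots for \<open>t\<close> near
  \<open>t0\<close>. Roots keeping a distance from those at \<open>t0\<close> would therefore
  accumulate at a further root at \<open>t0\<close>.\<close>

lemma real_roots_near:
  assumes lc: "poly (lead_coeff Q) t0 \<noteq> 0" and e: "e > 0"
  shows "\<forall>\<^sub>F t in nhds t0. \<forall>y\<in>real_roots Q t. \<exists>r\<in>real_roots Q t0. \<bar>y - r\<bar> < e"
proof -
  define d where "d = degree Q"
  define C where "C t = 1 + (\<Sum>i<d. \<bar>poly (coeff Q i) t\<bar>) / \<bar>poly (coeff Q d) t\<bar>" for t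
  have "isCont C t0" unfolding C_def using lc by (intro continuous_intros) (auto simp: d_def)
  then have "\<forall>\<^sub>F t in nhds t0. C t < C t0 + 1"
    by (intro order_tendstoD(2)[of C "C t0"]) (simp_all add: isCont_def tendsto_at_iff_tendsto_nhds)
  moreover have "\<forall>\<^sub>F t in nhds t0. poly (lead_coeff Q) t \<noteq> 0"
  proof -
    have "(poly (lead_coeff Q) \<longlongrightarrow> poly (lead_coeff Q) t0) (nhds t0)"
      using isCont_def tendsto_at_iff_tendsto_nhds poly_isCont by blast
    then show ?thesis using lc by (rule tendsto_imp_eventually_ne)
  qed
  ultimately have bound: "\<forall>\<^sub>F t in nhds t0. \<forall>y\<in>real_roots Q t. \<bar>y\<bar> \<le> C t0 + 1"
  proof eventually_elim
    case (elim t)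
    show ?case
    proof
      fix y assume "y \<in> real_roots Q t"
      then have "\<bar>y\<bar> \<le> 1 + (\<Sum>i<d. \<bar>coeff (specialize Q t) i\<bar>) / \<bar>coeff (specialize Q t) d\<bar>"
        using elim(2) by (intro poly_root_bound degree_le)
          (auto simp: poly_specialize coeff_specialize d_def coeff_eq_0)
      then show "\<bar>y\<bar> \<le> C t0 + 1" using elim(1) by (simp add: C_def coeff_specialize)
    qed
  qed
  show ?thesis
  proof (rule ccontr)
    assume "\<not> ?thesis"
    then have freq: "\<exists>\<^sub>F t in nhds t0. \<exists>y\<in>real_roots Q t. \<forall>r\<in>real_roots Q t0. \<bar>y - r\<bar> \<ge> e"
      by (simp add: not_eventually not_less)
    have "\<exists>t. dist t t0 < inverse (real (Suc n)) \<and>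
        (\<exists>y\<in>real_roots Q t. \<bar>y\<bar> \<le> C t0 + 1 \<and> (\<forall>r\<in>real_roots Q t0. \<bar>y - r\<bar> \<ge> e))" for n
    proof -
      have "\<forall>\<^sub>F t in nhds t0. dist t t0 < inverse (real (Suc n))"
        by (intro eventually_nhds_metric[THEN iffD2]) (auto intro!: exI[of _ "inverse (real (Suc n))"])
      from frequently_eventually_frequently[OF freq eventually_conj[OF this bound]]
      show ?thesis by (auto dest!: frequently_ex)
    qed
    then obtain t y where ty: "\<And>n. dist (t n) t0 < inverse (real (Suc n))"
      "\<And>n. y n \<in> real_roots Q (t n)" "\<And>n. \<bar>y n\<bar> \<le> C t0 + 1"
      "\<And>n r. r \<in> real_roots Q t0 \<Longrightarrow> \<bar>y n - r\<bar> \<ge> e"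
      by metis
    have "t \<longlonglongrightarrow> t0"
      by (rule metric_LIMSEQ_I) (meson ty(1) reals_Archimedean less_trans order_less_le_trans
        inverse_less_imp_less le_imp_inverse_le lift_Suc_antimono_le of_nat_0_less_iff zero_less_Suc of_nat_le_iff Suc_le_mono)
    have "y n \<in> {- (C t0 + 1)..C t0 + 1}" for n using ty(3)[of n] by auto
    then obtain l \<rho> where l: "strict_mono (\<rho> :: nat \<Rightarrow> nat)" "(y \<circ> \<rho>) \<longlonglongrightarrow> l"
      using compact_Icc unfolding compact_eq_seq_compact_metric seq_compact_def by metis
    have yl: "(\<lambda>n. y (\<rho> n)) \<longlonglongrightarrow> l" using l(2) by (simp add: o_def)
    have tl: "(\<lambda>n. t (\<rho> n)) \<longlonglongrightarrow> t0"
      using LIMSEQ_subseq_LIMSEQ[OF \<open>t \<longlonglongrightarrow> t0\<close> l(1)] by (simp add: o_def)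
    have "(\<lambda>n. poly (poly Q [:y (\<rho> n):]) (t (\<rho> n))) \<longlonglongrightarrow> poly (poly Q [:l:]) t0"
      by (intro tendsto_bivariate_poly tl yl)
    then have "poly (poly Q [:l:]) t0 = 0"
      using ty(2) by (simp add: LIMSEQ_const_iff)
    then have "\<bar>y (\<rho> n) - l\<bar> \<ge> e" for n using ty(4) by simp
    moreover have "\<forall>\<^sub>F n in sequentially. dist (y (\<rho> n)) l < e"
      using yl e by (rule tendstoD)
    ultimately show False
      by (auto simp: dist_real_def eventually_sequentially) (meson not_le order_refl)
  qed
qed


lemma poly_pderiv_specialize:
  "poly (pderiv (specialize Q t)) y = poly (poly (pderiv Q) [:y:]) t"
  by (simp add: poly_specialize flip: specialize_pderiv)

text \<open>At a simple root the polynomial changes sign, and opposite signs at the fixed points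
  \<open>r - h\<close> and \<open>r + h\<close> survive small changes of \<open>t\<close>.\<close>

lemma simple_root_persists:
  assumes root: "poly (poly Q [:r:]) t0 = 0" and simple: "poly (poly (pderiv Q) [:r:]) t0 \<noteq> 0"
    and e: "e > 0"
  shows "\<forall>\<^sub>F t in nhds t0. \<exists>y\<in>real_roots Q t. \<bar>y - r\<bar> < e"
proof -
  let ?p = "specialize Q t0"
  have D: "(poly ?p has_real_derivative poly (poly (pderiv Q) [:r:]) t0) (at r)"
    using poly_DERIV[of ?p r] by (simp add: poly_pderiv_specialize)
  have p0: "poly ?p r = 0" using root by (simp add: poly_specialize)
  have "\<exists>d>0. \<forall>h>0. h < d \<longrightarrow> poly ?p (r - h) * poly ?p (r + h) < 0"
  proof (cases "poly (poly (pderiv Q) [:r:]) t0 > 0")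
    case True
    from DERIV_pos_inc_left[OF D True] DERIV_pos_inc_right[OF D True] obtain d d' where
      "d > 0" "d' > 0" "\<And>h. h > 0 \<Longrightarrow> h < d \<Longrightarrow> poly ?p (r - h) < 0"
      "\<And>h. h > 0 \<Longrightarrow> h < d' \<Longrightarrow> 0 < poly ?p (r + h)" unfolding p0 by blast
    then show ?thesis by (intro exI[of _ "min d d'"]) (auto intro: mult_neg_pos)
  next
    case False
    with simple have "poly (poly (pderiv Q) [:r:]) t0 < 0" by simp
    from DERIV_neg_dec_left[OF D this] DERIV_neg_dec_right[OF D this] obtain d d' where
      "d > 0" "d' > 0" "\<And>h. h > 0 \<Longrightarrow> h < d \<Longrightarrow> 0 < poly ?p (r - h)"
      "\<And>h. h > 0 \<Longrightarrow> h < d' \<Longrightarrow> poly ?p (r + h) < 0" unfolding p0 by blast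
    then show ?thesis by (intro exI[of _ "min d d'"]) (auto intro: mult_pos_neg)
  qed
  then obtain d where d: "d > 0" "\<And>h. h > 0 \<Longrightarrow> h < d \<Longrightarrow> poly ?p (r - h) * poly ?p (r + h) < 0"
    by blast
  define h where "h = min d e / 2"
  have h: "h > 0" "h < d" "h < e" using d(1) e by (auto simp: h_def)
  have "((\<lambda>t. poly (poly Q [:r - h:]) t * poly (poly Q [:r + h:]) t) \<longlongrightarrow>
      poly (poly Q [:r - h:]) t0 * poly (poly Q [:r + h:]) t0) (nhds t0)"
    by (intro tendsto_intros filterlim_ident)
  then have "\<forall>\<^sub>F t in nhds t0. poly (poly Q [:r - h:]) t * poly (poly Q [:r + h:]) t < 0"
    using d(2)[OF h(1,2)] by (intro order_tendstoD(2)) (simp_all add: poly_specialize)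
  then show ?thesis
  proof eventually_elim
    case (elim t)
    then obtain y where "r - h < y" "y < r + h" "poly (specialize Q t) y = 0"
      using poly_IVT[of "r - h" "r + h" "specialize Q t"] h(1) by (auto simp: poly_specialize)
    then show ?case using h(3) by (intro bexI[of _ y]) (auto simp: poly_specialize)
  qed
qed

lemma derivative_nonzero_near:
  fixes Q :: "real poly poly"
  assumes "poly (poly (pderiv Q) [:r:]) t0 \<noteq> 0"
  shows "\<forall>\<^sub>F e in at_right 0. \<forall>\<^sub>F t in nhds t0. \<forall>y. \<bar>y - r\<bar> < e \<longrightarrow> poly (poly (pderiv Q) [:y:]) t \<noteq> 0"
proof -
  have "((\<lambda>z. poly (poly (pderiv Q) [:snd z:]) (fst z)) \<longlongrightarrow> poly (poly (pderiv Q) [:r:]) t0)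
      (nhds t0 \<times>\<^sub>F nhds r)"
    by (rule tendsto_bivariate_poly[OF filterlim_fst filterlim_snd])
  then have "\<forall>\<^sub>F z in nhds t0 \<times>\<^sub>F nhds r. poly (poly (pderiv Q) [:snd z:]) (fst z) \<noteq> 0"
    using assms by (rule tendsto_imp_eventually_ne)
  then obtain A B where AB: "eventually A (nhds t0)" "eventually B (nhds r)"
    "\<And>t y. A t \<Longrightarrow> B y \<Longrightarrow> poly (poly (pderiv Q) [:y:]) t \<noteq> 0"
    by (auto simp: eventually_prod_filter)
  obtain d where d: "d > 0" "\<And>y. dist y r < d \<Longrightarrow> B y"
    using AB(2) by (auto simp: eventually_nhds_metric)
  have "\<forall>\<^sub>F e in at_right 0. e < d"
    using d(1) by (auto simp: eventually_at_right_field)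
  then show ?thesis
  proof eventually_elim
    case (elim e)
    show ?case using AB(1)
      by eventually_elim (use AB(3) d(2) elim in \<open>auto simp: dist_real_def\<close>)
  qed
qed

text \<open>Every root at \<open>t0\<close> has a root nearby because simple roots persist, and only
  one, since two would enclose a zero of the derivative. The bound on roots excludes all others.
  Monotonicity is recorded because roots will be numbered by size.\<close>

lemma real_roots_bijection:
  assumes lc: "poly (lead_coeff Q) t0 \<noteq> 0"
    and simple: "\<And>y. y \<in> real_roots Q t0 \<Longrightarrow> poly (poly (pderiv Q) [:y:]) t0 \<noteq> 0"
    and e: "e > 0"
  shows "\<forall>\<^sub>F t in nhds t0. \<exists>\<phi>. \<phi> ` real_roots Q t0 = real_roots Q t \<and>
    strict_mono_on (real_roots Q t0) \<phi> \<and> (\<forall>r\<in>real_roots Q t0. \<bar>\<phi> r - r\<bar> < e)"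
proof -
  let ?R = "real_roots Q t0"
  have "specialize Q t0 \<noteq> 0" using lc by (metis coeff_0 coeff_specialize)
  then have fin: "finite ?R" unfolding real_roots_specialize by (rule poly_roots_finite)
  \<comment> \<open>The radius \<open>d\<close> makes the intervals around the roots at
    \<open>t0\<close> disjoint and, for \<open>t\<close> near \<open>t0\<close>, free of zeros of
    the derivative.\<close>
  have "\<forall>\<^sub>F d in at_right 0. d < e \<and> d > 0 \<and>
      (\<forall>r\<in>?R. (\<forall>\<^sub>F t in nhds t0. \<forall>y. \<bar>y - r\<bar> < d \<longrightarrow> poly (poly (pderiv Q) [:y:]) t \<noteq> 0)) \<and>
      (\<forall>r\<in>?R. \<forall>r'\<in>?R. r \<noteq> r' \<longrightarrow> 2 * d < \<bar>r - r'\<bar>)"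
  proof (intro eventually_conj eventually_ball_finite ballI fin derivative_nonzero_near simple)
    show "\<forall>\<^sub>F d in at_right 0. r \<noteq> r' \<longrightarrow> 2 * d < \<bar>r - r'\<bar>" for r r' :: real
      by (cases "r = r'") (auto simp: eventually_at_right_field intro!: exI[of _ "\<bar>r - r'\<bar> / 2"])
  qed (use e in \<open>auto simp: eventually_at_right_field intro: exI[of _ 1]\<close>)
  then obtain d where d: "d < e" "d > 0"
    "\<forall>r\<in>?R. (\<forall>\<^sub>F t in nhds t0. \<forall>y. \<bar>y - r\<bar> < d \<longrightarrow> poly (poly (pderiv Q) [:y:]) t \<noteq> 0)"
    "\<And>r r'. r \<in> ?R \<Longrightarrow> r' \<in> ?R \<Longrightarrow> r \<noteq> r' \<Longrightarrow> 2 * d < \<bar>r - r'\<bar>"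
    using eventually_happens'[OF trivial_limit_at_right_real] by (smt (verit, best))
  have "\<forall>\<^sub>F t in nhds t0. \<forall>r\<in>?R. \<forall>y. \<bar>y - r\<bar> < d \<longrightarrow> poly (poly (pderiv Q) [:y:]) t \<noteq> 0"
    using d(3) by (intro eventually_ball_finite fin)
  moreover have "\<forall>\<^sub>F t in nhds t0. \<forall>r\<in>?R. \<exists>y\<in>real_roots Q t. \<bar>y - r\<bar> < d"
    using d(2) simple by (intro eventually_ball_finite fin ballI simple_root_persists) auto
  moreover have "\<forall>\<^sub>F t in nhds t0. \<forall>y\<in>real_roots Q t. \<exists>r\<in>?R. \<bar>y - r\<bar> < d"
    using lc d(2) by (rule real_roots_near)
  ultimately show ?thesis
  proof eventually_elim
    case (elim t)
    obtain \<phi> where \<phi>: "\<And>r. r \<in> ?R \<Longrightarrow> \<phi> r \<in> real_roots Q t" "\<And>r. r \<in> ?R \<Longrightarrow> \<bar>\<phi> r - r\<bar> < d"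
      using bchoice[of ?R "\<lambda>r y. y \<in> real_roots Q t \<and> \<bar>y - r\<bar> < d"] elim(2) by blast
    have uniq: "y = y'" if r: "r \<in> ?R" and y: "y \<in> real_roots Q t" "\<bar>y - r\<bar> < d"
      and y': "y' \<in> real_roots Q t" "\<bar>y' - r\<bar> < d" for r y y'
    proof (rule ccontr)
      have no: False if "u < v" "u \<in> real_roots Q t" "\<bar>u - r\<bar> < d" "v \<in> real_roots Q t" "\<bar>v - r\<bar> < d" for u v
      proof -
        obtain w where w: "u < w" "w < v" "poly (specialize Q t) v - poly (specialize Q t) u =
            (v - u) * poly (pderiv (specialize Q t)) w"
          using poly_MVT[OF \<open>u < v\<close>] by blast
        then have "poly (poly (pderiv Q) [:w:]) t = 0"
          using that by (simp add: poly_pderiv_specialize poly_specialize)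
        moreover have "\<bar>w - r\<bar> < d" using w(1,2) that(3,5) by auto
        ultimately show False using elim(1) r by blast
      qed
      assume "y \<noteq> y'"
      then show False using no[of y y'] no[of y' y] y y' by (meson linorder_neqE)
    qed
    have "\<phi> ` ?R = real_roots Q t"
    proof (intro equalityI subsetI)
      fix y assume "y \<in> real_roots Q t"
      moreover from this elim(3) obtain r where "r \<in> ?R" "\<bar>y - r\<bar> < d" by blast
      ultimately show "y \<in> \<phi> ` ?R" using uniq[of r y "\<phi> r"] \<phi> by blast
    qed (use \<phi>(1) in auto)
    moreover have "strict_mono_on ?R \<phi>"
    proof (rule strict_mono_onI)
      fix r r' assume "r \<in> ?R" "r' \<in> ?R" "r < r'"
      then show "\<phi> r < \<phi> r'"
        using d(4)[of r r'] \<phi>(2)[of r] \<phi>(2)[of r'] by linarith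
    qed
    moreover have "\<forall>r\<in>?R. \<bar>\<phi> r - r\<bar> < e" using \<phi>(2) d(1) by force
    ultimately show ?case by blast
  qed
qed

lemma sorted_list_of_set_image_strict_mono:
  fixes \<phi> :: "'a::linorder \<Rightarrow> 'b::linorder"
  assumes "finite A" "strict_mono_on A \<phi>"
  shows "sorted_list_of_set (\<phi> ` A) = map \<phi> (sorted_list_of_set A)"
proof (rule strict_sorted_equal)
  show "sorted_wrt (<) (map \<phi> (sorted_list_of_set A))"
    unfolding sorted_wrt_map
    by (rule sorted_wrt_mono_rel[OF _ strict_sorted_list_of_set])
      (use assms in \<open>auto dest: strict_mono_onD\<close>)
qed (use assms in auto)

text \<open>Numbering the roots by size, from 0, defines each branch on a whole interval at once,
  with no local branches to glue. The value is unspecified when there are at most \<open>j\<close>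
  real roots.\<close>

definition root_branch :: "real poly poly \<Rightarrow> nat \<Rightarrow> real \<Rightarrow> real" where
  "root_branch Q j t = sorted_list_of_set (real_roots Q t) ! j"

lemma root_branch_near:
  assumes lc: "poly (lead_coeff Q) t0 \<noteq> 0"
    and simple: "\<And>y. y \<in> real_roots Q t0 \<Longrightarrow> poly (poly (pderiv Q) [:y:]) t0 \<noteq> 0"
    and e: "e > 0"
  shows "\<forall>\<^sub>F t in nhds t0. card (real_roots Q t) = card (real_roots Q t0) \<and>
    (\<forall>j<card (real_roots Q t0). \<bar>root_branch Q j t - root_branch Q j t0\<bar> < e)"
proof -
  have "\<forall>\<^sub>F t in nhds t0. \<exists>\<phi>. \<phi> ` real_roots Q t0 = real_roots Q t \<and>
    strict_mono_on (real_roots Q t0) \<phi> \<and> (\<forall>r\<in>real_roots Q t0. \<bar>\<phi> r - r\<bar> < e)"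
    using lc simple e by (rule real_roots_bijection)
  then show ?thesis
  proof eventually_elim
    case (elim t)
    let ?R = "real_roots Q t0"
    from elim obtain \<phi> where \<phi>: "\<phi> ` ?R = real_roots Q t"
      "strict_mono_on ?R \<phi>" "\<And>r. r \<in> ?R \<Longrightarrow> \<bar>\<phi> r - r\<bar> < e" by blast
    have "specialize Q t0 \<noteq> 0" using lc by (metis coeff_0 coeff_specialize)
    then have fin: "finite ?R" unfolding real_roots_specialize by (rule poly_roots_finite)
    have "card (real_roots Q t) = card ?R"
      unfolding \<phi>(1)[symmetric] by (intro card_image strict_mono_on_imp_inj_on \<phi>(2))
    moreover have "\<bar>root_branch Q j t - root_branch Q j t0\<bar> < e" if "j < card ?R" for j
    proof -
      have "sorted_list_of_set ?R ! j \<in> ?R"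
        using nth_mem[of j "sorted_list_of_set ?R"] that fin by simp
      then show ?thesis
        unfolding root_branch_def \<phi>(1)[symmetric]
        using sorted_list_of_set_image_strict_mono[OF fin \<phi>(2)] that \<phi>(3) by simp
    qed
    ultimately show ?case by blast
  qed
qed

text \<open>On an interval to the right of 0 the number of real roots of \<open>Q\<close> is locally
  constant, hence constant. There the numbering by size gives continuous branches, and they are
  differentiable by implicit differentiation because all roots are simple.\<close>

lemma root_branches:
  fixes P :: "real poly poly"
  assumes "P \<noteq> 0"
  obtains Q Y l where "Q \<noteq> 0"
    and "\<forall>\<^sub>F t in at_right 0. \<forall>y\<in>real_roots P t. \<exists>j<l. y = Y j t"
    and "\<And>j. j < (l::nat) \<Longrightarrow> \<forall>\<^sub>F t in at_right 0. poly (poly Q [:Y j t:]) t = 0 \<and>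
      poly (poly (pderiv Q) [:Y j t:]) t \<noteq> 0 \<and>
      (Y j has_real_derivative
        - poly (poly (map_poly pderiv Q) [:Y j t:]) t / poly (poly (pderiv Q) [:Y j t:]) t) (at t)"
proof -
  obtain Q where Q: "Q \<noteq> 0"
    "\<forall>\<^sub>F t in at_right 0. \<forall>y. poly (specialize P t) y = 0 \<longrightarrow> poly (specialize Q t) y = 0"
    "\<forall>\<^sub>F t in at_right 0. \<forall>y. poly (specialize Q t) y = 0 \<longrightarrow> poly (pderiv (specialize Q t)) y \<noteq> 0"
    using simple_roots_polynomial[OF assms] .
  have "lead_coeff Q \<noteq> 0" using Q(1) by simp
  from eventually_poly_nonzero[OF this, of 0] Q(2,3)
  have "\<forall>\<^sub>F t in at_right 0. poly (lead_coeff Q) t \<noteq> 0 \<and> real_roots P t \<subseteq> real_roots Q t \<and>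
      (\<forall>y\<in>real_roots Q t. poly (poly (pderiv Q) [:y:]) t \<noteq> 0)"
    by eventually_elim (auto simp: poly_specialize poly_pderiv_specialize)
  then obtain \<delta> where \<delta>: "\<delta> > 0" "\<And>t. 0 < t \<Longrightarrow> t < \<delta> \<Longrightarrow> poly (lead_coeff Q) t \<noteq> 0"
      "\<And>t. 0 < t \<Longrightarrow> t < \<delta> \<Longrightarrow> real_roots P t \<subseteq> real_roots Q t"
      "\<And>t y. 0 < t \<Longrightarrow> t < \<delta> \<Longrightarrow> y \<in> real_roots Q t \<Longrightarrow> poly (poly (pderiv Q) [:y:]) t \<noteq> 0"
    unfolding eventually_at_right_field by blast
  \<comment> \<open>The midpoint is an arbitrary reference point; the number of roots turns out to
    be the same on the whole interval.\<close>
  define l where "l = card (real_roots Q (\<delta> / 2))"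
  have near: "\<forall>\<^sub>F s in nhds t. card (real_roots Q s) = card (real_roots Q t) \<and>
      (\<forall>j<card (real_roots Q t). \<bar>root_branch Q j s - root_branch Q j t\<bar> < e)"
    if "0 < t" "t < \<delta>" "e > 0" for t e
    using \<delta>(2)[OF that(1,2)] \<delta>(4)[OF that(1,2)] that(3) by (rule root_branch_near)
  have card: "card (real_roots Q t) = l" if "0 < t" "t < \<delta>" for t
    unfolding l_def
  proof (rule connected_local_const[where A = "{0<..<\<delta>}"])
    show "\<forall>a\<in>{0<..<\<delta>}. \<forall>\<^sub>F b in at a within {0<..<\<delta>}. card (real_roots Q a) = card (real_roots Q b)"
    proof
      fix a assume "a \<in> {0<..<\<delta>}"
      then have "\<forall>\<^sub>F s in nhds a. card (real_roots Q a) = card (real_roots Q s)"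
        using near[of a 1] by (auto elim: eventually_mono)
      then show "\<forall>\<^sub>F b in at a within {0<..<\<delta>}. card (real_roots Q a) = card (real_roots Q b)"
        by (auto simp: eventually_at_filter elim: eventually_mono)
    qed
  qed (use that \<delta>(1) in auto)
  have fin: "finite (real_roots Q t)" if "0 < t" "t < \<delta>" for t
  proof -
    have "specialize Q t \<noteq> 0" using \<delta>(2)[OF that] by (metis coeff_0 coeff_specialize)
    then show ?thesis unfolding real_roots_specialize by (rule poly_roots_finite)
  qed
  have branch: "root_branch Q j t \<in> real_roots Q t" if "0 < t" "t < \<delta>" "j < l" for j t
    using nth_mem[of j "sorted_list_of_set (real_roots Q t)"] fin[OF that(1,2)] card[OF that(1,2)] that(3)
    unfolding root_branch_def by simp
  have cont: "isCont (root_branch Q j) t" if "0 < t" "t < \<delta>" "j < l" for j t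
  proof -
    have "\<forall>\<^sub>F s in nhds t. dist (root_branch Q j s) (root_branch Q j t) < e" if "e > 0" for e
      using near[OF \<open>0 < t\<close> \<open>t < \<delta>\<close> that] card[OF \<open>0 < t\<close> \<open>t < \<delta>\<close>] \<open>j < l\<close>
      by (auto simp: dist_real_def elim: eventually_mono)
    then have "(root_branch Q j \<longlongrightarrow> root_branch Q j t) (nhds t)" by (rule tendstoI)
    then show ?thesis by (simp add: isCont_def tendsto_at_iff_tendsto_nhds)
  qed
  have ev: "\<forall>\<^sub>F t in at_right 0. 0 < t \<and> t < \<delta>"
    using \<delta>(1) by (auto simp: eventually_at_right_field)
  show ?thesis
  proof (rule that[of Q l "root_branch Q"])
    show "\<forall>\<^sub>F t in at_right 0. \<forall>y\<in>real_roots P t. \<exists>j<l. y = root_branch Q j t"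
      using ev
    proof eventually_elim
      case (elim t)
      show ?case
      proof
        fix y assume "y \<in> real_roots P t"
        then have "y \<in> set (sorted_list_of_set (real_roots Q t))"
          using \<delta>(3) elim fin by auto
        then show "\<exists>j<l. y = root_branch Q j t"
          unfolding in_set_conv_nth root_branch_def using card elim by auto
      qed
    qed
  next
    fix j assume j: "j < l"
    show "\<forall>\<^sub>F t in at_right 0. poly (poly Q [:root_branch Q j t:]) t = 0 \<and>
      poly (poly (pderiv Q) [:root_branch Q j t:]) t \<noteq> 0 \<and>
      (root_branch Q j has_real_derivative - poly (poly (map_poly pderiv Q) [:root_branch Q j t:]) t /
        poly (poly (pderiv Q) [:root_branch Q j t:]) t) (at t)"
      using ev
    proof eventually_elim
      case (elim t)
      have simple: "poly (poly (pderiv Q) [:root_branch Q j t:]) t \<noteq> 0"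
        using branch j elim \<delta>(4) by blast
      have "\<forall>\<^sub>F s in nhds t. s \<in> {0<..<\<delta>}"
        using elim by (intro eventually_nhds_in_open) auto
      then have "\<forall>\<^sub>F s in nhds t. poly (poly Q [:root_branch Q j s:]) s = 0"
        by eventually_elim (use branch j in auto)
      from has_real_derivative_implicit[OF cont this simple] branch[of t j] elim j simple
      show ?case by auto
    qed
  qed (rule Q(1))
qed

section \<open>Hardy fields of algebraic curves\<close>

text \<open>An identity valid for small \<open>t > 0\<close> can be differentiated at such a
  \<open>t\<close> because it holds on a full neighbourhood of \<open>t\<close>.\<close>

lemma eventually_at_right_open:
  fixes P :: "real \<Rightarrow> bool"
  assumes "\<forall>\<^sub>F t in at_right a. P t"
  shows "\<forall>\<^sub>F t in at_right a. \<forall>\<^sub>F s in nhds t. P s"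
proof -
  obtain b where b: "b > a" "\<And>t. a < t \<Longrightarrow> t < b \<Longrightarrow> P t"
    using assms unfolding eventually_at_right_field by blast
  have "\<forall>\<^sub>F s in nhds t. P s" if "a < t" "t < b" for t
  proof -
    have "\<forall>\<^sub>F s in nhds t. s \<in> {a<..<b}" using that by (intro eventually_nhds_in_open) auto
    then show ?thesis by eventually_elim (use b in auto)
  qed
  then show ?thesis using b(1) by (auto simp: eventually_at_right_field)
qed

text \<open>Functions stand for their germs to the right of 0. By \<open>sign\<close> a germ is zero
  or eventually nonzero, so closure under \<open>inverse\<close> makes the germs a field;
  \<open>inverse 0 = 0\<close> covers the zero germ. The constant sign of every element and of its
  derivative does the work of power series expansions.\<close>

locale hardy_field =
  fixes H :: "(real \<Rightarrow> real) set"
  assumes const: "(\<lambda>t. c) \<in> H"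
    and add: "f \<in> H \<Longrightarrow> g \<in> H \<Longrightarrow> (\<lambda>t. f t + g t) \<in> H"
    and mult: "f \<in> H \<Longrightarrow> g \<in> H \<Longrightarrow> (\<lambda>t. f t * g t) \<in> H"
    and inverse: "f \<in> H \<Longrightarrow> (\<lambda>t. inverse (f t)) \<in> H"
    and deriv: "f \<in> H \<Longrightarrow> \<exists>f'\<in>H. \<forall>\<^sub>F t in at_right 0. (f has_real_derivative f' t) (at t)"
    and sign: "f \<in> H \<Longrightarrow> (\<forall>\<^sub>F t in at_right 0. f t > 0) \<or> (\<forall>\<^sub>F t in at_right 0. f t = 0) \<or>
      (\<forall>\<^sub>F t in at_right 0. f t < 0)"
begin

lemma minus: "f \<in> H \<Longrightarrow> (\<lambda>t. - f t) \<in> H"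
  using mult[OF const[of "-1"]] by simp

lemma diff: "f \<in> H \<Longrightarrow> g \<in> H \<Longrightarrow> (\<lambda>t. f t - g t) \<in> H"
  using add[OF _ minus] by simp

lemma divide: "f \<in> H \<Longrightarrow> g \<in> H \<Longrightarrow> (\<lambda>t. f t / g t) \<in> H"
  unfolding divide_inverse by (intro mult inverse)

lemma sum: "(\<And>i. i \<in> A \<Longrightarrow> f i \<in> H) \<Longrightarrow> (\<lambda>t. \<Sum>i\<in>A. f i t) \<in> H"
  by (induction A rule: infinite_finite_induct) (auto intro: const add)

lemma power: "f \<in> H \<Longrightarrow> (\<lambda>t. f t ^ k) \<in> H"
  by (induction k) (auto intro: const mult)

lemma polynomial_function:
  fixes X :: "real \<Rightarrow> 'a::euclidean_space"
  assumes "real_polynomial_function p" and X: "\<And>b. b \<in> Basis \<Longrightarrow> (\<lambda>t. X t \<bullet> b) \<in> H"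
  shows "(\<lambda>t. p (X t)) \<in> H"
  using assms(1)
proof induction
  case (linear f)
  interpret bounded_linear f by fact
  have "(\<Sum>b\<in>Basis. (X t \<bullet> b) * f b) = f (X t)" for t
    by (subst (2) euclidean_representation[symmetric, of "X t"]) (simp add: sum scaleR)
  then have eq: "(\<lambda>t. \<Sum>b\<in>Basis. (X t \<bullet> b) * f b) = (\<lambda>t. f (X t))" by (intro ext)
  have "(\<lambda>t. \<Sum>b\<in>Basis. (X t \<bullet> b) * f b) \<in> H"
    by (intro hardy_field.sum[OF hardy_field_axioms] mult const X)
  then show ?case unfolding eq .
qed (auto intro: const hardy_field.add[OF hardy_field_axioms] mult)

end

text \<open>With \<open>p m\<close> the lowest nonzero coefficient, the relation factors as
  \<open>h t ^ m * k t = 0\<close>, and \<open>k t\<close> equals \<open>poly (p m) t\<close>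
  wherever \<open>h t = 0\<close>. The zeros of \<open>h\<close> are therefore exactly the points
  where \<open>k\<close> does not vanish: a set both closed and open in an interval, hence empty or
  everything.\<close>

lemma algebraic_function_sign:
  fixes h :: "real \<Rightarrow> real" and p :: "nat \<Rightarrow> real poly"
  assumes cont: "\<forall>\<^sub>F t in at_right 0. isCont h t"
    and root: "\<forall>\<^sub>F t in at_right 0. (\<Sum>i\<le>r. poly (p i) t * h t ^ i) = 0"
    and nonzero: "\<exists>i\<le>r. p i \<noteq> 0"
  shows "(\<forall>\<^sub>F t in at_right 0. h t > 0) \<or> (\<forall>\<^sub>F t in at_right 0. h t = 0) \<or>
    (\<forall>\<^sub>F t in at_right 0. h t < 0)"
proof -
  define m where "m = (LEAST i. p i \<noteq> 0)"
  have m: "p m \<noteq> 0" "\<And>i. i < m \<Longrightarrow> p i = 0" "m \<le> r"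
    unfolding m_def using nonzero LeastI_ex[of "\<lambda>i. p i \<noteq> 0"] not_less_Least[of _ "\<lambda>i. p i \<noteq> 0"]
      Least_le[of "\<lambda>i. p i \<noteq> 0"] by (blast, blast, meson order.trans)
  define k where "k t = (\<Sum>i=m..r. poly (p i) t * h t ^ (i - m))" for t
  have hk: "(\<Sum>i\<le>r. poly (p i) t * h t ^ i) = h t ^ m * k t" for t
  proof -
    have "(\<Sum>i\<le>r. poly (p i) t * h t ^ i) = (\<Sum>i=m..r. poly (p i) t * h t ^ i)"
      by (rule sum.mono_neutral_right) (auto simp: m(2) not_le)
    also have "\<dots> = (\<Sum>i=m..r. h t ^ m * (poly (p i) t * h t ^ (i - m)))"
      by (intro sum.cong) (auto simp flip: power_add simp: algebra_simps)
    finally show ?thesis by (simp add: k_def sum_distrib_left)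
  qed
  have k0: "k t = poly (p m) t" if "h t = 0" for t
  proof -
    have "k t = (\<Sum>i=m..r. if i = m then poly (p m) t else 0)"
      unfolding k_def using that by (intro sum.cong) auto
    then show ?thesis using m(3) by simp
  qed
  from cont root eventually_poly_nonzero[OF m(1), of 0]
  have "\<forall>\<^sub>F t in at_right 0. isCont h t \<and> h t ^ m * k t = 0 \<and> poly (p m) t \<noteq> 0"
    unfolding hk by eventually_elim auto
  then obtain \<delta> where \<delta>: "\<delta> > 0" "\<And>t. 0 < t \<Longrightarrow> t < \<delta> \<Longrightarrow> isCont h t"
    "\<And>t. 0 < t \<Longrightarrow> t < \<delta> \<Longrightarrow> h t ^ m * k t = 0" "\<And>t. 0 < t \<Longrightarrow> t < \<delta> \<Longrightarrow> poly (p m) t \<noteq> 0"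
    unfolding eventually_at_right_field by blast
  let ?S = "{0<..<\<delta>}"
  have conth: "continuous_on ?S h" using \<delta>(2) by (auto intro: continuous_at_imp_continuous_on)
  then have contk: "continuous_on ?S k" unfolding k_def by (intro continuous_intros)
  have "{t \<in> ?S. h t = 0} = {t \<in> ?S. k t \<in> - {0}}"
    using \<delta>(3,4) k0 by fastforce
  moreover have "openin (top_of_set ?S) {t \<in> ?S. k t \<in> - {0}}"
    using continuous_openin_preimage_gen[OF contk, of "- {0}"] by (auto simp: vimage_def Int_def)
  ultimately have "openin (top_of_set ?S) {t \<in> ?S. h t = 0}" by simp
  moreover have "closedin (top_of_set ?S) {t \<in> ?S. h t = 0}"
    using conth by (rule continuous_closedin_preimage_constant)
  moreover have conn: "connected ?S" by simp
  ultimately have "{t \<in> ?S. h t = 0} = {} \<or> {t \<in> ?S. h t = 0} = ?S"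
    unfolding connected_clopen by blast
  then show ?thesis
  proof
    assume "{t \<in> ?S. h t = 0} = ?S"
    then have "\<forall>t\<in>?S. h t = 0" by blast
    then have "\<forall>\<^sub>F t in at_right 0. h t = 0"
      using \<delta>(1) unfolding eventually_at_right_field by (intro exI[of _ \<delta>]) simp
    then show ?thesis by simp
  next
    assume ne: "{t \<in> ?S. h t = 0} = {}"
    have conn: "connected (h ` ?S)" using conth conn by (rule connected_continuous_image)
    have zero: "0 \<notin> h ` ?S" using ne by auto
    have "(\<forall>t\<in>?S. h t > 0) \<or> (\<forall>t\<in>?S. h t < 0)"
    proof (rule ccontr)
      assume "\<not> ?thesis"
      then have "\<exists>s\<in>?S. \<not> h s > 0" "\<exists>t\<in>?S. \<not> h t < 0" by blast+
      then obtain s t where st: "s \<in> ?S" "t \<in> ?S" "h s \<le> 0" "0 \<le> h t" unfolding not_less by blast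
      have "0 \<in> h ` ?S"
        by (rule connectedD_interval[OF conn imageI[OF st(1)] imageI[OF st(2)] st(3,4)])
      with zero show False by blast
    qed
    then have "(\<forall>\<^sub>F t in at_right 0. h t > 0) \<or> (\<forall>\<^sub>F t in at_right 0. h t < 0)"
    proof (elim disjE)
      assume "\<forall>t\<in>?S. h t > 0"
      then have "\<forall>\<^sub>F t in at_right 0. h t > 0"
        using \<delta>(1) unfolding eventually_at_right_field by (intro exI[of _ \<delta>]) simp
      then show ?thesis by blast
    next
      assume "\<forall>t\<in>?S. h t < 0"
      then have "\<forall>\<^sub>F t in at_right 0. h t < 0"
        using \<delta>(1) unfolding eventually_at_right_field by (intro exI[of _ \<delta>]) simp
      then show ?thesis by blast
    qed
    then show ?thesis by blast
  qed
qed

section \<open>Rational functions along an algebraic curve\<close>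

lemma real_polynomial_function_bivariate:
  fixes P :: "real poly poly"
  shows "real_polynomial_function (\<lambda>z :: real \<times> 'a::real_inner. poly (poly P [:snd z \<bullet> b:]) (fst z))"
proof -
  have fst: "real_polynomial_function (\<lambda>z :: real \<times> 'a. fst z)"
    by (intro real_polynomial_function.intros(1) bounded_linear_fst)
  have snd: "real_polynomial_function (\<lambda>z :: real \<times> 'a. snd z \<bullet> b)"
    by (intro real_polynomial_function.intros(1) bounded_linear_compose[OF bounded_linear_inner_left bounded_linear_snd])
  have "real_polynomial_function (\<lambda>z :: real \<times> 'a. poly a (fst z))" for a
    by (induction a) (auto intro!: real_polynomial_function.intros(2-) fst)
  then show ?thesis
    by (induction P) (auto intro!: real_polynomial_function.intros(2-) snd)
qed

text \<open>The equations of the coordinates differ in degree and leading coefficient. Multiplying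
  each by the other leading coefficients and by a power of its coordinate gives them a common
  leading coefficient and the common degree \<open>d\<close>. A polynomial in \<open>t\<close> and
  the coordinates is then itself algebraic over the polynomials in \<open>t\<close>.\<close>

lemma algebraic_curve_sign:
  fixes X :: "real \<Rightarrow> 'a::euclidean_space" and Q :: "'a \<Rightarrow> real poly poly"
  assumes Q: "\<And>b. b \<in> Basis \<Longrightarrow> Q b \<noteq> 0"
    and root: "\<forall>\<^sub>F t in at_right 0. \<forall>b\<in>Basis. poly (poly (Q b) [:X t \<bullet> b:]) t = 0"
    and cont: "\<forall>\<^sub>F t in at_right 0. isCont X t"
    and p: "real_polynomial_function p"
  shows "(\<forall>\<^sub>F t in at_right 0. p (t, X t) > 0) \<or> (\<forall>\<^sub>F t in at_right 0. p (t, X t) = 0) \<or>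
    (\<forall>\<^sub>F t in at_right 0. p (t, X t) < 0)"
proof -
  define S where "S = {t. \<forall>b\<in>Basis. poly (poly (Q b) [:X t \<bullet> b:]) t = 0}"
  define ev where "ev t c = poly c t" for t :: real and c :: "real poly"
  interpret coefficient_evaluation ev "\<lambda>t b. X t \<bullet> b" Basis
    by standard (auto simp: ev_def)
  define d where "d = (\<Sum>b\<in>Basis. degree (Q b))"
  interpret monic_system ev "\<lambda>t b. X t \<bullet> b" Basis S "\<Prod>b\<in>Basis. lead_coeff (Q b)" d
  proof
    show "(\<Prod>b\<in>Basis. lead_coeff (Q b)) \<noteq> 0" using Q by simp
    fix b :: 'a assume b: "b \<in> Basis"
    let ?n = "degree (Q b)" and ?a = "\<Prod>b'\<in>Basis - {b}. lead_coeff (Q b')"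
    have n: "?n \<le> d" unfolding d_def using b by (intro member_le_sum) auto
    define R where "R t = (\<Sum>i<?n. ev t (- ?a * coeff (Q b) i) * (X t \<bullet> b) ^ (d - ?n + i))" for t
    have "(\<lambda>t. ev t (- ?a * coeff (Q b) i) * (X t \<bullet> b) ^ (d - ?n + i)) \<in> pspan d" if "i < ?n" for i
      using pspan_mon[of "\<lambda>b'. if b' = b then d - ?n + i else 0" d "- ?a * coeff (Q b) i"] n that b
      by (simp add: mon_single deg_single)
    then have "R \<in> pspan d" unfolding R_def by (intro pspan_sum) auto
    moreover have "ev t (\<Prod>b\<in>Basis. lead_coeff (Q b)) * (X t \<bullet> b) ^ d = R t" if "t \<in> S" for t
    proof -
      have "0 = poly (specialize (Q b) t) (X t \<bullet> b)"
        using that b by (simp add: S_def poly_specialize)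
      also have "degree (specialize (Q b) t) \<le> ?n"
        by (rule degree_le) (simp add: coeff_specialize coeff_eq_0)
      then have "poly (specialize (Q b) t) (X t \<bullet> b) = (\<Sum>i\<le>?n. poly (coeff (Q b) i) t * (X t \<bullet> b) ^ i)"
        by (subst poly_altdef, intro sum.mono_neutral_cong_left)
          (auto simp: coeff_specialize[symmetric] coeff_eq_0)
      finally have lead: "poly (lead_coeff (Q b)) t * (X t \<bullet> b) ^ ?n =
          - (\<Sum>i<?n. poly (coeff (Q b) i) t * (X t \<bullet> b) ^ i)"
        by (simp add: lessThan_Suc_atMost[symmetric])
      have a: "(\<Prod>b\<in>Basis. lead_coeff (Q b)) = lead_coeff (Q b) * ?a"
        using b by (intro prod.remove) auto
      have x: "(X t \<bullet> b) ^ d = (X t \<bullet> b) ^ ?n * (X t \<bullet> b) ^ (d - ?n)"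
        using n by (simp flip: power_add)
      have "ev t (\<Prod>b\<in>Basis. lead_coeff (Q b)) * (X t \<bullet> b) ^ d =
          (poly (lead_coeff (Q b)) t * (X t \<bullet> b) ^ ?n) * (poly ?a t * (X t \<bullet> b) ^ (d - ?n))"
        unfolding ev_def a x poly_mult by (simp only: mult_ac)
      also have "\<dots> = - (\<Sum>i<?n. poly (coeff (Q b) i) t * (X t \<bullet> b) ^ i) *
          (poly ?a t * (X t \<bullet> b) ^ (d - ?n))"
        by (simp only: lead)
      also have "\<dots> = R t"
        unfolding R_def sum_negf[symmetric] sum_distrib_right
        by (intro sum.cong refl) (simp add: ev_def power_add mult_ac)
      finally show ?thesis .
    qed
    ultimately show "\<exists>R\<in>pspan d. \<forall>t\<in>S. ev t (\<Prod>b\<in>Basis. lead_coeff (Q b)) * (X t \<bullet> b) ^ d = R t"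
      by blast
  qed
  have ev_const: "ev t [:c:] = c" and ev_linear: "ev t [:0, c:] = t * c" for t c
    by (simp_all add: ev_def)
  have "reducible (\<lambda>t. p (t, X t))"
    using p
  proof induction
    case (linear f)
    interpret bounded_linear f by fact
    have "t * f (1, 0) + (\<Sum>b\<in>Basis. (x \<bullet> b) * f (0, b)) = f (t, x)" for t x
    proof -
      have "(t, x) = t *\<^sub>R (1, 0) + (\<Sum>b\<in>Basis. (x \<bullet> b) *\<^sub>R (0, b))"
        by (simp add: prod_eq_iff fst_sum snd_sum euclidean_representation)
      then show ?thesis by (simp only: add sum scaleR real_scaleR_def)
    qed
    then have eq: "(\<lambda>t. ev t [:0, f (1, 0):] + (\<Sum>b\<in>Basis. ev t [:f (0, b):] * (X t \<bullet> b))) = (\<lambda>t. f (t, X t))"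
      by (intro ext) (simp only: ev_linear ev_const mult.commute[of "f _" "_ \<bullet> _"])
    have "reducible (\<lambda>t. ev t [:0, f (1, 0):] + (\<Sum>b\<in>Basis. ev t [:f (0, b):] * (X t \<bullet> b)))"
      by (rule reducible_add[OF reducible_const reducible_sum[OF reducible_scale[OF reducible_var]]])
    then show ?case unfolding eq .
  next
    case (const c)
    show ?case using reducible_const[of "[:c:]"] unfolding ev_const .
  qed (auto intro: reducible_add reducible_mult)
  then obtain r q where q: "\<exists>i\<le>r. q i \<noteq> 0"
    "\<And>t. t \<in> S \<Longrightarrow> (\<Sum>i\<le>r. ev t (q i) * p (t, X t) ^ i) = 0"
    by (rule reducible_algebraic) blast
  show ?thesis
  proof (rule algebraic_function_sign[OF _ _ q(1)])
    show "\<forall>\<^sub>F t in at_right 0. (\<Sum>i\<le>r. poly (q i) t * p (t, X t) ^ i) = 0"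
      using root by eventually_elim (use q(2) in \<open>simp add: S_def ev_def\<close>)
    have "continuous_on UNIV p"
      using p by (intro continuous_on_polymonial_function) (simp add: real_polynomial_function_eq)
    then have contp: "isCont p z" for z
      by (rule continuous_on_interior) simp
    show "\<forall>\<^sub>F t in at_right 0. isCont (\<lambda>t. p (t, X t)) t"
      using cont
    proof eventually_elim
      case (elim t)
      then have "isCont (\<lambda>t. (t, X t)) t" by (intro isCont_Pair continuous_ident)
      from isCont_o2[OF this contp] show ?case .
    qed
  qed
qed

lemma eventually_trichotomy:
  fixes h :: "'a \<Rightarrow> real"
  assumes "eventually (\<lambda>t. h t > 0) F \<or> eventually (\<lambda>t. h t = 0) F \<or> eventually (\<lambda>t. h t < 0) F"
  shows "eventually (\<lambda>t. h t \<noteq> 0) F \<or> eventually (\<lambda>t. h t = 0) F"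
    and "eventually (\<lambda>t. h t \<ge> 0) F \<or> eventually (\<lambda>t. h t < 0) F"
proof -
  have "eventually (\<lambda>t. h t \<noteq> 0) F" "eventually (\<lambda>t. h t \<ge> 0) F" if "eventually (\<lambda>t. h t > 0) F"
    using that by (eventually_elim, simp)+
  moreover have "eventually (\<lambda>t. h t \<ge> 0) F" if "eventually (\<lambda>t. h t = 0) F"
    using that by eventually_elim simp
  moreover have "eventually (\<lambda>t. h t \<noteq> 0) F" if "eventually (\<lambda>t. h t < 0) F"
    using that by eventually_elim simp
  ultimately show "eventually (\<lambda>t. h t \<noteq> 0) F \<or> eventually (\<lambda>t. h t = 0) F"
    and "eventually (\<lambda>t. h t \<ge> 0) F \<or> eventually (\<lambda>t. h t < 0) F"
    using assms by blast+
qed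

text \<open>The field consists of quotients of polynomials in \<open>t\<close> and
  \<open>X t\<close>. It is closed under derivatives because implicit differentiation expresses the
  velocities of the coordinates as such quotients.\<close>

lemma algebraic_curve_hardy_field:
  fixes X :: "real \<Rightarrow> 'a::euclidean_space" and Q :: "'a \<Rightarrow> real poly poly"
  assumes Q: "\<And>b. b \<in> Basis \<Longrightarrow> Q b \<noteq> 0"
    and curve: "\<And>b. b \<in> Basis \<Longrightarrow> \<forall>\<^sub>F t in at_right 0. poly (poly (Q b) [:X t \<bullet> b:]) t = 0 \<and>
      poly (poly (pderiv (Q b)) [:X t \<bullet> b:]) t \<noteq> 0 \<and>
      ((\<lambda>t. X t \<bullet> b) has_real_derivative
        - poly (poly (map_poly pderiv (Q b)) [:X t \<bullet> b:]) t / poly (poly (pderiv (Q b)) [:X t \<bullet> b:]) t) (at t)"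
  obtains H where "hardy_field H" and "(\<lambda>t. t) \<in> H" and "\<And>b. (\<lambda>t. X t \<bullet> b) \<in> H"
proof -
  have "\<forall>\<^sub>F t in at_right 0. \<forall>b\<in>Basis. isCont (\<lambda>t. X t \<bullet> b) t"
  proof (intro eventually_ball_finite ballI)
    fix b :: 'a assume "b \<in> Basis"
    from curve[OF this] show "\<forall>\<^sub>F t in at_right 0. isCont (\<lambda>t. X t \<bullet> b) t"
      by eventually_elim (auto intro: DERIV_isCont)
  qed simp
  then have contX: "\<forall>\<^sub>F t in at_right 0. isCont X t"
  proof eventually_elim
    case (elim t)
    then have "isCont (\<lambda>t. \<Sum>b\<in>Basis. (X t \<bullet> b) *\<^sub>R b) t" by (intro continuous_sum continuous_scaleR continuous_const) auto
    then show ?case by (simp add: euclidean_representation)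
  qed
  have sign: "(\<forall>\<^sub>F t in at_right 0. p (t, X t) > 0) \<or> (\<forall>\<^sub>F t in at_right 0. p (t, X t) = 0) \<or>
      (\<forall>\<^sub>F t in at_right 0. p (t, X t) < 0)" if "real_polynomial_function p" for p
  proof (rule algebraic_curve_sign[OF Q _ contX that])
    show "\<forall>\<^sub>F t in at_right 0. \<forall>b\<in>Basis. poly (poly (Q b) [:X t \<bullet> b:]) t = 0"
      by (intro eventually_ball_finite ballI eventually_mono[OF curve]) auto
  qed
  \<comment> \<open>Only the germ of \<open>y\<close> is constrained. The denominator must be
    nonzero at every point of the curve with small \<open>t > 0\<close>, not merely as a
    polynomial.\<close>
  define H where "H = {y :: real \<Rightarrow> real. \<exists>p r. real_polynomial_function p \<and> real_polynomial_function r \<and>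
    (\<forall>\<^sub>F t in at_right 0. r (t, X t) \<noteq> 0 \<and> y t = p (t, X t) / r (t, X t))}"
  have HI: "y \<in> H" if "real_polynomial_function p" "real_polynomial_function r"
    "\<forall>\<^sub>F t in at_right 0. r (t, X t) \<noteq> 0 \<and> y t = p (t, X t) / r (t, X t)" for y p r
    using that unfolding H_def by blast
  have HE: "\<exists>p r. real_polynomial_function p \<and> real_polynomial_function r \<and>
    (\<forall>\<^sub>F t in at_right 0. r (t, X t) \<noteq> 0 \<and> y t = p (t, X t) / r (t, X t))" if "y \<in> H" for y
    using that unfolding H_def by blast
  have H_poly: "(\<lambda>t. p (t, X t)) \<in> H" if "real_polynomial_function p" for p
    by (rule HI[OF that, of "\<lambda>_. 1"]) auto
  have H_const: "(\<lambda>t. c) \<in> H" for c using H_poly[of "\<lambda>_. c"] by auto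
  have H_add: "(\<lambda>t. f t + h t) \<in> H" if fh: "f \<in> H" "h \<in> H" for f h
  proof -
    obtain p r p' r' where *: "real_polynomial_function p" "real_polynomial_function r"
      "real_polynomial_function p'" "real_polynomial_function r'"
      "\<forall>\<^sub>F t in at_right 0. r (t, X t) \<noteq> 0 \<and> f t = p (t, X t) / r (t, X t)"
      "\<forall>\<^sub>F t in at_right 0. r' (t, X t) \<noteq> 0 \<and> h t = p' (t, X t) / r' (t, X t)"
      using HE[OF fh(1)] HE[OF fh(2)] by blast
    show ?thesis
    proof (rule HI[of "\<lambda>z. p z * r' z + p' z * r z" "\<lambda>z. r z * r' z"])
      show "\<forall>\<^sub>F t in at_right 0. r (t, X t) * r' (t, X t) \<noteq> 0 \<and>
          f t + h t = (p (t, X t) * r' (t, X t) + p' (t, X t) * r (t, X t)) / (r (t, X t) * r' (t, X t))"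
        using *(5,6) by eventually_elim (simp add: add_frac_eq)
    qed (intro real_polynomial_function.intros(3,4) *)+
  qed
  have H_mult: "(\<lambda>t. f t * h t) \<in> H" if fh: "f \<in> H" "h \<in> H" for f h
  proof -
    obtain p r p' r' where *: "real_polynomial_function p" "real_polynomial_function r"
      "real_polynomial_function p'" "real_polynomial_function r'"
      "\<forall>\<^sub>F t in at_right 0. r (t, X t) \<noteq> 0 \<and> f t = p (t, X t) / r (t, X t)"
      "\<forall>\<^sub>F t in at_right 0. r' (t, X t) \<noteq> 0 \<and> h t = p' (t, X t) / r' (t, X t)"
      using HE[OF fh(1)] HE[OF fh(2)] by blast
    show ?thesis
    proof (rule HI[of "\<lambda>z. p z * p' z" "\<lambda>z. r z * r' z"])
      show "\<forall>\<^sub>F t in at_right 0. r (t, X t) * r' (t, X t) \<noteq> 0 \<and>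
          f t * h t = p (t, X t) * p' (t, X t) / (r (t, X t) * r' (t, X t))"
        using *(5,6) by eventually_elim simp
    qed (intro real_polynomial_function.intros(4) *)+
  qed
  have H_inverse: "(\<lambda>t. inverse (f t)) \<in> H" if f: "f \<in> H" for f
  proof -
    obtain p r where *: "real_polynomial_function p" "real_polynomial_function r"
      "\<forall>\<^sub>F t in at_right 0. r (t, X t) \<noteq> 0 \<and> f t = p (t, X t) / r (t, X t)"
      using HE[OF f] by blast
    consider "\<forall>\<^sub>F t in at_right 0. p (t, X t) \<noteq> 0" | "\<forall>\<^sub>F t in at_right 0. p (t, X t) = 0"
      using eventually_trichotomy(1)[OF sign[OF *(1)]] by blast
    then show ?thesis
    proof cases
      case 1
      with *(3) have "\<forall>\<^sub>F t in at_right 0. p (t, X t) \<noteq> 0 \<and> inverse (f t) = r (t, X t) / p (t, X t)"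
        by eventually_elim simp
      then show ?thesis by (rule HI[OF *(2,1)])
    next
      case 2
      with *(3) have "\<forall>\<^sub>F t in at_right 0. (1::real) \<noteq> 0 \<and> inverse (f t) = 0 / 1"
        by eventually_elim simp
      then show ?thesis by (intro HI[of "\<lambda>_. 0" "\<lambda>_. 1"]) auto
    qed
  qed
  have H_coord: "(\<lambda>t. X t \<bullet> b) \<in> H" for b
    using H_poly[of "\<lambda>z. snd z \<bullet> b"]
    by (simp add: real_polynomial_function.intros(1)
        bounded_linear_compose[OF bounded_linear_inner_left bounded_linear_snd])
  have H_divide: "(\<lambda>t. f t / h t) \<in> H" if "f \<in> H" "h \<in> H" for f h
    unfolding divide_inverse using that by (intro H_mult H_inverse)
  have H_sum: "(\<lambda>t. \<Sum>i\<in>A. f i t) \<in> H" if "finite A" "\<And>i. i \<in> A \<Longrightarrow> f i \<in> H" for f and A :: "'a set"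
    using that by (induction A rule: finite_induct) (auto intro: H_const H_add)
  have deriv_poly: "\<exists>f'\<in>H. \<forall>\<^sub>F t in at_right 0. ((\<lambda>t. p (t, X t)) has_real_derivative f' t) (at t)"
    if "real_polynomial_function p" for p
    using that
  proof induction
    case (linear f)
    interpret bounded_linear f by fact
    have "t * f (1, 0) + (\<Sum>b\<in>Basis. (x \<bullet> b) * f (0, b)) = f (t, x)" for t x
    proof -
      have "(t, x) = t *\<^sub>R (1, 0) + (\<Sum>b\<in>Basis. (x \<bullet> b) *\<^sub>R (0, b))"
        by (simp add: prod_eq_iff fst_sum snd_sum euclidean_representation)
      then show ?thesis by (simp only: add sum scaleR real_scaleR_def)
    qed
    then have eq: "(\<lambda>t. t * f (1, 0) + (\<Sum>b\<in>Basis. (X t \<bullet> b) * f (0, b))) = (\<lambda>t. f (t, X t))"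
      by (intro ext)
    define y' where "y' b t = - poly (poly (map_poly pderiv (Q b)) [:X t \<bullet> b:]) t /
      poly (poly (pderiv (Q b)) [:X t \<bullet> b:]) t" for b t
    have y': "y' b \<in> H" for b
      using H_divide[OF H_mult[OF H_const[of "-1"] H_poly[OF real_polynomial_function_bivariate]]
          H_poly[OF real_polynomial_function_bivariate], of "map_poly pderiv (Q b)" b "pderiv (Q b)" b]
      by (simp add: y'_def[abs_def])
    have "\<forall>\<^sub>F t in at_right 0. \<forall>b\<in>Basis. ((\<lambda>t. X t \<bullet> b) has_real_derivative y' b t) (at t)"
      unfolding y'_def by (intro eventually_ball_finite ballI eventually_mono[OF curve]) auto
    then have "\<forall>\<^sub>F t in at_right 0. ((\<lambda>t. f (t, X t)) has_real_derivative
        (f (1, 0) + (\<Sum>b\<in>Basis. y' b t * f (0, b)))) (at t)"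
      unfolding eq[symmetric]
    proof eventually_elim
      case (elim t)
      have "((\<lambda>t. \<Sum>b\<in>Basis. (X t \<bullet> b) * f (0, b)) has_real_derivative
          (\<Sum>b\<in>Basis. y' b t * f (0, b))) (at t)"
        using elim by (intro DERIV_sum DERIV_cmult_right) auto
      from DERIV_add[OF DERIV_cmult_right[OF DERIV_ident, of "f (1, 0)"] this]
      show ?case by simp
    qed
    moreover have "(\<lambda>t. f (1, 0) + (\<Sum>b\<in>Basis. y' b t * f (0, b))) \<in> H"
      by (intro H_add H_const H_sum H_mult y') simp
    ultimately show ?case by (rule bexI)
  next
    case (const c)
    show ?case by (intro bexI[OF _ H_const[of 0]]) simp
  next
    case (add f h)
    then obtain f' h' where *: "f' \<in> H" "h' \<in> H"
      "\<forall>\<^sub>F t in at_right 0. ((\<lambda>t. f (t, X t)) has_real_derivative f' t) (at t)"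
      "\<forall>\<^sub>F t in at_right 0. ((\<lambda>t. h (t, X t)) has_real_derivative h' t) (at t)" by blast
    from *(3,4) have "\<forall>\<^sub>F t in at_right 0. ((\<lambda>t. f (t, X t) + h (t, X t)) has_real_derivative f' t + h' t) (at t)"
      by eventually_elim (rule DERIV_add)
    then show ?case by (rule bexI[OF _ H_add[OF *(1,2)]])
  next
    case (mult f h)
    then obtain f' h' where *: "f' \<in> H" "h' \<in> H"
      "\<forall>\<^sub>F t in at_right 0. ((\<lambda>t. f (t, X t)) has_real_derivative f' t) (at t)"
      "\<forall>\<^sub>F t in at_right 0. ((\<lambda>t. h (t, X t)) has_real_derivative h' t) (at t)" by blast
    from *(3,4) have "\<forall>\<^sub>F t in at_right 0. ((\<lambda>t. f (t, X t) * h (t, X t)) has_real_derivative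
        f' t * h (t, X t) + h' t * f (t, X t)) (at t)"
      by eventually_elim (rule DERIV_mult)
    moreover have "(\<lambda>t. f' t * h (t, X t) + h' t * f (t, X t)) \<in> H"
      by (intro H_add H_mult H_poly * mult.hyps)
    ultimately show ?case by (rule bexI)
  qed
  have "hardy_field H"
  proof
    fix f assume "f \<in> H"
    then obtain p r where *: "real_polynomial_function p" "real_polynomial_function r"
      "\<forall>\<^sub>F t in at_right 0. r (t, X t) \<noteq> 0 \<and> f t = p (t, X t) / r (t, X t)"
      using HE by blast
    obtain p' r' where d: "p' \<in> H" "r' \<in> H"
      "\<forall>\<^sub>F t in at_right 0. ((\<lambda>t. p (t, X t)) has_real_derivative p' t) (at t)"
      "\<forall>\<^sub>F t in at_right 0. ((\<lambda>t. r (t, X t)) has_real_derivative r' t) (at t)"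
      using deriv_poly *(1,2) by blast
    let ?f' = "\<lambda>t. (p' t * r (t, X t) + (- 1) * (p (t, X t) * r' t)) / (r (t, X t) * r (t, X t))"
    have "?f' \<in> H" by (intro H_divide H_add H_mult H_const H_poly * d)
    moreover have "\<forall>\<^sub>F t in at_right 0. (f has_real_derivative ?f' t) (at t)"
      using eventually_at_right_open[OF *(3)] d(3,4)
    proof eventually_elim
      case (elim t)
      have r: "r (t, X t) \<noteq> 0" using eventually_nhds_x_imp_x[OF elim(1)] by blast
      have "((\<lambda>t. p (t, X t) / r (t, X t)) has_real_derivative
          (p' t * r (t, X t) - p (t, X t) * r' t) / (r (t, X t) * r (t, X t))) (at t)"
        using elim(2,3) r by (rule DERIV_divide)
      moreover have "\<forall>\<^sub>F s in nhds t. p (s, X s) / r (s, X s) = f s"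
        using elim(1) by eventually_elim simp
      ultimately show ?case by (subst (asm) DERIV_cong_ev[OF refl _ refl]) simp_all
    qed
    ultimately show "\<exists>f'\<in>H. \<forall>\<^sub>F t in at_right 0. (f has_real_derivative f' t) (at t)"
      by (intro bexI[of _ ?f'])
    \<comment> \<open>A quotient has the sign of the product of numerator and denominator, which is
      a polynomial.\<close>
    have mult_sign: "(\<forall>\<^sub>F t in at_right 0. p (t, X t) * r (t, X t) > 0) \<or>
        (\<forall>\<^sub>F t in at_right 0. p (t, X t) * r (t, X t) = 0) \<or> (\<forall>\<^sub>F t in at_right 0. p (t, X t) * r (t, X t) < 0)"
      by (rule sign) (intro real_polynomial_function.intros(4) *)
    have pos: "\<forall>\<^sub>F t in at_right 0. sgn (p (t, X t) * r (t, X t)) = sgn (f t)"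
      using *(3) by eventually_elim (auto simp: sgn_if zero_less_mult_iff zero_less_divide_iff)
    from mult_sign show "(\<forall>\<^sub>F t in at_right 0. f t > 0) \<or> (\<forall>\<^sub>F t in at_right 0. f t = 0) \<or>
        (\<forall>\<^sub>F t in at_right 0. f t < 0)"
    proof (elim disjE)
      assume "\<forall>\<^sub>F t in at_right 0. p (t, X t) * r (t, X t) > 0"
      with pos have "\<forall>\<^sub>F t in at_right 0. f t > 0" by eventually_elim (metis sgn_greater)
      then show ?thesis by blast
    next
      assume "\<forall>\<^sub>F t in at_right 0. p (t, X t) * r (t, X t) = 0"
      with pos have "\<forall>\<^sub>F t in at_right 0. f t = 0" by eventually_elim (metis sgn_zero_iff)
      then show ?thesis by blast
    next
      assume "\<forall>\<^sub>F t in at_right 0. p (t, X t) * r (t, X t) < 0"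
      with pos have "\<forall>\<^sub>F t in at_right 0. f t < 0" by eventually_elim (metis sgn_less)
      then show ?thesis by blast
    qed
  qed (auto intro: H_const H_add H_mult H_inverse)
  moreover have "(\<lambda>t. t) \<in> H"
    using H_poly[of fst] by (simp add: real_polynomial_function.intros(1) bounded_linear_fst)
  ultimately show ?thesis using H_coord by (rule that)
qed

text \<open>The parameter \<open>t\<close> is the radius of the cube. For small \<open>t\<close> the
  coordinates of a maximizer lie on branches of roots, and there are finitely many choices
  \<open>J\<close> of branches. One choice yields suitable points at arbitrarily small radii; since
  the functions that express suitability have eventually constant sign, it does so at all small
  radii.\<close>

lemma curve_selection:
  fixes g :: "'a::euclidean_space \<Rightarrow> real"
  assumes g: "real_polynomial_function g" and pos: "\<And>e. e > 0 \<Longrightarrow> \<exists>x. norm x < e \<and> g x > 0"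
  obtains X H where "hardy_field H" and "\<And>b. b \<in> Basis \<Longrightarrow> (\<lambda>t. X t \<bullet> b) \<in> H"
    and "\<forall>\<^sub>F t in at_right 0. g (X t) > 0" and "(X \<longlongrightarrow> 0) (at_right 0)"
proof -
  obtain P :: "'a \<Rightarrow> real poly poly" where P: "\<And>b. b \<in> Basis \<Longrightarrow> P b \<noteq> 0"
    "\<And>e. e > 0 \<Longrightarrow> \<exists>x \<in> cbox (- (e *\<^sub>R One)) (e *\<^sub>R One).
      (\<forall>y \<in> cbox (- (e *\<^sub>R One)) (e *\<^sub>R One). g y \<le> g x) \<and>
      (\<forall>b\<in>Basis. poly (poly (P b) [:x \<bullet> b:]) e = 0)"
    using polynomial_maximizer_algebraic[OF g] by blast
  \<comment> \<open>The triple collects the squarefree polynomial, its branches and their number, so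
    that a single choice over \<open>Basis\<close> provides all three.\<close>
  define branched where "branched b q \<longleftrightarrow> (case q of (Q, Y, l) \<Rightarrow> Q \<noteq> 0 \<and>
      (\<forall>\<^sub>F t in at_right 0. \<forall>y\<in>real_roots (P b) t. \<exists>j<l. y = Y j t) \<and>
      (\<forall>j<l::nat. \<forall>\<^sub>F t in at_right 0. poly (poly Q [:Y j t:]) t = 0 \<and>
        poly (poly (pderiv Q) [:Y j t:]) t \<noteq> 0 \<and>
        (Y j has_real_derivative
          - poly (poly (map_poly pderiv Q) [:Y j t:]) t / poly (poly (pderiv Q) [:Y j t:]) t) (at t)))"
    for b q
  have "\<exists>q. branched b q" if b: "b \<in> Basis" for b
  proof (rule root_branches[OF P(1)[OF b]])
    fix Q Y l
    assume "Q \<noteq> 0" "\<forall>\<^sub>F t in at_right 0. \<forall>y\<in>real_roots (P b) t. \<exists>j<l. y = Y j t"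
      "\<And>j. j < (l::nat) \<Longrightarrow> \<forall>\<^sub>F t in at_right 0. poly (poly Q [:Y j t:]) t = 0 \<and>
        poly (poly (pderiv Q) [:Y j t:]) t \<noteq> 0 \<and>
        (Y j has_real_derivative
          - poly (poly (map_poly pderiv Q) [:Y j t:]) t / poly (poly (pderiv Q) [:Y j t:]) t) (at t)"
    then have "branched b (Q, Y, l)" unfolding branched_def by simp
    then show ?thesis ..
  qed
  then obtain q where q: "\<And>b. b \<in> Basis \<Longrightarrow> branched b (q b)"
    using bchoice[of Basis branched] by blast
  define Q where "Q b = fst (q b)" for b
  define Y where "Y b = fst (snd (q b))" for b
  define l where "l b = snd (snd (q b))" for b
  have Q0: "Q b \<noteq> 0"
    and cover: "\<forall>\<^sub>F t in at_right 0. \<forall>y\<in>real_roots (P b) t. \<exists>j<l b. y = Y b j t"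
    and branch: "\<And>j. j < l b \<Longrightarrow> \<forall>\<^sub>F t in at_right 0. poly (poly (Q b) [:Y b j t:]) t = 0 \<and>
        poly (poly (pderiv (Q b)) [:Y b j t:]) t \<noteq> 0 \<and>
        (Y b j has_real_derivative
          - poly (poly (map_poly pderiv (Q b)) [:Y b j t:]) t / poly (poly (pderiv (Q b)) [:Y b j t:]) t) (at t)"
    if "b \<in> Basis" for b
    using q[OF that] unfolding branched_def Q_def Y_def l_def by (simp_all add: case_prod_unfold)
  define Z where "Z J t = (\<Sum>b\<in>Basis. Y b (J b) t *\<^sub>R b)" for J t
  have Zb: "Z J t \<bullet> b = Y b (J b) t" if "b \<in> Basis" for J t b
    unfolding Z_def using that by simp
  define good where "good J t \<longleftrightarrow> g (Z J t) > 0 \<and> (\<forall>b\<in>Basis. \<bar>Z J t \<bullet> b\<bar> \<le> t)" for J t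
  let ?J = "\<Pi>\<^sub>E b\<in>Basis. {..<l b}"
  have "\<forall>\<^sub>F t in at_right 0. \<forall>b\<in>Basis. \<forall>y\<in>real_roots (P b) t. \<exists>j<l b. y = Y b j t"
    by (intro eventually_ball_finite ballI cover) auto
  moreover have "\<forall>\<^sub>F t in at_right 0. t > (0::real)" by (simp add: eventually_at_right_less)
  ultimately have "\<forall>\<^sub>F t in at_right 0. \<exists>J\<in>?J. good J t"
  proof eventually_elim
    case (elim t)
    obtain x where x: "x \<in> cbox (- (t *\<^sub>R One)) (t *\<^sub>R One)"
      "\<And>y. y \<in> cbox (- (t *\<^sub>R One)) (t *\<^sub>R One) \<Longrightarrow> g y \<le> g x"
      "\<And>b. b \<in> Basis \<Longrightarrow> x \<bullet> b \<in> real_roots (P b) t"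
      using P(2)[OF elim(2)] by blast
    obtain j where j: "\<And>b. b \<in> Basis \<Longrightarrow> j b < l b \<and> x \<bullet> b = Y b (j b) t"
      using bchoice[of Basis "\<lambda>b j. j < l b \<and> x \<bullet> b = Y b j t"] x(3) elim(1) by blast
    define J where "J = restrict j Basis"
    have "x = Z J t"
      by (rule euclidean_eqI) (simp add: Zb j J_def)
    moreover obtain y where "norm y < t" "g y > 0" using pos[OF elim(2)] by blast
    then have "y \<in> cbox (- (t *\<^sub>R One)) (t *\<^sub>R One)"
      unfolding mem_cube by (meson Basis_le_norm less_imp_le order.trans)
    ultimately have "good J t"
      using x(1) x(2)[of y] \<open>g y > 0\<close> unfolding good_def mem_cube by auto
    moreover have "J \<in> ?J" using j by (auto simp: J_def)
    ultimately show ?case by blast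
  qed
  moreover have "finite ?J" by (intro finite_PiE) auto
  ultimately obtain J where J: "J \<in> ?J" "\<exists>\<^sub>F t in at_right 0. good J t"
  proof -
    have "\<exists>J\<in>?J. \<exists>\<^sub>F t in at_right 0. good J t"
    proof (rule ccontr)
      assume "\<not> ?thesis"
      then have "\<forall>\<^sub>F t in at_right 0. \<forall>J\<in>?J. \<not> good J t"
        using \<open>finite ?J\<close> by (intro eventually_ball_finite) (auto simp: not_frequently)
      with \<open>\<forall>\<^sub>F t in at_right 0. \<exists>J\<in>?J. good J t\<close> have "\<forall>\<^sub>F t in at_right (0::real). False"
        by eventually_elim blast
      then show False by simp
    qed
    then show ?thesis using that by blast
  qed
  define X where "X = Z J"
  have Xb: "X t \<bullet> b = Y b (J b) t" if "b \<in> Basis" for t b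
    using Zb[OF that] by (simp add: X_def)
  have Jl: "J b < l b" if "b \<in> Basis" for b using J(1) that by auto
  have curve: "\<forall>\<^sub>F t in at_right 0. poly (poly (Q b) [:X t \<bullet> b:]) t = 0 \<and>
      poly (poly (pderiv (Q b)) [:X t \<bullet> b:]) t \<noteq> 0 \<and>
      ((\<lambda>t. X t \<bullet> b) has_real_derivative
        - poly (poly (map_poly pderiv (Q b)) [:X t \<bullet> b:]) t / poly (poly (pderiv (Q b)) [:X t \<bullet> b:]) t) (at t)"
    if "b \<in> Basis" for b
    using branch[OF that Jl[OF that]] by (simp add: Xb[OF that])
  obtain H where H: "hardy_field H" "(\<lambda>t. t) \<in> H" "\<And>b. (\<lambda>t. X t \<bullet> b) \<in> H"
    using algebraic_curve_hardy_field[of Q X] Q0 curve by blast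
  interpret hardy_field H by (rule H(1))
  have gpos: "\<forall>\<^sub>F t in at_right 0. g (X t) > 0"
  proof (rule ccontr)
    assume neg: "\<not> ?thesis"
    have "\<not> (\<forall>\<^sub>F t in at_right 0. g (X t) \<le> 0)"
    proof
      assume "\<forall>\<^sub>F t in at_right 0. g (X t) \<le> 0"
      then have "\<forall>\<^sub>F t in at_right 0. \<not> good J t"
        by eventually_elim (simp add: good_def X_def)
      with J(2) show False by (simp add: frequently_def)
    qed
    then have "\<not> (\<forall>\<^sub>F t in at_right 0. - g (X t) \<ge> 0)" by simp
    moreover have "(\<lambda>t. - g (X t)) \<in> H" by (intro minus polynomial_function[OF g H(3)])
    ultimately have "\<forall>\<^sub>F t in at_right 0. - g (X t) < 0"
      using eventually_trichotomy(2)[OF sign] by blast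
    with neg show False by simp
  qed
  have small: "\<forall>\<^sub>F t in at_right 0. \<bar>X t \<bullet> b\<bar> \<le> t" if b: "b \<in> Basis" for b
  proof (rule ccontr)
    assume neg: "\<not> ?thesis"
    \<comment> \<open>Squaring turns the bound on the coordinate into a sign condition on an element
      of \<open>H\<close>.\<close>
    have "(\<lambda>t. t * t - (X t \<bullet> b) * (X t \<bullet> b)) \<in> H"
      by (intro diff mult H)
    note s = sign[OF this]
    have "\<forall>\<^sub>F t in at_right 0. \<not> good J t"
    proof -
      consider "\<forall>\<^sub>F t in at_right 0. t * t - (X t \<bullet> b) * (X t \<bullet> b) \<ge> 0"
        | "\<forall>\<^sub>F t in at_right 0. t * t - (X t \<bullet> b) * (X t \<bullet> b) < 0"
        using eventually_trichotomy(2)[OF s] by blast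
      then show ?thesis
      proof cases
        case 1
        with eventually_at_right_less[of "0::real"] have "\<forall>\<^sub>F t in at_right 0. \<bar>X t \<bullet> b\<bar> \<le> t"
          by eventually_elim (use abs_le_square_iff in \<open>force simp: power2_eq_square\<close>)
        with neg show ?thesis by blast
      next
        case 2
        with eventually_at_right_less[of "0::real"] show ?thesis
        proof eventually_elim
          case (elim t)
          then have "\<not> \<bar>X t \<bullet> b\<bar> \<le> t"
            using abs_le_square_iff[of "X t \<bullet> b" t] by (auto simp: power2_eq_square)
          then show ?case using b unfolding good_def X_def by blast
        qed
      qed
    qed
    with J(2) show False by (simp add: frequently_def)
  qed
  have "((\<lambda>t. X t \<bullet> b) \<longlongrightarrow> 0) (at_right 0)" if "b \<in> Basis" for b
    by (rule tendsto_rabs_zero_cancel, rule tendsto_sandwich[of "\<lambda>_. 0" _ _ "\<lambda>t. t"])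
      (use small[OF that] in \<open>auto intro: tendsto_eq_intros\<close>)
  then have "((\<lambda>t. \<Sum>b\<in>Basis. (X t \<bullet> b) *\<^sub>R b) \<longlongrightarrow> (\<Sum>b\<in>Basis. 0 *\<^sub>R b)) (at_right 0)"
    by (intro tendsto_intros)
  then have "(X \<longlongrightarrow> 0) (at_right 0)" by (simp add: euclidean_representation)
  then show ?thesis using that[OF H(1,3) gpos] by blast
qed

section \<open>Curves of small slope\<close>

context hardy_field
begin

text \<open>Otherwise the derivative is eventually nonpositive, and \<open>y\<close> stays above one
  of its positive values as \<open>t\<close> decreases to 0.\<close>

lemma deriv_pos_if_tendsto_0:
  assumes y': "y' \<in> H" and deriv: "\<forall>\<^sub>F t in at_right 0. (y has_real_derivative y' t) (at t)"
    and pos: "\<forall>\<^sub>F t in at_right 0. y t > 0" and lim: "(y \<longlongrightarrow> 0) (at_right 0)"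
  shows "\<forall>\<^sub>F t in at_right 0. y' t > 0"
proof (rule ccontr)
  assume "\<not> ?thesis"
  then have "\<forall>\<^sub>F t in at_right 0. - y' t \<ge> 0"
    using eventually_trichotomy(2)[OF sign[OF minus[OF y']]] by simp
  with deriv pos have "\<forall>\<^sub>F t in at_right 0. (y has_real_derivative y' t) (at t) \<and> y' t \<le> 0 \<and> y t > 0"
    by eventually_elim simp
  then obtain \<delta> where \<delta>: "\<delta> > 0" "\<And>t. 0 < t \<Longrightarrow> t < \<delta> \<Longrightarrow> (y has_real_derivative y' t) (at t)"
    "\<And>t. 0 < t \<Longrightarrow> t < \<delta> \<Longrightarrow> y' t \<le> 0" "\<And>t. 0 < t \<Longrightarrow> t < \<delta> \<Longrightarrow> y t > 0"
    unfolding eventually_at_right_field by blast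
  have "y t \<ge> y (\<delta> / 2)" if "0 < t" "t < \<delta> / 2" for t
    by (rule DERIV_nonpos_imp_nonincreasing[of t "\<delta> / 2" y]) (use that \<delta>(2,3) in force)+
  then have "\<forall>\<^sub>F t in at_right 0. y (\<delta> / 2) \<le> y t"
    unfolding eventually_at_right_field using \<delta>(1) by (intro exI[of _ "\<delta> / 2"]) simp
  from tendsto_lowerbound[OF lim this] have "y (\<delta> / 2) \<le> 0" by simp
  with \<delta>(4)[of "\<delta> / 2"] \<delta>(1) show False by simp
qed

text \<open>Bounded germs vary more slowly than \<open>ln \<sigma>\<close>, which tends to minus infinity: all derivatives
  have constant sign, so a lower bound on the sum of their moduli could be integrated.\<close>
lemma frequently_slow_variation:
  fixes y y' :: "'k \<Rightarrow> real \<Rightarrow> real"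
  assumes "finite K" and y': "\<And>k. k \<in> K \<Longrightarrow> y' k \<in> H"
    and deriv: "\<And>k. k \<in> K \<Longrightarrow> \<forall>\<^sub>F t in at_right 0. (y k has_real_derivative y' k t) (at t)"
    and bounded: "\<And>k. k \<in> K \<Longrightarrow> \<forall>\<^sub>F t in at_right 0. \<bar>y k t\<bar> \<le> 1"
    and \<sigma>: "\<forall>\<^sub>F t in at_right 0. \<sigma> t > 0" "(\<sigma> \<longlongrightarrow> 0) (at_right 0)"
      "\<forall>\<^sub>F t in at_right 0. (\<sigma> has_real_derivative \<sigma>' t) (at t)"
    and c: "c > 0"
  shows "\<exists>\<^sub>F t in at_right 0. (\<Sum>k\<in>K. \<bar>y' k t\<bar>) \<le> c * (\<sigma>' t / \<sigma> t)"
proof (rule ccontr)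
  assume "\<not> ?thesis"
  then have fast: "\<forall>\<^sub>F t in at_right 0. c * (\<sigma>' t / \<sigma> t) < (\<Sum>k\<in>K. \<bar>y' k t\<bar>)"
    by (simp add: not_frequently not_le)
  \<comment> \<open>Fixing the eventual sign of each derivative makes the sum of the moduli the
    derivative of a single function.\<close>
  have "\<exists>s::real. \<bar>s\<bar> = 1 \<and> (\<forall>\<^sub>F t in at_right 0. \<bar>y' k t\<bar> = s * y' k t)" if k: "k \<in> K" for k
  proof -
    consider "\<forall>\<^sub>F t in at_right 0. y' k t \<ge> 0" | "\<forall>\<^sub>F t in at_right 0. y' k t < 0"
      using eventually_trichotomy(2)[OF sign[OF y'[OF k]]] by blast
    then show ?thesis
    proof cases
      case 1
      then have "\<forall>\<^sub>F t in at_right 0. \<bar>y' k t\<bar> = 1 * y' k t" by eventually_elim simp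
      then show ?thesis by (intro exI[of _ 1]) simp
    next
      case 2
      then have "\<forall>\<^sub>F t in at_right 0. \<bar>y' k t\<bar> = - 1 * y' k t" by eventually_elim simp
      then show ?thesis by (intro exI[of _ "-1"]) simp
    qed
  qed
  then obtain s :: "'k \<Rightarrow> real" where s: "\<And>k. k \<in> K \<Longrightarrow> \<bar>s k\<bar> = 1"
    "\<And>k. k \<in> K \<Longrightarrow> \<forall>\<^sub>F t in at_right 0. \<bar>y' k t\<bar> = s k * y' k t"
    using bchoice[of K "\<lambda>k s. \<bar>s\<bar> = 1 \<and> (\<forall>\<^sub>F t in at_right 0. \<bar>y' k t\<bar> = s * y' k t)"] by blast
  have "\<forall>\<^sub>F t in at_right 0. \<forall>k\<in>K. (y k has_real_derivative y' k t) (at t) \<and> \<bar>y k t\<bar> \<le> 1 \<and>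
      \<bar>y' k t\<bar> = s k * y' k t"
    by (intro eventually_ball_finite ballI eventually_conj deriv bounded s \<open>finite K\<close>)
  with fast \<sigma>(1,3) have "\<forall>\<^sub>F t in at_right 0. c * (\<sigma>' t / \<sigma> t) < (\<Sum>k\<in>K. \<bar>y' k t\<bar>) \<and> \<sigma> t > 0 \<and>
      (\<sigma> has_real_derivative \<sigma>' t) (at t) \<and>
      (\<forall>k\<in>K. (y k has_real_derivative y' k t) (at t) \<and> \<bar>y k t\<bar> \<le> 1 \<and> \<bar>y' k t\<bar> = s k * y' k t)"
    by eventually_elim blast
  then obtain \<delta> where \<delta>: "\<delta> > 0" "\<And>t. 0 < t \<Longrightarrow> t < \<delta> \<Longrightarrow> c * (\<sigma>' t / \<sigma> t) < (\<Sum>k\<in>K. \<bar>y' k t\<bar>) \<and> \<sigma> t > 0 \<and>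
      (\<sigma> has_real_derivative \<sigma>' t) (at t) \<and>
      (\<forall>k\<in>K. (y k has_real_derivative y' k t) (at t) \<and> \<bar>y k t\<bar> \<le> 1 \<and> \<bar>y' k t\<bar> = s k * y' k t)"
    unfolding eventually_at_right_field by blast
  \<comment> \<open>\<open>W\<close> is nondecreasing and its sum is bounded by
    \<open>card K\<close>, so \<open>- c * ln (\<sigma> t)\<close> stays bounded above as
    \<open>t\<close> decreases to 0; this keeps \<sigma> away from 0.\<close>
  define W where "W t = (\<Sum>k\<in>K. s k * y k t) - c * ln (\<sigma> t)" for t
  have W: "\<exists>D. (W has_real_derivative D) (at t) \<and> D \<ge> 0" if t: "0 < t" "t < \<delta>" for t
  proof (intro exI conjI)
    show "(W has_real_derivative (\<Sum>k\<in>K. s k * y' k t) - c * (1 / \<sigma> t * \<sigma>' t)) (at t)"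
      unfolding W_def using \<delta>(2)[OF t]
      by (intro DERIV_diff DERIV_sum DERIV_cmult DERIV_chain2[OF DERIV_ln_divide]) auto
    have "c * (1 / \<sigma> t * \<sigma>' t) = c * (\<sigma>' t / \<sigma> t)" by simp
    also have "\<dots> < (\<Sum>k\<in>K. \<bar>y' k t\<bar>)" using \<delta>(2)[OF t] by blast
    also have "\<dots> = (\<Sum>k\<in>K. s k * y' k t)" using \<delta>(2)[OF t] by (intro sum.cong) auto
    finally show "0 \<le> (\<Sum>k\<in>K. s k * y' k t) - c * (1 / \<sigma> t * \<sigma>' t)" by linarith
  qed
  define B where "B = (W (\<delta> / 2) + real (card K)) / c"
  have lower: "\<sigma> t \<ge> exp (- B)" if t: "0 < t" "t < \<delta> / 2" for t
  proof -
    have "W t \<le> W (\<delta> / 2)"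
      by (rule DERIV_nonneg_imp_nondecreasing) (use t W in auto)
    moreover have "\<bar>\<Sum>k\<in>K. s k * y k t\<bar> \<le> (\<Sum>k\<in>K. 1)"
    proof (rule order.trans[OF sum_abs sum_mono])
      fix k assume "k \<in> K"
      then show "\<bar>s k * y k t\<bar> \<le> 1" using \<delta>(2)[of t] t s(1) by (simp add: abs_mult)
    qed
    ultimately have "- c * ln (\<sigma> t) \<le> W (\<delta> / 2) + real (card K)"
      unfolding W_def[of t] by simp
    then have "- B \<le> ln (\<sigma> t)" using c by (simp add: B_def field_simps)
    then show ?thesis using \<delta>(2)[of t] t by (simp add: ln_ge_iff)
  qed
  then have "\<forall>\<^sub>F t in at_right 0. exp (- B) \<le> \<sigma> t"
    unfolding eventually_at_right_field using \<delta>(1) by (intro exI[of _ "\<delta> / 2"]) simp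
  from tendsto_lowerbound[OF \<sigma>(2) this] have "exp (- B) \<le> 0" by simp
  then show False by (simp add: not_le)
qed

lemma eventually_dominant:
  assumes "finite A" "A \<noteq> {}" "\<And>b. b \<in> A \<Longrightarrow> F b \<in> H"
  shows "\<exists>m\<in>A. \<forall>\<^sub>F t in at_right 0. \<forall>b\<in>A. \<bar>F b t\<bar> \<le> \<bar>F m t\<bar>"
  using assms
proof (induction A rule: finite_ne_induct)
  case (singleton b)
  then show ?case by simp
next
  case (insert b A)
  then obtain m where m: "m \<in> A" "\<forall>\<^sub>F t in at_right 0. \<forall>b\<in>A. \<bar>F b t\<bar> \<le> \<bar>F m t\<bar>" by auto
  have "(\<lambda>t. F m t ^ 2 - F b t ^ 2) \<in> H" using insert.prems m(1) by (intro diff power) auto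
  then consider "\<forall>\<^sub>F t in at_right 0. F m t ^ 2 - F b t ^ 2 \<ge> 0" | "\<forall>\<^sub>F t in at_right 0. F m t ^ 2 - F b t ^ 2 < 0"
    using eventually_trichotomy(2)[OF sign] by blast
  then show ?case
  proof cases
    case 1
    with m(2) have "\<forall>\<^sub>F t in at_right 0. \<forall>b\<in>insert b A. \<bar>F b t\<bar> \<le> \<bar>F m t\<bar>"
      by eventually_elim (auto simp: abs_le_square_iff)
    with m(1) show ?thesis by blast
  next
    case 2
    with m(2) have "\<forall>\<^sub>F t in at_right 0. \<forall>b'\<in>insert b A. \<bar>F b' t\<bar> \<le> \<bar>F b t\<bar>"
    proof eventually_elim
      case (elim t)
      then have "\<bar>F m t\<bar> \<le> \<bar>F b t\<bar>" by (simp add: abs_le_square_iff)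
      with elim(1) show ?case by (auto intro: order.trans)
    qed
    then show ?thesis by blast
  qed
qed

end

text \<open>Here \<tau> is the logarithmic derivative of the size \<sigma>, \<open>L\<close> the
  radial derivative of the function and \<open>S\<close> its derivative along the velocity of the
  direction. Slow variation of \<open>v / u\<close> makes the total derivative nearly
  \<open>(u' / u) * F\<close>, so \<open>L / F\<close> is close to the real number \<open>q\<close>.
  As the real part of \<open>L / F\<close> is at most 1/16, the distance is at most 3/40 and
  \<open>q\<close> at most 11/80, whereas \<open>growth\<close> gives
  \<open>q > 1/2\<close>.\<close>

lemma logarithmic_derivative_contradiction:
  fixes L S :: complex and u v u' v' \<sigma> \<tau> :: real
  assumes u: "u \<noteq> 0" and \<tau>: "\<tau> > 0"
    and F': "Complex u' v' = of_real \<tau> * L + of_real \<sigma> * S"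
    and S: "norm (of_real \<sigma> * S) \<le> \<tau> / 16 * ((norm (L / Complex u v) + 1 / 16) * norm (Complex u v))"
    and L: "\<bar>Re (L / Complex u v)\<bar> \<le> 1 / 16"
    and y': "\<bar>(v' * u - v * u') / (u * u)\<bar> \<le> \<tau> / 16"
    and growth: "2 * (u' / u) > \<tau>"
  shows False
proof -
  define F where "F = Complex u v"
  define l where "l = L / F"
  define q where "q = u' / u / \<tau>"
  have F0: "F \<noteq> 0" using u by (simp add: F_def complex_eq_iff)
  have uF: "\<bar>u\<bar> \<le> norm F" using abs_Re_le_cmod[of F] by (simp add: F_def)
  \<comment> \<open>The derivative has a part along \<open>F\<close> with rate \<open>u' / u\<close>
    and a part due to the change of the quotient \<open>v / u\<close>.\<close>
  have split: "Complex u' v' = of_real (u' / u) * F + \<i> * of_real (u * ((v' * u - v * u') / (u * u)))"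
    using u by (simp add: F_def complex_eq_iff field_simps)
  have q: "of_real (u' / u) = of_real \<tau> * (of_real q :: complex)"
    using \<tau> u by (simp add: q_def)
  have "of_real \<tau> * (l - of_real q) * F =
      \<i> * of_real (u * ((v' * u - v * u') / (u * u))) - of_real \<sigma> * S"
    using F' F0 unfolding split q by (simp add: l_def algebra_simps)
  then have "norm (of_real \<tau> * (l - of_real q) * F) \<le>
      norm (\<i> * of_real (u * ((v' * u - v * u') / (u * u))) :: complex) + norm (of_real \<sigma> * S)"
    by (simp only: norm_triangle_ineq4)
  also have "\<dots> \<le> \<tau> / 16 * norm F + \<tau> / 16 * ((norm l + 1 / 16) * norm F)"
  proof (rule add_mono)
    have "norm (\<i> * of_real (u * ((v' * u - v * u') / (u * u))) :: complex) =
        \<bar>(v' * u - v * u') / (u * u)\<bar> * \<bar>u\<bar>"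
      by (simp only: norm_mult norm_ii norm_of_real abs_mult mult_1 mult.commute)
    also have "\<dots> \<le> \<tau> / 16 * norm F" using y' uF \<tau> by (intro mult_mono) auto
    finally show "norm (\<i> * of_real (u * ((v' * u - v * u') / (u * u))) :: complex) \<le> \<tau> / 16 * norm F" .
    show "norm (of_real \<sigma> * S) \<le> \<tau> / 16 * ((norm l + 1 / 16) * norm F)"
      using S by (simp add: l_def F_def)
  qed
  also have "\<dots> = (\<tau> * norm F) * (1 / 16 + (norm l + 1 / 16) / 16)" by (simp add: field_simps)
  finally have "(\<tau> * norm F) * norm (l - of_real q) \<le> (\<tau> * norm F) * (1 / 16 + (norm l + 1 / 16) / 16)"
    using \<tau> by (simp add: norm_mult mult_ac)
  then have e: "norm (l - of_real q) \<le> 1 / 16 + (norm l + 1 / 16) / 16"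
    using \<tau> F0 by (simp add: mult_le_cancel_left)
  define n where "n = norm l"
  define r where "r = norm (l - of_real q)"
  have l: "\<bar>Re l\<bar> \<le> 1 / 16" using L by (simp add: l_def F_def)
  \<comment> \<open>The estimates of \<open>n\<close> and \<open>r\<close> refer to each other; the
    factor 1/16 in front of \<open>n\<close> is what lets them be solved.\<close>
  have "n \<le> \<bar>Re l\<bar> + \<bar>Im l\<bar>" unfolding n_def by (rule cmod_le)
  moreover have "\<bar>Im l\<bar> \<le> r" using abs_Im_le_cmod[of "l - of_real q"] by (simp add: r_def)
  ultimately have "n \<le> 1 / 16 + r" using l by simp
  moreover have "r \<le> 1 / 16 + (n + 1 / 16) / 16" using e by (simp add: n_def r_def)
  moreover have "\<bar>Re l - q\<bar> \<le> r" using abs_Re_le_cmod[of "l - of_real q"] by (simp add: r_def)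
  then have "q \<le> 1 / 16 + r" using l by linarith
  moreover have "q > 1 / 2" using growth \<tau> unfolding q_def by (subst pos_less_divide_eq) linarith+
  ultimately show False by (simp add: field_simps)
qed

lemma eventually_norm_le_linear:
  fixes f :: "'a::real_normed_vector \<Rightarrow> 'b::real_normed_vector"
  assumes "(f has_derivative f') (at 0)" "f 0 = 0"
  shows "\<exists>C. \<forall>\<^sub>F z in nhds 0. norm (f z) \<le> C * norm z"
proof -
  have "bounded_linear f'" using assms(1) by (rule has_derivative_bounded_linear)
  then obtain K where K: "\<And>v. norm (f' v) \<le> norm v * K" using bounded_linear.bounded by blast
  obtain \<delta> where \<delta>: "\<delta> > 0" "\<And>y. norm (y - 0) < \<delta> \<Longrightarrow> norm (f y - f 0 - f' (y - 0)) \<le> 1 * norm (y - 0)"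
    using assms(1) unfolding has_derivative_at_alt by (meson zero_less_one)
  have "norm (f z) \<le> (K + 1) * norm z" if "norm z < \<delta>" for z
  proof -
    have "norm (f z) \<le> norm (f z - f' z) + norm (f' z)"
      using norm_triangle_ineq[of "f z - f' z" "f' z"] by simp
    also have "\<dots> \<le> norm z + norm z * K" using \<delta>(2)[of z] that assms(2) K[of z] by simp
    finally show ?thesis by (simp add: algebra_simps)
  qed
  then show ?thesis
    using \<delta>(1) by (intro exI[of _ "K + 1"]) (auto simp: eventually_nhds_metric dist_norm)
qed

text \<open>The size \<sigma> of \<open>X\<close> is the largest modulus of a coordinate: it is a
  coordinate up to sign and so lies in \<open>H\<close> without taking roots. With \<tau> the
  logarithmic derivative of \<sigma>, the velocity is \<tau> X + \<sigma> E, where E is the velocity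
  of the direction X / \<sigma>. At arbitrarily small \<open>t\<close>, E and the derivative of Im f
  / Re f are small compared with \<tau>; \<open>slope\<close> and the growth of \<open>f\<close>
  exclude this for all small \<open>t\<close>.\<close>

lemma (in hardy_field) no_curve_of_small_slope:
  fixes f :: "complex ^ 'n \<Rightarrow> complex" and d :: "'n::finite \<Rightarrow> complex ^ 'n \<Rightarrow> complex"
  defines "L z \<equiv> \<Sum>i\<in>UNIV. d i z * z $ i"
  assumes X: "\<And>b. b \<in> Basis \<Longrightarrow> (\<lambda>t. X t \<bullet> b) \<in> H" "(X \<longlongrightarrow> 0) (at_right 0)"
    and f0: "f 0 = 0"
    and df: "\<And>z. (f has_derivative (\<lambda>v. \<Sum>i\<in>UNIV. d i z * v $ i)) (at z)"
    and fX: "(\<lambda>t. Re (f (X t))) \<in> H" "(\<lambda>t. Im (f (X t))) \<in> H"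
    and slope: "\<forall>\<^sub>F t in at_right 0. f (X t) \<noteq> 0 \<and> \<bar>Re (L (X t) / f (X t))\<bar> \<le> 1 / 16 \<and>
      (\<forall>i. norm (X t) * norm (d i (X t)) \<le> (norm (L (X t) / f (X t)) + 1 / 16) * norm (f (X t)))"
    and dom: "\<forall>\<^sub>F t in at_right 0. \<bar>Im (f (X t))\<bar> \<le> \<bar>Re (f (X t))\<bar>"
  shows False
proof -
  have "\<exists>m\<in>Basis. \<forall>\<^sub>F t in at_right 0. \<forall>b\<in>Basis. \<bar>X t \<bullet> b\<bar> \<le> \<bar>X t \<bullet> m\<bar>"
    by (rule eventually_dominant) (auto intro: X)
  then obtain m where m: "m \<in> Basis" "\<forall>\<^sub>F t in at_right 0. \<forall>b\<in>Basis. \<bar>X t \<bullet> b\<bar> \<le> \<bar>X t \<bullet> m\<bar>"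
    by blast
  have "\<forall>\<^sub>F t in at_right 0. X t \<bullet> m \<noteq> 0"
    using slope m(2)
  proof eventually_elim
    case (elim t)
    show ?case
    proof
      assume "X t \<bullet> m = 0"
      with elim(2) have "X t = 0" by (simp add: euclidean_all_zero_iff)
      with elim(1) f0 show False by simp
    qed
  qed
  note ne = this
  have "\<exists>e::real. \<forall>\<^sub>F t in at_right 0. e * (X t \<bullet> m) = \<bar>X t \<bullet> m\<bar>"
  proof -
    consider "\<forall>\<^sub>F t in at_right 0. X t \<bullet> m \<ge> 0" | "\<forall>\<^sub>F t in at_right 0. X t \<bullet> m < 0"
      using eventually_trichotomy(2)[OF sign[OF X(1)[OF m(1)]]] by blast
    then show ?thesis
    proof cases
      case 1
      then have "\<forall>\<^sub>F t in at_right 0. 1 * (X t \<bullet> m) = \<bar>X t \<bullet> m\<bar>" by eventually_elim simp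
      then show ?thesis ..
    next
      case 2
      then have "\<forall>\<^sub>F t in at_right 0. - 1 * (X t \<bullet> m) = \<bar>X t \<bullet> m\<bar>" by eventually_elim simp
      then show ?thesis ..
    qed
  qed
  then obtain e :: real where e: "\<forall>\<^sub>F t in at_right 0. e * (X t \<bullet> m) = \<bar>X t \<bullet> m\<bar>" ..
  define \<sigma> where "\<sigma> t = e * (X t \<bullet> m)" for t
  have \<sigma>H: "\<sigma> \<in> H" unfolding \<sigma>_def by (intro mult const X m)
  have \<sigma>_pos: "\<forall>\<^sub>F t in at_right 0. \<sigma> t > 0"
    using e ne by eventually_elim (simp add: \<sigma>_def)
  have "(\<sigma> \<longlongrightarrow> e * (0 \<bullet> m)) (at_right 0)" unfolding \<sigma>_def by (intro tendsto_intros X)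
  then have \<sigma>_lim: "(\<sigma> \<longlongrightarrow> 0) (at_right 0)" by simp
  have coord: "\<forall>\<^sub>F t in at_right 0. \<forall>b\<in>Basis. \<bar>X t \<bullet> b\<bar> \<le> \<sigma> t"
    using m(2) e by eventually_elim (simp add: \<sigma>_def)
  have \<sigma>_norm: "\<forall>\<^sub>F t in at_right 0. \<sigma> t \<le> norm (X t)"
    using e by eventually_elim (simp add: \<sigma>_def Basis_le_norm m)
  obtain \<sigma>' where \<sigma>': "\<sigma>' \<in> H" "\<forall>\<^sub>F t in at_right 0. (\<sigma> has_real_derivative \<sigma>' t) (at t)"
    using deriv[OF \<sigma>H] by blast
  have \<sigma>'_pos: "\<forall>\<^sub>F t in at_right 0. \<sigma>' t > 0"
    by (rule deriv_pos_if_tendsto_0[OF \<sigma>' \<sigma>_pos \<sigma>_lim])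
  obtain w where w: "\<And>b. b \<in> Basis \<Longrightarrow> w b \<in> H"
    "\<And>b. b \<in> Basis \<Longrightarrow> \<forall>\<^sub>F t in at_right 0. ((\<lambda>t. X t \<bullet> b) has_real_derivative w b t) (at t)"
    using bchoice[of Basis "\<lambda>b w. w \<in> H \<and> (\<forall>\<^sub>F t in at_right 0. ((\<lambda>t. X t \<bullet> b) has_real_derivative w t) (at t))"]
      deriv[OF X(1)] by blast
  have w_all: "\<forall>\<^sub>F t in at_right 0. \<forall>b\<in>Basis. ((\<lambda>t. X t \<bullet> b) has_real_derivative w b t) (at t)"
    by (intro eventually_ball_finite ballI w) auto
  define U where "U t = Re (f (X t))" for t
  define V where "V t = Im (f (X t))" for t
  have UV: "U \<in> H" "V \<in> H" using fX unfolding U_def V_def by auto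
  obtain U' V' where UV': "U' \<in> H" "V' \<in> H"
    "\<forall>\<^sub>F t in at_right 0. (U has_real_derivative U' t) (at t)"
    "\<forall>\<^sub>F t in at_right 0. (V has_real_derivative V' t) (at t)"
    using deriv[OF UV(1)] deriv[OF UV(2)] by blast
  have U0: "\<forall>\<^sub>F t in at_right 0. U t \<noteq> 0"
    using slope dom by eventually_elim (auto simp: U_def complex_eq_iff)
  have growth: "\<forall>\<^sub>F t in at_right 0. 2 * (U' t / U t) > \<sigma>' t / \<sigma> t"
  proof -
    \<comment> \<open>Differentiability at 0 gives U = O(\<sigma>), so U^2 / \<sigma> is positive
      and tends to 0. Positivity of its logarithmic derivative is the claim.\<close>
    let ?y = "\<lambda>t. U t * U t / \<sigma> t"
    let ?y' = "\<lambda>t. ((U' t * U t + U' t * U t) * \<sigma> t - (U t * U t) * \<sigma>' t) / (\<sigma> t * \<sigma> t)"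
    have "\<forall>\<^sub>F t in at_right 0. ?y' t > 0"
    proof (rule deriv_pos_if_tendsto_0)
      show "?y' \<in> H" by (intro divide diff mult add UV UV' \<sigma>' \<sigma>H)
      show "\<forall>\<^sub>F t in at_right 0. (?y has_real_derivative ?y' t) (at t)"
        using UV'(3) \<sigma>'(2) \<sigma>_pos by eventually_elim (intro DERIV_divide DERIV_mult, auto)
      show "\<forall>\<^sub>F t in at_right 0. ?y t > 0"
        using U0 \<sigma>_pos by eventually_elim (simp add: zero_less_mult_iff linorder_neq_iff disj_commute)
      obtain C where C: "\<forall>\<^sub>F z in nhds 0. norm (f z) \<le> C * norm z"
        using eventually_norm_le_linear[OF df f0] by blast
      have "\<forall>\<^sub>F t in at_right 0. norm (f (X t)) \<le> C * norm (X t)"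
        using X(2) C by (rule filterlim_iff[THEN iffD1, rule_format])
      then have "\<forall>\<^sub>F t in at_right 0. ?y t \<le> (\<bar>C\<bar> * real DIM(complex ^ 'n))\<^sup>2 * \<sigma> t"
        using coord \<sigma>_pos
      proof eventually_elim
        case (elim t)
        have "norm (X t) \<le> (\<Sum>b\<in>Basis. \<bar>X t \<bullet> b\<bar>)" by (rule norm_le_l1)
        also have "\<dots> \<le> (\<Sum>b\<in>(Basis::(complex ^ 'n) set). \<sigma> t)" using elim(2) by (intro sum_mono) auto
        finally have n: "norm (X t) \<le> real DIM(complex ^ 'n) * \<sigma> t" by simp
        have "\<bar>U t\<bar> \<le> norm (f (X t))" unfolding U_def by (rule abs_Re_le_cmod)
        also have "\<dots> \<le> \<bar>C\<bar> * norm (X t)" using elim(1) by (meson abs_ge_self mult_right_mono norm_ge_zero order.trans)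
        also have "\<dots> \<le> \<bar>C\<bar> * (real DIM(complex ^ 'n) * \<sigma> t)" using n by (intro mult_left_mono) auto
        finally have "\<bar>U t\<bar> \<le> \<bar>\<bar>C\<bar> * real DIM(complex ^ 'n) * \<sigma> t\<bar>" using elim(3) by (simp add: abs_mult mult_ac)
        then have "(U t)\<^sup>2 \<le> (\<bar>C\<bar> * real DIM(complex ^ 'n) * \<sigma> t)\<^sup>2" by (simp add: abs_le_square_iff)
        then show ?case using elim(3) by (simp add: pos_divide_le_eq power2_eq_square mult_ac)
      qed
      note upper = this
      have lower: "\<forall>\<^sub>F t in at_right 0. 0 \<le> ?y t" using \<sigma>_pos by eventually_elim simp
      have "((\<lambda>t. (\<bar>C\<bar> * real DIM(complex ^ 'n))\<^sup>2 * \<sigma> t) \<longlongrightarrow> 0) (at_right 0)"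
        using tendsto_mult_right_zero[OF \<sigma>_lim] .
      with lower upper show "(?y \<longlongrightarrow> 0) (at_right 0)"
        by (rule tendsto_sandwich[OF _ _ tendsto_const])
    qed
    then show ?thesis
      using U0 \<sigma>_pos
    proof eventually_elim
      case (elim t)
      have eq: "2 * (U' t / U t) - \<sigma>' t / \<sigma> t =
          ((U' t * U t + U' t * U t) * \<sigma> t - (U t * U t) * \<sigma>' t) / (\<sigma> t * \<sigma> t) * (\<sigma> t / (U t * U t))"
        using elim(2,3) by (simp add: field_simps)
      have sq: "U t * U t > 0" using elim(2) by (simp add: zero_less_mult_iff linorder_neq_iff disj_commute)
      have "2 * (U' t / U t) - \<sigma>' t / \<sigma> t > 0"
        unfolding eq by (rule mult_pos_pos[OF elim(1) divide_pos_pos[OF elim(3) sq]])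
      then show ?case by simp
    qed
  qed
  \<comment> \<open>The index 0 is not a basis vector and is used for \<open>V / U\<close>; the
    other indices give the coordinates of the direction. All these functions are bounded by
    1.\<close>
  define y where "y b t = (if b = 0 then V t / U t else (X t \<bullet> b) / \<sigma> t)" for b t
  define y' where "y' b t = (if b = 0 then (V' t * U t - V t * U' t) / (U t * U t)
    else (w b t * \<sigma> t - (X t \<bullet> b) * \<sigma>' t) / (\<sigma> t * \<sigma> t))" for b t
  let ?K = "insert 0 (Basis :: (complex ^ 'n) set)"
  \<comment> \<open>The factor \<open>real CARD('n)\<close> compensates the later sum over the
    partial derivatives, one for each coordinate.\<close>
  have "\<exists>\<^sub>F t in at_right 0. (\<Sum>b\<in>?K. \<bar>y' b t\<bar>) \<le> 1 / (16 * real CARD('n)) * (\<sigma>' t / \<sigma> t)"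
  proof (rule frequently_slow_variation[where y = y])
    fix b assume b: "b \<in> ?K"
    show "y' b \<in> H"
    proof (cases "b = 0")
      case True
      then show ?thesis unfolding y'_def by (simp, intro divide diff mult UV UV')
    next
      case False
      then show ?thesis using b unfolding y'_def by (simp, intro divide diff mult w X \<sigma>' \<sigma>H) auto
    qed
    show "\<forall>\<^sub>F t in at_right 0. (y b has_real_derivative y' b t) (at t)"
    proof (cases "b = 0")
      case True
      from UV'(4,3) U0 have "\<forall>\<^sub>F t in at_right 0. ((\<lambda>t. V t / U t) has_real_derivative
          (V' t * U t - V t * U' t) / (U t * U t)) (at t)"
        by eventually_elim (rule DERIV_divide)
      then show ?thesis using True by (simp add: y_def[abs_def] y'_def)
    next
      case False
      with b have "b \<in> Basis" by simp
      from w(2)[OF this] \<sigma>'(2) \<sigma>_pos have "\<forall>\<^sub>F t in at_right 0. ((\<lambda>t. (X t \<bullet> b) / \<sigma> t)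
          has_real_derivative (w b t * \<sigma> t - (X t \<bullet> b) * \<sigma>' t) / (\<sigma> t * \<sigma> t)) (at t)"
        by eventually_elim (rule DERIV_divide, auto)
      then show ?thesis using False by (simp add: y_def[abs_def] y'_def)
    qed
    show "\<forall>\<^sub>F t in at_right 0. \<bar>y b t\<bar> \<le> 1"
      using dom U0 coord \<sigma>_pos
      by eventually_elim (use b in \<open>auto simp: y_def U_def V_def pos_divide_le_eq\<close>)
  qed (use \<sigma>_pos \<sigma>_lim \<sigma>'(2) in auto)
  moreover have "\<forall>\<^sub>F t in at_right 0. \<not> (\<Sum>b\<in>?K. \<bar>y' b t\<bar>) \<le> 1 / (16 * real CARD('n)) * (\<sigma>' t / \<sigma> t)"
    using slope U0 growth \<sigma>_pos \<sigma>'_pos \<sigma>_norm w_all UV'(3,4)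
  proof eventually_elim
    case (elim t)
    show ?case
    proof
      assume slow: "(\<Sum>b\<in>?K. \<bar>y' b t\<bar>) \<le> 1 / (16 * real CARD('n)) * (\<sigma>' t / \<sigma> t)"
      define \<tau> where "\<tau> = \<sigma>' t / \<sigma> t"
      have \<tau>: "\<tau> > 0" using elim by (simp add: \<tau>_def)
      \<comment> \<open>\<open>E\<close> is the velocity of the direction
        \<open>X t / \<sigma> t\<close>, and \<open>D\<close> is the bound that \<open>slope\<close>
        gives for each partial derivative times the norm.\<close>
      define E where "E = (\<Sum>b\<in>Basis. y' b t *\<^sub>R b)"
      define D where "D = (norm (L (X t) / f (X t)) + 1 / 16) * norm (f (X t))"
      have K: "(\<Sum>b\<in>?K. \<bar>y' b t\<bar>) = \<bar>y' 0 t\<bar> + (\<Sum>b\<in>Basis. \<bar>y' b t\<bar>)"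
        by (rule sum.insert) auto
      have w_eq: "w b t = \<tau> * (X t \<bullet> b) + \<sigma> t * y' b t" if "b \<in> Basis" for b
        using that elim(4) by (auto simp: y'_def \<tau>_def field_simps)
      have "(\<Sum>b\<in>Basis. w b t *\<^sub>R b) = (\<Sum>b\<in>Basis. \<tau> *\<^sub>R ((X t \<bullet> b) *\<^sub>R b) + \<sigma> t *\<^sub>R (y' b t *\<^sub>R b))"
        by (intro sum.cong refl) (simp add: w_eq scaleR_add_left)
      then have X': "(\<Sum>b\<in>Basis. w b t *\<^sub>R b) = \<tau> *\<^sub>R X t + \<sigma> t *\<^sub>R E"
        by (simp only: sum.distrib scaleR_sum_right[symmetric] euclidean_representation E_def)
      have "((\<lambda>t. (X t \<bullet> b) *\<^sub>R b) has_vector_derivative w b t *\<^sub>R b) (at t)" if b: "b \<in> Basis" for b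
        using has_vector_derivative_scaleR[OF elim(7)[rule_format, OF b] has_vector_derivative_const[of b]]
        by simp
      then have "((\<lambda>t. \<Sum>b\<in>Basis. (X t \<bullet> b) *\<^sub>R b) has_vector_derivative (\<Sum>b\<in>Basis. w b t *\<^sub>R b)) (at t)"
        by (rule has_vector_derivative_sum)
      then have "(X has_vector_derivative \<tau> *\<^sub>R X t + \<sigma> t *\<^sub>R E) (at t)"
        by (simp add: euclidean_representation X')
      then have "((f \<circ> X) has_vector_derivative
          (\<Sum>i\<in>UNIV. d i (X t) * (\<tau> *\<^sub>R X t + \<sigma> t *\<^sub>R E) $ i)) (at t)"
        unfolding has_vector_derivative_def
        by (rule has_derivative_eq_rhs[OF diff_chain_at[OF _ df]])
          (simp add: fun_eq_iff scaleR_sum_right)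
      moreover have "((f \<circ> X) has_vector_derivative Complex (U' t) (V' t)) (at t)"
        using elim(8,9) unfolding has_vector_derivative_complex_iff U_def[abs_def] V_def[abs_def] o_def by simp
      ultimately have "Complex (U' t) (V' t) = (\<Sum>i\<in>UNIV. d i (X t) * (\<tau> *\<^sub>R X t + \<sigma> t *\<^sub>R E) $ i)"
        by (metis vector_derivative_unique_at)
      moreover have comp: "(\<tau> *\<^sub>R X t + \<sigma> t *\<^sub>R E) $ i = of_real \<tau> * X t $ i + of_real (\<sigma> t) * E $ i" for i
        by (simp only: vector_add_component vector_scaleR_component) (simp only: scaleR_conv_of_real)
      ultimately have F': "Complex (U' t) (V' t) = of_real \<tau> * L (X t) + of_real (\<sigma> t) * (\<Sum>i\<in>UNIV. d i (X t) * E $ i)"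
        by (simp only: comp) (simp add: L_def sum.distrib sum_distrib_left distrib_left mult_ac)
      have fC: "f (X t) = Complex (U t) (V t)" by (simp add: U_def V_def)
      have "norm E \<le> (\<Sum>b\<in>Basis. \<bar>y' b t\<bar>)"
        unfolding E_def by (rule order.trans[OF norm_sum]) (simp add: sum_mono)
      then have E: "norm E \<le> 1 / (16 * real CARD('n)) * \<tau>"
        using slow unfolding K \<tau>_def by linarith
      have "norm (of_real (\<sigma> t) * (\<Sum>i\<in>UNIV. d i (X t) * E $ i)) \<le> \<sigma> t * (\<Sum>i\<in>UNIV. norm (d i (X t)) * norm E)"
        unfolding norm_mult using elim(4)
        by (auto intro!: mult_left_mono sum_norm_le simp: norm_mult Finite_Cartesian_Product.norm_nth_le)
      also have "\<dots> = (\<Sum>i\<in>UNIV. (\<sigma> t * norm (d i (X t))) * norm E)"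
        by (simp add: sum_distrib_left mult.assoc)
      also have "\<dots> \<le> (\<Sum>i\<in>(UNIV::'n set). D * (1 / (16 * real CARD('n)) * \<tau>))"
      proof (rule sum_mono)
        fix i
        have "\<sigma> t * norm (d i (X t)) \<le> norm (X t) * norm (d i (X t))"
          using elim(6) by (intro mult_right_mono) auto
        also have "\<dots> \<le> D" using elim(1) by (simp add: D_def)
        finally show "\<sigma> t * norm (d i (X t)) * norm E \<le> D * (1 / (16 * real CARD('n)) * \<tau>)"
          using E elim(4) by (intro mult_mono) (auto simp: D_def)
      qed
      also have "\<dots> = \<tau> / 16 * D" by simp
      finally have S: "norm (of_real (\<sigma> t) * (\<Sum>i\<in>UNIV. d i (X t) * E $ i)) \<le> \<tau> / 16 * D" .
      have "1 / (16 * real CARD('n)) * \<tau> \<le> \<tau> / 16"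
      proof -
        have "1 \<le> real CARD('n)" by (simp add: Suc_le_eq)
        then show ?thesis using \<tau> by (simp add: field_simps)
      qed
      moreover have "0 \<le> (\<Sum>b\<in>(Basis::(complex ^ 'n) set). \<bar>y' b t\<bar>)" by (rule sum_nonneg) simp
      ultimately have "\<bar>y' 0 t\<bar> \<le> \<tau> / 16" using slow unfolding K \<tau>_def[symmetric] by linarith
      then have y0: "\<bar>(V' t * U t - V t * U' t) / (U t * U t)\<bar> \<le> \<tau> / 16" by (simp add: y'_def)
      show False
        using logarithmic_derivative_contradiction[OF elim(2) \<tau> F' _ _ y0] S elim(1,3)
        unfolding D_def fC \<tau>_def by blast
    qed
  qed
  ultimately show False by (simp add: frequently_def)
qed

section \<open>Milnor's lemma\<close>

definition complex_polynomial :: "('a::real_normed_vector \<Rightarrow> complex) \<Rightarrow> bool" where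
  "complex_polynomial p \<longleftrightarrow> real_polynomial_function (\<lambda>z. Re (p z)) \<and> real_polynomial_function (\<lambda>z. Im (p z))"

lemma complex_polynomial_const: "complex_polynomial (\<lambda>z. c)"
  by (simp add: complex_polynomial_def real_polynomial_function.intros(2))

lemma complex_polynomial_add:
  "complex_polynomial p \<Longrightarrow> complex_polynomial q \<Longrightarrow> complex_polynomial (\<lambda>z. p z + q z)"
  by (simp add: complex_polynomial_def real_polynomial_function.intros(3))

lemma complex_polynomial_mult:
  "complex_polynomial p \<Longrightarrow> complex_polynomial q \<Longrightarrow> complex_polynomial (\<lambda>z. p z * q z)"
  unfolding complex_polynomial_def times_complex.sel
  by (intro conjI real_polynomial_function.intros(3,4) real_polynomial_function_diff) simp_all

lemma complex_polynomial_diff: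
  "complex_polynomial p \<Longrightarrow> complex_polynomial q \<Longrightarrow> complex_polynomial (\<lambda>z. p z - q z)"
  by (simp add: complex_polynomial_def real_polynomial_function_diff)

lemma complex_polynomial_sum:
  "finite A \<Longrightarrow> (\<And>i. i \<in> A \<Longrightarrow> complex_polynomial (p i)) \<Longrightarrow> complex_polynomial (\<lambda>z. \<Sum>i\<in>A. p i z)"
  by (induction A rule: finite_induct) (auto intro: complex_polynomial_const complex_polynomial_add)

lemma complex_polynomial_cnj: "complex_polynomial p \<Longrightarrow> complex_polynomial (\<lambda>z. cnj (p z))"
  by (simp add: complex_polynomial_def real_polynomial_function_minus)

lemma complex_polynomial_of_real:
  "real_polynomial_function p \<Longrightarrow> complex_polynomial (\<lambda>z. of_real (p z))"
  by (simp add: complex_polynomial_def real_polynomial_function.intros(2))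

lemma complex_polynomial_nth: "complex_polynomial (\<lambda>z :: complex ^ 'n::finite. z $ i)"
  unfolding complex_polynomial_def
  by (intro conjI real_polynomial_function.intros(1)
      bounded_linear_compose[OF bounded_linear_Re bounded_linear_vec_nth]
      bounded_linear_compose[OF bounded_linear_Im bounded_linear_vec_nth])

lemma real_polynomial_function_cmod_power2:
  "complex_polynomial p \<Longrightarrow> real_polynomial_function (\<lambda>z. (cmod (p z))\<^sup>2)"
  unfolding complex_polynomial_def cmod_power2
  by (intro real_polynomial_function.intros(3) real_polynomial_function_power) simp_all

text \<open>The functions \<open>d i\<close> are the complex partial derivatives. They are required
  to be polynomials because they enter the polynomial condition to which curve selection is
  applied.\<close>

definition holomorphic_polynomial :: "(complex ^ 'n::finite \<Rightarrow> complex) \<Rightarrow> bool" where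
  "holomorphic_polynomial p \<longleftrightarrow> complex_polynomial p \<and>
    (\<exists>d. (\<forall>i. complex_polynomial (d i)) \<and>
      (\<forall>z. (p has_derivative (\<lambda>v. \<Sum>i\<in>UNIV. d i z * v $ i)) (at z)))"

lemma holomorphic_polynomial_const: "holomorphic_polynomial (\<lambda>z. c)"
  unfolding holomorphic_polynomial_def
  by (intro conjI complex_polynomial_const exI[of _ "\<lambda>i z. 0"] allI) simp

lemma holomorphic_polynomial_nth: "holomorphic_polynomial (\<lambda>z :: complex ^ 'n::finite. z $ i)"
  unfolding holomorphic_polynomial_def
proof (intro conjI complex_polynomial_nth exI[of _ "\<lambda>j z. if j = i then 1 else 0"] allI)
  fix z :: "complex ^ 'n"
  have "((\<lambda>z :: complex ^ 'n. z $ i) has_derivative (\<lambda>v. v $ i)) (at z)"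
    by (rule bounded_linear_imp_has_derivative[OF bounded_linear_vec_nth])
  moreover have "(\<Sum>j\<in>UNIV. (if j = i then 1 else 0) * v $ j) = v $ i" for v :: "complex ^ 'n"
    by (simp add: if_distrib[of "\<lambda>c. c * _"] cong: if_cong)
  ultimately show "((\<lambda>z :: complex ^ 'n. z $ i) has_derivative
      (\<lambda>v. \<Sum>j\<in>UNIV. (if j = i then 1 else 0) * v $ j)) (at z)"
    by simp
qed (use complex_polynomial_const in auto)

lemma holomorphic_polynomial_add:
  assumes "holomorphic_polynomial p" "holomorphic_polynomial q"
  shows "holomorphic_polynomial (\<lambda>z. p z + q z)"
proof -
  obtain d d' where d: "\<And>i. complex_polynomial (d i)" "\<And>i. complex_polynomial (d' i)"
    "\<And>z. (p has_derivative (\<lambda>v. \<Sum>i\<in>UNIV. d i z * v $ i)) (at z)"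
    "\<And>z. (q has_derivative (\<lambda>v. \<Sum>i\<in>UNIV. d' i z * v $ i)) (at z)"
    using assms unfolding holomorphic_polynomial_def by blast
  have "((\<lambda>z. p z + q z) has_derivative (\<lambda>v. \<Sum>i\<in>UNIV. (d i z + d' i z) * v $ i)) (at z)" for z
    using has_derivative_add[OF d(3)[of z] d(4)[of z]] by (simp add: distrib_right sum.distrib)
  then show ?thesis
    using assms d(1,2) unfolding holomorphic_polynomial_def
    by (intro conjI complex_polynomial_add exI[of _ "\<lambda>i z. d i z + d' i z"])
      (auto intro: complex_polynomial_add)
qed

lemma holomorphic_polynomial_mult:
  assumes "holomorphic_polynomial p" "holomorphic_polynomial q"
  shows "holomorphic_polynomial (\<lambda>z. p z * q z)"
proof -
  obtain d d' where d: "\<And>i. complex_polynomial (d i)" "\<And>i. complex_polynomial (d' i)"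
    "\<And>z. (p has_derivative (\<lambda>v. \<Sum>i\<in>UNIV. d i z * v $ i)) (at z)"
    "\<And>z. (q has_derivative (\<lambda>v. \<Sum>i\<in>UNIV. d' i z * v $ i)) (at z)"
    using assms unfolding holomorphic_polynomial_def by blast
  have "((\<lambda>z. p z * q z) has_derivative (\<lambda>v. \<Sum>i\<in>UNIV. (p z * d' i z + d i z * q z) * v $ i)) (at z)" for z
    using has_derivative_mult[OF d(3)[of z] d(4)[of z]]
    by (simp add: distrib_right distrib_left sum.distrib sum_distrib_left sum_distrib_right mult_ac)
  moreover have pq: "complex_polynomial p" "complex_polynomial q"
    using assms unfolding holomorphic_polynomial_def by blast+
  then have "complex_polynomial (\<lambda>z. p z * d' i z + d i z * q z)" for i
    by (intro complex_polynomial_add complex_polynomial_mult d)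
  ultimately show ?thesis
    unfolding holomorphic_polynomial_def
    by (intro conjI complex_polynomial_mult pq exI[of _ "\<lambda>i z. p z * d' i z + d i z * q z"]) auto
qed

lemma holomorphic_polynomial_poly_eval:
  fixes ix :: "nat \<Rightarrow> 'n::finite"
  shows "holomorphic_polynomial (poly_eval ix P)"
proof -
  have power: "holomorphic_polynomial (\<lambda>z :: complex ^ 'n. z $ ix i ^ k)" for i k
    by (induction k) (auto intro: holomorphic_polynomial_const holomorphic_polynomial_nth holomorphic_polynomial_mult)
  have prod: "finite I \<Longrightarrow> holomorphic_polynomial (\<lambda>z :: complex ^ 'n. \<Prod>i\<in>I. z $ ix i ^ e i)" for I e
    by (induction I rule: finite_induct) (auto intro: holomorphic_polynomial_const power holomorphic_polynomial_mult)
  have "finite A \<Longrightarrow> holomorphic_polynomial (\<lambda>z :: complex ^ 'n.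
      \<Sum>a\<in>A. Poly_Mapping.lookup P a * (\<Prod>i\<in>Poly_Mapping.keys a. (z $ ix i) ^ Poly_Mapping.lookup a i))" for A
    by (induction A rule: finite_induct)
      (auto intro!: holomorphic_polynomial_const holomorphic_polynomial_add holomorphic_polynomial_mult prod)
  then show ?thesis unfolding poly_eval_def[abs_def] by simp
qed

text \<open>The vector with entries \<open>|z|\<^sup>2 d\<^sub>i - L cnj z\<^sub>i\<close> is, up to conjugation and the factor \<open>|z|\<^sup>2\<close>, the
  component of the gradient orthogonal to \<open>z\<close>.\<close>
lemma slope_bounds:
  fixes F L :: complex and z :: "complex ^ 'n::finite" and d :: "'n \<Rightarrow> complex"
  assumes "(norm z)\<^sup>2 * (((cmod F)\<^sup>2 / 16)\<^sup>2 - (Re (cnj F * L))\<^sup>2) -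
    (cmod F)\<^sup>2 * (\<Sum>i\<in>UNIV. (cmod (of_real ((norm z)\<^sup>2) * d i - L * cnj (z $ i)))\<^sup>2) > 0"
  shows "F \<noteq> 0" and "\<bar>Re (L / F)\<bar> \<le> 1 / 16"
    and "norm z * norm (d i) \<le> (norm (L / F) + 1 / 16) * norm F"
proof -
  define Q where "Q i = of_real ((norm z)\<^sup>2) * d i - L * cnj (z $ i)" for i
  have Qsum: "0 \<le> (\<Sum>i\<in>UNIV. (cmod (Q i))\<^sup>2)" by (simp add: sum_nonneg)
  \<comment> \<open>This one inequality carries both bounds: its right side is nonnegative, which
    bounds the real part, and discarding the real part on the left bounds the sum.\<close>
  have pos: "(norm z)\<^sup>2 * (((cmod F)\<^sup>2 / 16)\<^sup>2 - (Re (cnj F * L))\<^sup>2) >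
      (cmod F)\<^sup>2 * (\<Sum>i\<in>UNIV. (cmod (Q i))\<^sup>2)"
    using assms by (simp add: Q_def)
  show F: "F \<noteq> 0" using pos by auto
  have "0 \<le> (cmod F)\<^sup>2 * (\<Sum>i\<in>UNIV. (cmod (Q i))\<^sup>2)" using Qsum by simp
  with pos have z: "norm z > 0" by auto
  have "(norm z)\<^sup>2 * (((cmod F)\<^sup>2 / 16)\<^sup>2 - (Re (cnj F * L))\<^sup>2) > 0"
    using pos Qsum by (meson le_less_trans mult_nonneg_nonneg zero_le_power2)
  then have "(Re (cnj F * L))\<^sup>2 \<le> ((cmod F)\<^sup>2 / 16)\<^sup>2" using z by (simp add: zero_less_mult_iff)
  then have "\<bar>Re (cnj F * L)\<bar> \<le> (cmod F)\<^sup>2 / 16" by (simp flip: abs_le_square_iff)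
  moreover have "Re (L / F) = Re (cnj F * L) / (cmod F)\<^sup>2"
    by (simp add: Re_divide cmod_power2 algebra_simps)
  ultimately show "\<bar>Re (L / F)\<bar> \<le> 1 / 16"
    using F by (simp add: abs_divide pos_divide_le_eq)
  have "(cmod F)\<^sup>2 * (cmod (Q i))\<^sup>2 \<le> (cmod F)\<^sup>2 * (\<Sum>i\<in>UNIV. (cmod (Q i))\<^sup>2)"
    by (intro mult_left_mono member_le_sum) auto
  also have "\<dots> \<le> (norm z)\<^sup>2 * (((cmod F)\<^sup>2 / 16)\<^sup>2)"
    using pos by (smt (verit) mult_left_mono zero_le_power2)
  also have "\<dots> = (cmod F)\<^sup>2 * (norm z * cmod F / 16)\<^sup>2" by (simp add: power2_eq_square)
  finally have "(cmod (Q i))\<^sup>2 \<le> (norm z * cmod F / 16)\<^sup>2" using F by simp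
  then have Q: "cmod (Q i) \<le> norm z * cmod F / 16" by (rule power2_le_imp_le) simp
  have "norm z * (norm z * norm (d i)) = norm (of_real ((norm z)\<^sup>2) * d i)"
    by (simp add: norm_mult norm_power power2_eq_square)
  also have "\<dots> = norm (L * cnj (z $ i) + Q i)" by (simp add: Q_def)
  also have "\<dots> \<le> norm L * norm z + norm z * cmod F / 16"
    using Q by (intro order.trans[OF norm_triangle_ineq] add_mono)
      (simp_all add: norm_mult mult_left_mono Finite_Cartesian_Product.norm_nth_le)
  also have "\<dots> = norm z * (norm L + cmod F / 16)" by (simp add: algebra_simps)
  finally have "norm z * norm (d i) \<le> norm L + cmod F / 16" using z by simp
  also have "\<dots> = (norm (L / F) + 1 / 16) * norm F" using F by (simp add: norm_divide field_simps)
  finally show "norm z * norm (d i) \<le> (norm (L / F) + 1 / 16) * norm F" .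
qed

text \<open>The equations for \<open>d\<close> say that the gradient of \<open>arg f\<close>, which is \<open>\<i> cnj (d / f)\<close>, equals
  \<open>s z\<close>.\<close>
lemma gradient_arg_not_radial:
  fixes f :: "complex ^ 'n::finite \<Rightarrow> complex"
  assumes f: "holomorphic_polynomial f" and f0: "f 0 = 0"
  shows "\<exists>e>0. \<forall>z s d. norm z \<le> e \<and> f z \<noteq> 0 \<and>
    (f has_derivative (\<lambda>v. \<Sum>i\<in>UNIV. d i * v $ i)) (at z) \<longrightarrow>
    \<not> (\<forall>i. d i = \<i> * of_real s * f z * cnj (z $ i))"
proof (rule ccontr)
  assume contr: "\<not> ?thesis"
  obtain d where d: "\<And>i. complex_polynomial (d i)"
    "\<And>z. (f has_derivative (\<lambda>v. \<Sum>i\<in>UNIV. d i z * v $ i)) (at z)"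
    using f unfolding holomorphic_polynomial_def by blast
  have fp: "complex_polynomial f" using f unfolding holomorphic_polynomial_def by blast
  define L where "L z = (\<Sum>i\<in>UNIV. d i z * z $ i)" for z
  \<comment> \<open>At the points to be excluded the real part and all entries of the sum vanish,
    which leaves the positive value
    \<open>(norm z)\<^sup>2 * ((cmod (f z))\<^sup>2 / 16)\<^sup>2\<close>.\<close>
  define g where "g z = (norm z)\<^sup>2 * (((cmod (f z))\<^sup>2 / 16)\<^sup>2 - (Re (cnj (f z) * L z))\<^sup>2) -
    (cmod (f z))\<^sup>2 * (\<Sum>i\<in>UNIV. (cmod (of_real ((norm z)\<^sup>2) * d i z - L z * cnj (z $ i)))\<^sup>2)" for z
  have Lp: "complex_polynomial L"
    unfolding L_def[abs_def] by (intro complex_polynomial_sum complex_polynomial_mult d(1) complex_polynomial_nth) simp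
  have norm_sq: "(norm z)\<^sup>2 = (\<Sum>i\<in>UNIV. (cmod (z $ i))\<^sup>2)" for z :: "complex ^ 'n"
    by (simp add: norm_vec_def L2_set_def sum_nonneg)
  have np: "real_polynomial_function (\<lambda>z :: complex ^ 'n. (norm z)\<^sup>2)"
    unfolding norm_sq by (intro real_polynomial_function_sum real_polynomial_function_cmod_power2 complex_polynomial_nth) simp
  have Rp: "real_polynomial_function (\<lambda>z. Re (cnj (f z) * L z))"
    using complex_polynomial_mult[OF complex_polynomial_cnj[OF fp] Lp] by (simp only: complex_polynomial_def)
  have gp: "real_polynomial_function g"
    unfolding g_def[abs_def]
    by (intro real_polynomial_function_diff real_polynomial_function.intros(4) np real_polynomial_function_power
        real_polynomial_function_divide Rp real_polynomial_function_sum real_polynomial_function_cmod_power2 fp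
        complex_polynomial_diff complex_polynomial_mult complex_polynomial_of_real d(1) Lp complex_polynomial_cnj
        complex_polynomial_nth) simp
  have pos: "\<exists>z. norm z < e \<and> g z > 0" if e: "e > 0" for e
  proof -
    have "e / 2 > 0" using e by simp
    then obtain z s d' where z: "norm z \<le> e / 2" "f z \<noteq> 0"
      "(f has_derivative (\<lambda>v. \<Sum>i\<in>UNIV. d' i * v $ i)) (at z)"
      "\<And>i. d' i = \<i> * of_real s * f z * cnj (z $ i)"
      using contr by blast
    \<comment> \<open>A derivative determines its coefficients, so \<open>d'\<close> agrees with the
      polynomial partial derivatives at \<open>z\<close>.\<close>
    have "d i z = d' i" for i
    proof -
      have "(\<lambda>v. \<Sum>i\<in>UNIV. d i z * v $ i) = (\<lambda>v. \<Sum>i\<in>UNIV. d' i * v $ i)"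
        using d(2) z(3) by (rule has_derivative_unique)
      from fun_cong[OF this, of "axis i 1"] show ?thesis
        by (simp add: axis_def if_distrib cong: if_cong)
    qed
    then have dz: "d i z = \<i> * of_real s * f z * cnj (z $ i)" for i using z(4) by simp
    have "L z = \<i> * of_real s * f z * of_real ((norm z)\<^sup>2)"
      unfolding L_def dz norm_sq of_real_sum sum_distrib_left
      by (intro sum.cong refl) (simp only: complex_norm_square mult_ac)
    then have Lz: "L z = f z * (\<i> * of_real (s * (norm z)\<^sup>2))" by simp
    have "Re (cnj (f z) * L z) = 0"
    proof -
      have "cnj (f z) * L z = of_real ((cmod (f z))\<^sup>2) * (\<i> * of_real (s * (norm z)\<^sup>2))"
        unfolding Lz complex_norm_square by (simp add: mult_ac)
      then show ?thesis by simp
    qed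
    moreover have "of_real ((norm z)\<^sup>2) * d i z - L z * cnj (z $ i) = 0" for i
      unfolding dz Lz by simp
    moreover have "z \<noteq> 0" using z(2) f0 by auto
    ultimately have "g z > 0" unfolding g_def using z(2) by simp
    moreover have "norm z < e" using z(1) e by simp
    ultimately show ?thesis by blast
  qed
  obtain X H where XH: "hardy_field H" "\<And>b. b \<in> Basis \<Longrightarrow> (\<lambda>t. X t \<bullet> b) \<in> H"
    "\<forall>\<^sub>F t in at_right 0. g (X t) > 0" "(X \<longlongrightarrow> 0) (at_right 0)"
    using curve_selection[OF gp pos] by blast
  interpret hardy_field H by (rule XH(1))
  have slope: "\<forall>\<^sub>F t in at_right 0. f (X t) \<noteq> 0 \<and> \<bar>Re (L (X t) / f (X t))\<bar> \<le> 1 / 16 \<and>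
      (\<forall>i. norm (X t) * norm (d i (X t)) \<le> (norm (L (X t) / f (X t)) + 1 / 16) * norm (f (X t)))"
    using XH(3)
  proof eventually_elim
    case (elim t)
    note b = slope_bounds[OF elim[unfolded g_def]]
    show ?case using b by blast
  qed
  have Re: "(\<lambda>t. Re (f (X t))) \<in> H" and Im: "(\<lambda>t. Im (f (X t))) \<in> H"
    using fp[unfolded complex_polynomial_def]
      polynomial_function[of "\<lambda>z. Re (f z)" X] polynomial_function[of "\<lambda>z. Im (f z)" X] XH(2)
    by simp_all
  have "(\<lambda>t. (Re (f (X t)))\<^sup>2 - (Im (f (X t)))\<^sup>2) \<in> H" by (intro diff power Re Im)
  from eventually_trichotomy(2)[OF sign[OF this]] show False
  proof
    assume "\<forall>\<^sub>F t in at_right 0. (Re (f (X t)))\<^sup>2 - (Im (f (X t)))\<^sup>2 \<ge> 0"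
    then have "\<forall>\<^sub>F t in at_right 0. \<bar>Im (f (X t))\<bar> \<le> \<bar>Re (f (X t))\<bar>"
      by eventually_elim (simp add: abs_le_square_iff)
    from no_curve_of_small_slope[OF XH(2,4) f0 d(2) Re Im slope[unfolded L_def] this] show False .
  next
    assume "\<forall>\<^sub>F t in at_right 0. (Re (f (X t)))\<^sup>2 - (Im (f (X t)))\<^sup>2 < 0"
    \<comment> \<open>Multiplication by \<open>- \<i>\<close> exchanges real and imaginary parts up
      to sign and leaves \<open>L / f\<close> unchanged; the real part dominates again.\<close>
    then have dom: "\<forall>\<^sub>F t in at_right 0. \<bar>Im (- \<i> * f (X t))\<bar> \<le> \<bar>Re (- \<i> * f (X t))\<bar>"
      by eventually_elim (simp add: abs_le_square_iff)
    have d': "((\<lambda>z. - \<i> * f z) has_derivative (\<lambda>v. \<Sum>i\<in>UNIV. (- \<i> * d i z) * v $ i)) (at z)" for z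
      using has_derivative_mult_right[OF d(2), of "- \<i>" z] by (simp add: sum_distrib_left sum_negf mult_ac)
    have L': "(\<Sum>i\<in>UNIV. (- \<i> * d i z) * z $ i) = - \<i> * L z" for z
      by (simp add: L_def sum_distrib_left sum_negf mult_ac)
    show False
    proof (rule no_curve_of_small_slope[OF XH(2,4) _ d' _ _ _ dom])
      show "\<forall>\<^sub>F t in at_right 0. - \<i> * f (X t) \<noteq> 0 \<and>
          \<bar>Re ((\<Sum>i\<in>UNIV. (- \<i> * d i (X t)) * X t $ i) / (- \<i> * f (X t)))\<bar> \<le> 1 / 16 \<and>
          (\<forall>i. norm (X t) * norm (- \<i> * d i (X t)) \<le>
            (norm ((\<Sum>i\<in>UNIV. (- \<i> * d i (X t)) * X t $ i) / (- \<i> * f (X t))) + 1 / 16) * norm (- \<i> * f (X t)))"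
        unfolding L' using slope by eventually_elim (simp add: norm_mult)
      show "(\<lambda>t. Re (- \<i> * f (X t))) \<in> H" using Im by simp
      show "(\<lambda>t. Im (- \<i> * f (X t))) \<in> H" using minus[OF Re] by simp
    qed (use f0 in auto)
  qed
qed

section \<open>Singular points of the product map\<close>

text \<open>In the logarithmic derivative \<open>F' v / F p\<close> the real part changes the
  modulus and the imaginary part the argument; normalization keeps only the latter, as a rotation
  speed.\<close>

lemma has_derivative_divide_cmod:
  fixes F :: "'a::real_normed_vector \<Rightarrow> complex"
  assumes F: "(F has_derivative F') (at p)" and nz: "F p \<noteq> 0"
  shows "((\<lambda>z. F z / of_real (cmod (F z))) has_derivative
    (\<lambda>v. \<i> * of_real (Im (F' v / F p)) * (F p / of_real (cmod (F p))))) (at p)"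
proof -
  have "(norm has_derivative (\<lambda>w. w \<bullet> sgn (F p))) (at (F p))"
    using has_derivative_norm[OF nz] by (simp add: inner_commute)
  from diff_chain_at[OF F this]
  have N: "((\<lambda>z. cmod (F z)) has_derivative (\<lambda>v. F' v \<bullet> sgn (F p))) (at p)"
    by (simp add: o_def)
  have N': "((\<lambda>z. of_real (cmod (F z)) :: complex) has_derivative (\<lambda>v. of_real (F' v \<bullet> sgn (F p)))) (at p)"
    by (rule has_derivative_of_real[OF N])
  have inn: "F' v \<bullet> sgn (F p) = cmod (F p) * Re (F' v / F p)" for v
  proof -
    have "F' v \<bullet> sgn (F p) = (F' v \<bullet> F p) / cmod (F p)"
      by (simp add: sgn_div_norm divide_inverse mult.commute)
    moreover have "Re (F' v / F p) = (F' v \<bullet> F p) / (cmod (F p))\<^sup>2"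
      by (simp add: Re_divide inner_complex_def cmod_power2)
    ultimately show ?thesis using nz by (simp add: power2_eq_square)
  qed
  have eq: "(F' v * of_real (cmod (F p)) - F p * of_real (F' v \<bullet> sgn (F p))) /
      (of_real (cmod (F p)) * of_real (cmod (F p))) =
      \<i> * of_real (Im (F' v / F p)) * (F p / of_real (cmod (F p)))" for v
  proof -
    define w where "w = F' v / F p"
    have v: "F' v = w * F p" using nz by (simp add: w_def)
    have w: "w - of_real (Re w) = \<i> * of_real (Im w)" by (simp add: complex_eq_iff)
    have "(F' v * of_real (cmod (F p)) - F p * (of_real (cmod (F p)) * of_real (Re w))) /
        (of_real (cmod (F p)) * of_real (cmod (F p))) = (w - of_real (Re w)) * (F p / of_real (cmod (F p)))"
      using nz by (simp add: v field_simps)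
    also have "\<dots> = \<i> * of_real (Im w) * (F p / of_real (cmod (F p)))" by (simp only: w)
    finally show ?thesis unfolding inn of_real_mult w_def .
  qed
  show ?thesis
    using has_derivative_divide'[OF F N'] nz by (simp add: eq)
qed

lemma has_derivative_vec_lambda:
  fixes G :: "'m::finite \<Rightarrow> 'a::real_normed_vector \<Rightarrow> 'b::euclidean_space"
  assumes "\<And>a. (G a has_derivative G' a) (at p)"
  shows "((\<lambda>z. \<chi> a. G a z) has_derivative (\<lambda>v. \<chi> a. G' a v)) (at p)"
proof (subst has_derivative_componentwise_within, intro ballI)
  fix b :: "'b ^ 'm" assume "b \<in> Basis"
  then obtain a u where b: "b = axis a u" by (auto simp: Basis_vec_def)
  show "((\<lambda>z. (\<chi> a. G a z) \<bullet> b) has_derivative (\<lambda>v. (\<chi> a. G' a v) \<bullet> b)) (at p)"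
    unfolding b inner_axis using has_derivative_inner_left[OF assms[of a], of u] by simp
qed

text \<open>The coefficients \<open>c\<close> form a covector orthogonal to the image of the tangent space.\<close>
lemma dependent_arguments:
  fixes \<theta> :: "'m::finite \<Rightarrow> 'a::euclidean_space \<Rightarrow> real" and G :: "'m \<Rightarrow> complex"
  assumes lin: "\<And>a. linear (\<theta> a)" and G: "\<And>a. G a \<noteq> 0" and p: "p \<noteq> 0"
    and rank: "dim ((\<lambda>v. \<chi> a. \<i> * of_real (\<theta> a v) * G a) ` {v. v \<bullet> p = 0}) < CARD('m)"
  shows "\<exists>(c :: 'm \<Rightarrow> real) s. (\<exists>a. c a \<noteq> 0) \<and> (\<forall>v. (\<Sum>a\<in>UNIV. c a * \<theta> a v) = s * (v \<bullet> p))"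
proof -
  \<comment> \<open>The map \<kappa> sends angular velocities to tangent vectors of the torus. It is
    injective since no \<open>G a\<close> vanishes, so the rank can be computed with the real
    functionals \<open>\<theta> a\<close>.\<close>
  define \<kappa> :: "real ^ 'm \<Rightarrow> complex ^ 'm" where "\<kappa> y = (\<chi> a. \<i> * of_real (y $ a) * G a)" for y
  define \<Theta> :: "'a \<Rightarrow> real ^ 'm" where "\<Theta> v = (\<chi> a. \<theta> a v)" for v
  have \<kappa>: "linear \<kappa>"
  proof (rule linearI)
    show "\<kappa> (r *\<^sub>R y) = r *\<^sub>R \<kappa> y" for r y
      by (simp add: \<kappa>_def vec_eq_iff) (simp add: scaleR_conv_of_real)
  qed (simp add: \<kappa>_def vec_eq_iff algebra_simps)
  have "inj \<kappa>"
    by (rule injI) (use G in \<open>simp add: \<kappa>_def vec_eq_iff\<close>)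
  let ?T = "{v. v \<bullet> p = 0}"
  have "(\<lambda>v. \<chi> a. \<i> * of_real (\<theta> a v) * G a) ` ?T = \<kappa> ` (\<Theta> ` ?T)"
    by (simp add: image_image \<kappa>_def \<Theta>_def)
  moreover have "dim (\<kappa> ` (\<Theta> ` ?T)) = dim (\<Theta> ` ?T)"
    using \<open>inj \<kappa>\<close> by (intro dim_image_eq[OF \<kappa>]) (auto intro: inj_on_subset)
  ultimately have "dim (\<Theta> ` ?T) < DIM(real ^ 'm)" using rank by simp
  then obtain c where c: "c \<noteq> 0" "\<And>y. y \<in> span (\<Theta> ` ?T) \<Longrightarrow> orthogonal c y"
    using orthogonal_to_subspace_exists by blast
  define \<phi> where "\<phi> v = (\<Sum>a\<in>UNIV. c $ a * \<theta> a v)" for v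
  have \<phi>: "linear \<phi>"
    unfolding \<phi>_def using lin
    by (intro linearI) (simp_all add: linear_add linear_cmul sum.distrib distrib_left sum_distrib_left mult_ac)
  have zero: "\<phi> v = 0" if "v \<bullet> p = 0" for v
  proof -
    have "orthogonal c (\<Theta> v)" using that by (intro c(2) span_base) auto
    then show ?thesis by (simp add: orthogonal_def inner_vec_def \<phi>_def \<Theta>_def)
  qed
  \<comment> \<open>A linear form that vanishes on the orthogonal complement of \<open>p\<close> is
    determined by its value at \<open>p\<close>.\<close>
  have "(\<Sum>a\<in>UNIV. c $ a * \<theta> a v) = \<phi> p / (p \<bullet> p) * (v \<bullet> p)" for v
  proof -
    have "\<phi> (v - ((v \<bullet> p) / (p \<bullet> p)) *\<^sub>R p) = 0"
      using p by (intro zero) (simp add: inner_diff_left)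
    then show ?thesis
      by (simp add: linear_diff[OF \<phi>] linear_cmul[OF \<phi>] \<phi>_def[of v, symmetric])
  qed
  moreover have "\<exists>a. c $ a \<noteq> 0" using c(1) by (simp add: vec_eq_iff)
  ultimately show ?thesis by (intro exI[of _ "\<lambda>a. c $ a"] exI[of _ "\<phi> p / (p \<bullet> p)"]) blast
qed

section \<open>Projection to blocks of variables\<close>

definition block_proj :: "'n set \<Rightarrow> complex ^ 'n::finite \<Rightarrow> complex ^ 'n" where
  "block_proj B z = (\<chi> i. if i \<in> B then z $ i else 0)"

lemma bounded_linear_block_proj: "bounded_linear (block_proj B)"
  by (intro linear_conv_bounded_linear[THEN iffD1] linearI)
    (simp_all add: block_proj_def vec_eq_iff)

lemma norm_block_proj_le: "norm (block_proj B z) \<le> norm z"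
  unfolding norm_vec_def by (intro L2_set_mono) (auto simp: block_proj_def)

lemma poly_eval_block_proj:
  assumes "ix ` poly_vars P \<subseteq> B"
  shows "poly_eval ix P (block_proj B z) = poly_eval ix P z"
  unfolding poly_eval_def
proof (intro sum.cong refl arg_cong2[where f = "(*)"] prod.cong)
  fix a i assume "a \<in> Poly_Mapping.keys P" "i \<in> Poly_Mapping.keys a"
  then have "ix i \<in> B" using assms by (auto simp: poly_vars_def)
  then show "(block_proj B z $ ix i) ^ Poly_Mapping.lookup a i = (z $ ix i) ^ Poly_Mapping.lookup a i"
    by (simp add: block_proj_def)
qed

text \<open>A block is kept inside the full space by setting the other coordinates to 0, so Milnor's
  lemma applies to every factor in the same space. The chain rule for the composition of
  \<open>F\<close> with the projection moves the derivative from \<open>p\<close> to its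
  projection.\<close>

lemma derivative_block_proj:
  assumes inv: "\<And>z. F (block_proj B z) = F z"
    and "(F has_derivative D) (at p)" "(F has_derivative D') (at (block_proj B p))"
  shows "D v = D' (block_proj B v)"
proof -
  have "((\<lambda>z. F (block_proj B z)) has_derivative (\<lambda>v. D' (block_proj B v))) (at p)"
    using diff_chain_at[OF bounded_linear_imp_has_derivative[OF bounded_linear_block_proj] assms(3)]
    by (simp add: o_def)
  then have "(F has_derivative (\<lambda>v. D' (block_proj B v))) (at p)" by (simp add: inv)
  from has_derivative_unique[OF assms(2) this] show ?thesis by (rule fun_cong)
qed

theorem proposition5p2:
  fixes m n :: nat and k :: "nat \<Rightarrow> nat" and f :: "nat \<Rightarrow> cpoly"
    and ix :: "nat \<Rightarrow> 'n::finite" and jx :: "'m::finite \<Rightarrow> nat"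
  assumes "m \<ge> 2"
    and "k 0 = 0" and "\<And>j. j < m \<Longrightarrow> k j < k (Suc j)" and "k m = n"
    and "bij_betw ix {1..n} (UNIV :: 'n set)"
    and "bij_betw jx (UNIV :: 'm set) {1..m}"
    and "\<And>j. j \<in> {1..m} \<Longrightarrow> poly_vars (f j) \<subseteq> {k (j - 1) + 1..k j}"
    and "\<And>j. j \<in> {1..m} \<Longrightarrow> poly_eval ix (f j) 0 = 0"
  shows "\<exists>\<epsilon>\<^sub>0>0. \<forall>\<epsilon>. 0 < \<epsilon> \<and> \<epsilon> \<le> \<epsilon>\<^sub>0 \<longrightarrow>
    \<not> (\<exists>p :: complex ^ 'n. milnor_singular_point ix jx m f \<epsilon> p)"
proof -
  have k_mono: "k i \<le> k j" if "i \<le> j" "j \<le> m" for i j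
    using that
  proof (induction j rule: dec_induct)
    case (step j)
    then show ?case using assms(3)[of j] by simp
  qed simp
  define B where "B j = ix ` {k (j - 1) + 1..k j}" for j
  have disjoint: "B i \<inter> B j = {}" if "i \<in> {1..m}" "j \<in> {1..m}" "i \<noteq> j" for i j
  proof -
    have *: "B i \<inter> B j = {}" if ij: "i \<in> {1..m}" "j \<in> {1..m}" "i < j" for i j
    proof -
      have "k i \<le> k (j - 1)" using ij by (intro k_mono) auto
      then have "{k (i - 1) + 1..k i} \<inter> {k (j - 1) + 1..k j} = {}" by auto
      moreover have "{k (i - 1) + 1..k i} \<subseteq> {1..n}" "{k (j - 1) + 1..k j} \<subseteq> {1..n}"
        using k_mono[of i m] k_mono[of j m] ij assms(4) by auto
      moreover have "inj_on ix {1..n}" using assms(5) by (rule bij_betw_imp_inj_on)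
      ultimately show ?thesis unfolding B_def by (simp flip: inj_on_image_Int)
    qed
    then show ?thesis using that by (metis inf_commute linorder_neqE_nat)
  qed
  have proj: "poly_eval ix (f j) (block_proj (B j) z) = poly_eval ix (f j) z"
    if "j \<in> {1..m}" for j and z :: "complex ^ 'n"
    using assms(7)[OF that] by (intro poly_eval_block_proj) (auto simp: B_def)
  have "\<exists>e>0. \<forall>z s d. norm z \<le> e \<and> poly_eval ix (f j) z \<noteq> 0 \<and>
      (poly_eval ix (f j) has_derivative (\<lambda>v. \<Sum>i\<in>UNIV. d i * v $ i)) (at z) \<longrightarrow>
      \<not> (\<forall>i. d i = \<i> * of_real s * poly_eval ix (f j) z * cnj (z $ i))" if "j \<in> {1..m}" for j
    by (rule gradient_arg_not_radial[OF holomorphic_polynomial_poly_eval assms(8)[OF that]])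
  then obtain e where e: "\<And>j. j \<in> {1..m} \<Longrightarrow> e j > 0"
    "\<And>j z s d. j \<in> {1..m} \<Longrightarrow> norm z \<le> e j \<Longrightarrow> poly_eval ix (f j) z \<noteq> 0 \<Longrightarrow>
      (poly_eval ix (f j) has_derivative (\<lambda>v. \<Sum>i\<in>UNIV. d i * v $ i)) (at z) \<Longrightarrow>
      \<not> (\<forall>i. d i = \<i> * of_real s * poly_eval ix (f j) z * cnj (z $ i))"
    using bchoice[of "{1..m}" "\<lambda>j e. e > 0 \<and> (\<forall>z s d. norm z \<le> e \<and> poly_eval ix (f j) z \<noteq> 0 \<and>
      (poly_eval ix (f j) has_derivative (\<lambda>v. \<Sum>i\<in>UNIV. d i * v $ i)) (at z) \<longrightarrow>
      \<not> (\<forall>i. d i = \<i> * of_real s * poly_eval ix (f j) z * cnj (z $ i)))"] by blast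
  \<comment> \<open>One radius serves all factors because projecting to a block does not increase
    the norm.\<close>
  define \<epsilon>\<^sub>0 where "\<epsilon>\<^sub>0 = Min (e ` {1..m})"
  have ne: "e ` {1..m} \<noteq> {}" using assms(1) by auto
  have "\<epsilon>\<^sub>0 > 0" unfolding \<epsilon>\<^sub>0_def using e(1) ne by (subst Min_gr_iff) auto
  have jx: "jx a \<in> {1..m}" for a using assms(6) by (auto simp: bij_betw_def)
  have m: "m = CARD('m)" using bij_betw_same_card[OF assms(6)] by simp
  have False if \<epsilon>: "0 < \<epsilon>" "\<epsilon> \<le> \<epsilon>\<^sub>0" and sing: "milnor_singular_point ix jx m f \<epsilon> p"
    for \<epsilon> and p :: "complex ^ 'n"
  proof -
    define F where "F a = (poly_eval ix (f (jx a)) :: complex ^ 'n \<Rightarrow> complex)" for a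
    have norm_p: "norm p = \<epsilon>" and link: "p \<in> sphere 0 \<epsilon> - milnor_link ix m f \<epsilon>"
      using sing by (auto simp: milnor_singular_point_def)
    have "p \<noteq> 0" using norm_p \<epsilon>(1) by auto
    have nz: "F a p \<noteq> 0" for a
    proof -
      have "(\<Prod>j=1..m. poly_eval ix (f j) p) \<noteq> 0" using link by (auto simp: milnor_link_def)
      then show ?thesis using jx[of a] by (simp add: F_def)
    qed
    obtain U where U: "open U" "sphere 0 \<epsilon> - milnor_link ix m f \<epsilon> = sphere 0 \<epsilon> \<inter> U"
      using sphere_minus_milnor_link[of \<epsilon> ix m f] by (elim exE conjE)
    have "p \<in> U" using link unfolding U(2) by blast
    from tangent_space_sphere[OF U(1) this norm_p \<epsilon>(1)]
    have tangent: "tangent_space (sphere 0 \<epsilon> - milnor_link ix m f \<epsilon>) p = {v. v \<bullet> p = 0}"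
      unfolding U(2) .
    have "\<exists>d. \<forall>z. (F a has_derivative (\<lambda>v. \<Sum>i\<in>UNIV. d i z * v $ i)) (at z)" for a
      using holomorphic_polynomial_poly_eval[of ix "f (jx a)"]
      unfolding holomorphic_polynomial_def F_def by blast
    then obtain d where d: "\<And>a z. (F a has_derivative (\<lambda>v. \<Sum>i\<in>UNIV. d a i z * v $ i)) (at z)"
      using choice[of "\<lambda>a d. \<forall>z. (F a has_derivative (\<lambda>v. \<Sum>i\<in>UNIV. d i z * v $ i)) (at z)"] by blast
    define D where "D a z v = (\<Sum>i\<in>UNIV. d a i z * v $ i)" for a z and v :: "complex ^ 'n"
    have D: "(F a has_derivative D a z) (at z)" for a z
      unfolding D_def[abs_def] by (rule d)
    define \<theta> where "\<theta> a v = Im (D a p v / F a p)" for a v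
    define G where "G a = F a p / of_real (cmod (F a p))" for a
    have "(milnor_product_map ix jx f has_derivative (\<lambda>v. \<chi> a. \<i> * of_real (\<theta> a v) * G a)) (at p)"
      unfolding milnor_product_map_def[abs_def] \<theta>_def G_def
      by (intro has_derivative_vec_lambda, fold F_def, intro has_derivative_divide_cmod D nz)
    then have "frechet_derivative (milnor_product_map ix jx f) (at p) =
        (\<lambda>v. \<chi> a. \<i> * of_real (\<theta> a v) * G a)"
      by (rule frechet_derivative_at[symmetric])
    then have rank: "dim ((\<lambda>v. \<chi> a. \<i> * of_real (\<theta> a v) * G a) ` {v. v \<bullet> p = 0}) < CARD('m)"
      using sing tangent by (simp add: milnor_singular_point_def differential_rank_def m)
    have "linear (\<theta> a)" for a
    proof -
      have lin: "linear (D a p)" using D by (rule has_derivative_linear)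
      show ?thesis
      proof (rule linearI)
        show "\<theta> a (r *\<^sub>R v) = r *\<^sub>R \<theta> a v" for r v
        proof -
          have "(r *\<^sub>R D a p v) / F a p = r *\<^sub>R (D a p v / F a p)"
            by (simp add: scaleR_conv_of_real)
          then show ?thesis unfolding \<theta>_def linear_cmul[OF lin] by (simp only: scaleR_complex.sel real_scaleR_def)
        qed
      qed (simp add: \<theta>_def linear_add[OF lin] add_divide_distrib)
    qed
    then obtain c s where c: "\<exists>a. c a \<noteq> 0" "\<And>v. (\<Sum>a\<in>UNIV. c a * \<theta> a v) = s * (v \<bullet> p)"
      using dependent_arguments[of \<theta> G p] nz \<open>p \<noteq> 0\<close> rank by (force simp: G_def)
    then obtain a where a: "c a \<noteq> 0" by blast
    define w where "w = block_proj (B (jx a)) p"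
    have inv: "F b (block_proj (B (jx b)) z) = F b z" for b z
      unfolding F_def by (rule proj[OF jx])
    have Dproj: "D b p v = D b (block_proj (B (jx b)) p) (block_proj (B (jx b)) v)" for b v
      by (rule derivative_block_proj[OF inv D D])
    \<comment> \<open>Testing the relation with vectors of a single block removes all other factors,
      the blocks being disjoint. The inner product on the right then sees only
      \<open>w\<close>.\<close>
    have block: "c a * Im (D a w v / F a w) = s * (block_proj (B (jx a)) v \<bullet> p)" for v
    proof -
      let ?u = "block_proj (B (jx a)) v"
      have "\<theta> b ?u = 0" if "b \<noteq> a" for b
      proof -
        have "jx b \<noteq> jx a" using that assms(6) by (auto simp: bij_betw_def dest: injD)
        then have "B (jx b) \<inter> B (jx a) = {}" using jx by (intro disjoint) auto
        then have "block_proj (B (jx b)) ?u = 0" by (auto simp: block_proj_def vec_eq_iff)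
        then show ?thesis using Dproj[of b ?u] by (simp add: \<theta>_def D_def)
      qed
      then have "(\<Sum>b\<in>UNIV. c b * \<theta> b ?u) = (\<Sum>b\<in>UNIV. if b = a then c a * \<theta> a ?u else 0)"
        by (intro sum.cong) auto
      then have "c a * \<theta> a ?u = s * (?u \<bullet> p)" using c(2)[of ?u] by simp
      moreover have "D a p ?u = D a w v"
      proof -
        have idem: "block_proj B (block_proj B z) = block_proj B z" for B and z :: "complex ^ 'n"
          by (simp add: block_proj_def vec_eq_iff)
        have "D a w v = D a (block_proj (B (jx a)) w) (block_proj (B (jx a)) v)"
          by (rule derivative_block_proj[OF inv D D])
        then show ?thesis using Dproj[of a ?u] by (simp add: w_def idem)
      qed
      moreover have "F a w = F a p" unfolding w_def by (rule inv)
      ultimately show ?thesis by (simp add: \<theta>_def)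
    qed
    have "d a i w = \<i> * of_real (s / c a) * F a w * cnj (w $ i)" for i
    proof -
      define \<delta> where "\<delta> = d a i w / F a w"
      have Fw: "F a w \<noteq> 0" using inv[of a p] nz[of a] by (simp add: w_def)
      have Dax: "D a w (axis i \<zeta>) = d a i w * \<zeta>" for \<zeta>
        by (simp add: D_def axis_def if_distrib cong: if_cong)
      have pax: "block_proj (B (jx a)) (axis i \<zeta>) \<bullet> p = Re (\<zeta> * cnj (w $ i))" for \<zeta>
      proof -
        have "block_proj (B (jx a)) (axis i \<zeta>) = axis i (if i \<in> B (jx a) then \<zeta> else 0)"
          by (auto simp: block_proj_def axis_def vec_eq_iff)
        then show ?thesis by (simp add: inner_axis' w_def block_proj_def inner_complex_def)
      qed
      have eq: "c a * Im (\<delta> * \<zeta>) = s * Re (\<zeta> * cnj (w $ i))" for \<zeta>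
        using block[of "axis i \<zeta>"] by (simp add: Dax pax \<delta>_def)
      \<comment> \<open>The directions 1 and \<open>\<i>\<close> in the \<open>i\<close>-th
        coordinate give the imaginary and the real part of \<delta>; together they form the radial
        equation with factor \<open>s / c a\<close>.\<close>
      have "Im \<delta> = s / c a * Re (w $ i)" "Re \<delta> = s / c a * Im (w $ i)"
        using eq[of 1] eq[of \<i>] a by (simp_all add: field_simps)
      then have "\<delta> = \<i> * of_real (s / c a) * cnj (w $ i)"
        by (simp add: complex_eq_iff)
      then show ?thesis using Fw by (simp add: \<delta>_def field_simps)
    qed
    moreover have "norm w \<le> e (jx a)"
    proof -
      have "\<epsilon>\<^sub>0 \<le> e (jx a)" unfolding \<epsilon>\<^sub>0_def using jx by (intro Min_le) auto
      then show ?thesis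
        using norm_block_proj_le[of "B (jx a)" p] norm_p \<epsilon>(2) by (simp add: w_def)
    qed
    moreover have "F a w \<noteq> 0" using inv[of a p] nz[of a] by (simp add: w_def)
    ultimately show False
      using e(2)[OF jx[of a], of w "\<lambda>i. d a i w" "s / c a"] d[of a w] unfolding F_def by blast
  qed
  with \<open>\<epsilon>\<^sub>0 > 0\<close> show ?thesis by blast
qed

end
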